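(* Let $(X,\mathcal{B}_X,\mu,T)$ be a $\mathbb{Z}^2$-measure preserving dynamical system and let $\vec{v}=(1,\beta)$ with $\beta\in\mathbb{R}$ irrational. For any $b\in(0,\infty)$, the following two conditions are equivalent. (a) $(X,\mathcal{B}_X,\mu,T)$ is $\vec{v}$-weakly mixing. (b) There exists an infinite sequence $S=\{(m_i,n_i)\}_{i=1}^{\infty}$ of pairwise distinct elements of $\Lambda^{\vec{v}}(b)$ such that $h^{S}_{\mu}(T,\alpha)=H_{\mu}(\alpha)$ for every finite measurable partition $\alpha$ of $X$.
   Context: A $\mathbb{Z}^2$-measure preserving dynamical system $(X,\mathcal{B}_X,\mu,T)$ consists of a compact metric space $X$, its Borel $\sigma$-algebra $\mathcal{B}_X$, a group homomorphism $(m,n)\mapsto T^{(m,n)}$ from the additive group $\mathbb{Z}^2$ to the group of homeomorphisms of $X$, and a Borel probability measure $\mu$ invariant under every $T^{(m,n)}$. For $f\in L^2(X,\mathcal{B}_X,\mu)$, $U_T^{(m,n)}f=f\circ T^{(m,n)}$; $1_B$ is the indicator function of $B$. For $\vec{v}=(1,\beta)$ and $b\in(0,\infty)$, $\Lambda^{\vec{v}}(b)=\{(m,n)\in\mathbb{Z}^2:\beta m-b\le n\le\beta m+b\}$. The directional Kronecker algebra $\mathcal{K}_\mu^{\vec{v}}$ is the $\sigma$-algebra of all $B\in\mathcal{B}_X$ such that the closure of $\{U_T^{(m,n)}1_B:(m,n)\in\Lambda^{\vec{v}}(b)\}$ is compact in $L^2(X,\mathcal{B}_X,\mu)$; it does not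 depend on the choice of $b\in(0,\infty)$. The system is called $\vec{v}$-weakly mixing if $\mathcal{K}_\mu^{\vec{v}}$ is trivial, i.e. $\mathcal{K}_\mu^{\vec{v}}=\{X,\emptyset\}$ modulo $\mu$-null sets (every $B\in\mathcal{K}_\mu^{\vec{v}}$ has $\mu(B)\in\{0,1\}$). For a finite measurable partition $\alpha$, $H_\mu(\alpha)=-\sum_{A\in\alpha}\mu(A)\log\mu(A)$ (with $0\log 0=0$), $T^{-(m,n)}\alpha=\{T^{-(m,n)}A:A\in\alpha\}$, $\bigvee$ denotes the common refinement of partitions, and for an infinite sequence $S=\{(m_i,n_i)\}_{i=1}^\infty$ in $\Lambda^{\vec{v}}(b)$, $$h^S_\mu(T,\alpha)=\limsup_{k\to\infty}\frac1k H_\mu\Big(\bigvee_{i=1}^k T^{-(m_i,n_i)}\alpha\Big).$$ *)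

theory Defs
  imports "HOL-Analysis.Analysis" "HOL-Probability.Probability"
begin

section \<open>The metric space \<open>L\<^sup>2\<close>\<close>

text \<open>
  Points are classes of square integrable complex functions modulo equality almost everywhere.
\<close>

definition L2_functions :: "'a measure \<Rightarrow> ('a \<Rightarrow> complex) set" where
  "L2_functions M =
     {f. f \<in> borel_measurable M \<and> integrable M (\<lambda>x. (cmod (f x))\<^sup>2)}"

definition L2_rel :: "'a measure \<Rightarrow> (('a \<Rightarrow> complex) \<times> ('a \<Rightarrow> complex)) set" where
  "L2_rel M =
     {(f, g). f \<in> L2_functions M \<and> g \<in> L2_functions M \<and> (AE x in M. f x = g x)}"

definition L2_space :: "'a measure \<Rightarrow> ('a \<Rightarrow> complex) set set" where
  "L2_space M = L2_functions M // L2_rel M"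

definition L2_class :: "'a measure \<Rightarrow> ('a \<Rightarrow> complex) \<Rightarrow> ('a \<Rightarrow> complex) set" where
  "L2_class M f = L2_rel M `` {f}"

definition L2_dist :: "'a measure \<Rightarrow> ('a \<Rightarrow> complex) set \<Rightarrow> ('a \<Rightarrow> complex) set \<Rightarrow> real" where
  "L2_dist M F G =
     sqrt (\<integral>x. (cmod ((SOME f. f \<in> F) x - (SOME g. g \<in> G) x))\<^sup>2 \<partial>M)"

abbreviation L2_topology :: "'a measure \<Rightarrow> ('a \<Rightarrow> complex) set topology" where
  "L2_topology M \<equiv> Metric_space.mtopology (L2_space M) (L2_dist M)"

lemma equiv_L2_rel: "equiv (L2_functions M) (L2_rel M)"
  by (rule equivI) (auto simp: L2_rel_def refl_on_def sym_def trans_def elim: AE_mp)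

lemma L2_class_in_space [simp]: "f \<in> L2_functions M \<Longrightarrow> L2_class M f \<in> L2_space M"
  by (simp add: L2_class_def L2_space_def quotientI)

lemma L2_spaceE:
  assumes "F \<in> L2_space M"
  obtains f where "f \<in> L2_functions M" "F = L2_class M f"
  using assms by (auto simp: L2_class_def L2_space_def elim: quotientE)

lemma L2_class_eq_iff:
  assumes "f \<in> L2_functions M" "g \<in> L2_functions M"
  shows "L2_class M f = L2_class M g \<longleftrightarrow> (AE x in M. f x = g x)"
  using eq_equiv_class_iff[OF equiv_L2_rel assms] assms by (simp add: L2_class_def L2_rel_def)

lemma L2_class_some:
  assumes "f \<in> L2_functions M"
  shows "(SOME g. g \<in> L2_class M f) \<in> L2_functions M"
    and "AE x in M. (SOME g. g \<in> L2_class M f) x = f x"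
proof -
  have "f \<in> L2_class M f"
    using assms by (simp add: L2_class_def L2_rel_def)
  then have "(SOME g. g \<in> L2_class M f) \<in> L2_class M f"
    by (rule someI[of "\<lambda>g. g \<in> L2_class M f"])
  then have "(f, (SOME g. g \<in> L2_class M f)) \<in> L2_rel M"
    by (simp add: L2_class_def)
  then show "(SOME g. g \<in> L2_class M f) \<in> L2_functions M"
    and "AE x in M. (SOME g. g \<in> L2_class M f) x = f x"
    by (auto simp: L2_rel_def elim: AE_mp)
qed

lemma L2_functions_diff:
  assumes f: "f \<in> L2_functions M" and g: "g \<in> L2_functions M"
  shows "(\<lambda>x. f x - g x) \<in> L2_functions M"
proof -
  have [measurable]: "f \<in> borel_measurable M" "g \<in> borel_measurable M"
    using f g by (auto simp: L2_functions_def)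
  have "integrable M (\<lambda>x. (cmod (f x - g x))\<^sup>2)"
  proof (rule Bochner_Integration.integrable_bound)
    show "integrable M (\<lambda>x. 2 * (cmod (f x))\<^sup>2 + 2 * (cmod (g x))\<^sup>2)"
      using f g by (auto simp: L2_functions_def)
    have "(cmod (u - v))\<^sup>2 \<le> 2 * (cmod u)\<^sup>2 + 2 * (cmod v)\<^sup>2" for u v
    proof -
      have "(cmod (u - v))\<^sup>2 \<le> (cmod u + cmod v)\<^sup>2"
        by (intro power_mono norm_triangle_ineq4) auto
      also have "\<dots> \<le> 2 * (cmod u)\<^sup>2 + 2 * (cmod v)\<^sup>2"
        using sum_squares_bound[of "cmod u" "cmod v"] by (simp add: power2_sum)
      finally show ?thesis .
    qed
    then show "AE x in M. norm ((cmod (f x - g x))\<^sup>2)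
        \<le> norm (2 * (cmod (f x))\<^sup>2 + 2 * (cmod (g x))\<^sup>2)"
      by simp
  qed measurable
  then show ?thesis
    by (simp add: L2_functions_def)
qed

lemma L2_dist_class:
  assumes f: "f \<in> L2_functions M" and g: "g \<in> L2_functions M"
  shows "L2_dist M (L2_class M f) (L2_class M g) = sqrt (\<integral>x. (cmod (f x - g x))\<^sup>2 \<partial>M)"
proof -
  have [measurable]: "f \<in> borel_measurable M" "g \<in> borel_measurable M"
    "(SOME h. h \<in> L2_class M f) \<in> borel_measurable M"
    "(SOME h. h \<in> L2_class M g) \<in> borel_measurable M"
    using f g L2_class_some(1)[OF f] L2_class_some(1)[OF g] by (auto simp: L2_functions_def)
  have "AE x in M. (cmod ((SOME h. h \<in> L2_class M f) x - (SOME h. h \<in> L2_class M g) x))\<^sup>2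
      = (cmod (f x - g x))\<^sup>2"
    using L2_class_some(2)[OF f] L2_class_some(2)[OF g] by eventually_elim simp
  then show ?thesis
    unfolding L2_dist_def by (subst integral_cong_AE) auto
qed

lemma L2_Minkowski:
  assumes f: "f \<in> L2_functions M" and g: "g \<in> L2_functions M" and h: "h \<in> L2_functions M"
  shows "sqrt (\<integral>x. (cmod (f x - h x))\<^sup>2 \<partial>M)
      \<le> sqrt (\<integral>x. (cmod (f x - g x))\<^sup>2 \<partial>M) + sqrt (\<integral>x. (cmod (g x - h x))\<^sup>2 \<partial>M)"
proof -
  define u v where "u = (\<lambda>x. cmod (f x - g x))" and "v = (\<lambda>x. cmod (g x - h x))"
  define A B where "A = (\<integral>x. (u x)\<^sup>2 \<partial>M)" and "B = (\<integral>x. (v x)\<^sup>2 \<partial>M)"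
  have [measurable]: "f \<in> borel_measurable M" "g \<in> borel_measurable M" "h \<in> borel_measurable M"
    using f g h by (auto simp: L2_functions_def)
  have [measurable]: "u \<in> borel_measurable M" "v \<in> borel_measurable M"
    by (auto simp: u_def v_def)
  have u2: "integrable M (\<lambda>x. (u x)\<^sup>2)" and v2: "integrable M (\<lambda>x. (v x)\<^sup>2)"
    using L2_functions_diff[OF f g] L2_functions_diff[OF g h]
    by (auto simp: L2_functions_def u_def v_def)
  have pos: "u x \<ge> 0" "v x \<ge> 0" for x
    by (auto simp: u_def v_def)
  have AB: "A \<ge> 0" "B \<ge> 0"
    by (auto simp: A_def B_def)
  have uv: "integrable M (\<lambda>x. u x * v x)"
  proof (rule Bochner_Integration.integrable_bound)
    show "integrable M (\<lambda>x. (u x)\<^sup>2 + (v x)\<^sup>2)"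
      using u2 v2 by auto
    have "u x * v x \<le> (u x)\<^sup>2 + (v x)\<^sup>2" for x
      using sum_squares_bound[of "u x" "v x"] pos[of x]
        mult_nonneg_nonneg[OF pos(1)[of x] pos(2)[of x]] by linarith
    then show "AE x in M. norm (u x * v x) \<le> norm ((u x)\<^sup>2 + (v x)\<^sup>2)"
      using pos by (simp add: abs_mult)
  qed measurable
  have CS: "(\<integral>x. u x * v x \<partial>M) \<le> sqrt A * sqrt B"
  proof -
    have nn: "(\<integral>\<^sup>+x. ennreal (u x) * ennreal (v x) \<partial>M)\<^sup>2
        \<le> (\<integral>\<^sup>+x. (ennreal (u x))\<^sup>2 \<partial>M) * (\<integral>\<^sup>+x. (ennreal (v x))\<^sup>2 \<partial>M)"
      by (rule Cauchy_Schwarz_nn_integral) auto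
    have "(\<integral>\<^sup>+x. ennreal (u x) * ennreal (v x) \<partial>M) = ennreal (\<integral>x. u x * v x \<partial>M)"
      using uv pos by (simp add: nn_integral_eq_integral flip: ennreal_mult)
    moreover have "(\<integral>\<^sup>+x. (ennreal (u x))\<^sup>2 \<partial>M) = ennreal A"
      using u2 pos by (simp add: nn_integral_eq_integral A_def ennreal_power)
    moreover have "(\<integral>\<^sup>+x. (ennreal (v x))\<^sup>2 \<partial>M) = ennreal B"
      using v2 pos by (simp add: nn_integral_eq_integral B_def ennreal_power)
    ultimately have "ennreal ((\<integral>x. u x * v x \<partial>M)\<^sup>2) \<le> ennreal (A * B)"
      using nn pos AB by (simp add: ennreal_power ennreal_mult)
    then have "(\<integral>x. u x * v x \<partial>M)\<^sup>2 \<le> A * B"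
      using AB by simp
    then show ?thesis
      using real_le_rsqrt by (metis real_sqrt_mult)
  qed
  have "(\<integral>x. (cmod (f x - h x))\<^sup>2 \<partial>M) \<le> (\<integral>x. (u x)\<^sup>2 + 2 * (u x * v x) + (v x)\<^sup>2 \<partial>M)"
  proof (rule integral_mono)
    show "integrable M (\<lambda>x. (cmod (f x - h x))\<^sup>2)"
      using L2_functions_diff[OF f h] by (simp add: L2_functions_def)
    show "integrable M (\<lambda>x. (u x)\<^sup>2 + 2 * (u x * v x) + (v x)\<^sup>2)"
      using u2 v2 uv by auto
    fix x
    have "cmod (f x - h x) \<le> u x + v x"
      using norm_triangle_ineq[of "f x - g x" "g x - h x"] by (simp add: u_def v_def)
    then have "(cmod (f x - h x))\<^sup>2 \<le> (u x + v x)\<^sup>2"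
      by (intro power_mono) auto
    then show "(cmod (f x - h x))\<^sup>2 \<le> (u x)\<^sup>2 + 2 * (u x * v x) + (v x)\<^sup>2"
      by (simp add: power2_sum)
  qed
  also have "\<dots> = A + 2 * (\<integral>x. u x * v x \<partial>M) + B"
    using u2 v2 uv by (simp add: A_def B_def)
  also have "\<dots> \<le> A + 2 * (sqrt A * sqrt B) + B"
    using CS by simp
  also have "\<dots> = (sqrt A + sqrt B)\<^sup>2"
    using AB by (simp add: power2_sum)
  finally have "sqrt (\<integral>x. (cmod (f x - h x))\<^sup>2 \<partial>M) \<le> sqrt A + sqrt B"
    using AB by (intro real_le_lsqrt) auto
  then show ?thesis
    by (simp add: A_def B_def u_def v_def)
qed

lemma Metric_space_L2: "Metric_space (L2_space M) (L2_dist M)"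
proof
  fix F G
  show "0 \<le> L2_dist M F G"
    by (simp add: L2_dist_def)
  show "L2_dist M F G = L2_dist M G F"
    by (simp add: L2_dist_def norm_minus_commute)
next
  fix F G assume "F \<in> L2_space M" "G \<in> L2_space M"
  then obtain f g where f: "f \<in> L2_functions M" "F = L2_class M f"
    and g: "g \<in> L2_functions M" "G = L2_class M g"
    by (metis L2_spaceE)
  have "integrable M (\<lambda>x. (cmod (f x - g x))\<^sup>2)"
    using L2_functions_diff[OF f(1) g(1)] by (simp add: L2_functions_def)
  then show "L2_dist M F G = 0 \<longleftrightarrow> F = G"
    using f g by (simp add: L2_dist_class L2_class_eq_iff integral_nonneg_eq_0_iff_AE)
next
  fix F G H assume "F \<in> L2_space M" "G \<in> L2_space M" "H \<in> L2_space M"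
  then obtain f g h where "f \<in> L2_functions M" "F = L2_class M f"
    and "g \<in> L2_functions M" "G = L2_class M g"
    and "h \<in> L2_functions M" "H = L2_class M h"
    by (metis L2_spaceE)
  then show "L2_dist M F H \<le> L2_dist M F G + L2_dist M G H"
    using L2_Minkowski by (simp add: L2_dist_class)
qed

section \<open>Measure preserving actions of \<open>\<int>\<^sup>2\<close>\<close>

text \<open>The compact metric space is the whole type \<open>'a\<close>.\<close>

locale Z2_mpds = prob_space \<mu>
  for \<mu> :: "'a::metric_space measure" and T :: "int \<times> int \<Rightarrow> 'a \<Rightarrow> 'a" +
  assumes compact_space: "compact (UNIV :: 'a set)"
    and sets_borel: "sets \<mu> = sets borel"
    and homeomorphism_T: "\<exists>S. homeomorphism UNIV UNIV (T p) S"
    and T_add: "T (p + q) = T p \<circ> T q"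
    and invariant: "distr \<mu> \<mu> (T p) = \<mu>"

definition koopman :: "(int \<times> int \<Rightarrow> 'a \<Rightarrow> 'a) \<Rightarrow> int \<times> int \<Rightarrow> ('a \<Rightarrow> complex) \<Rightarrow> 'a \<Rightarrow> complex"
  where "koopman T p f = f \<circ> T p"

definition strip :: "real \<Rightarrow> real \<Rightarrow> (int \<times> int) set" where
  "strip \<beta> b = {(m, n). \<beta> * of_int m - b \<le> of_int n \<and> of_int n \<le> \<beta> * of_int m + b}"

definition directional_kronecker_at ::
    "'a measure \<Rightarrow> (int \<times> int \<Rightarrow> 'a \<Rightarrow> 'a) \<Rightarrow> real \<Rightarrow> real \<Rightarrow> 'a set set" where
  "directional_kronecker_at \<mu> T \<beta> b =
     {B \<in> sets \<mu>. compactin (L2_topology \<mu>)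
        (L2_topology \<mu> closure_of {L2_class \<mu> (koopman T p (indicator B)) | p. p \<in> strip \<beta> b})}"

text \<open>
  The width of the strip is irrelevant, see \<open>directional_kronecker_at_eq\<close> below.
\<close>

definition directional_kronecker ::
    "'a measure \<Rightarrow> (int \<times> int \<Rightarrow> 'a \<Rightarrow> 'a) \<Rightarrow> real \<Rightarrow> 'a set set" where
  "directional_kronecker \<mu> T \<beta> = directional_kronecker_at \<mu> T \<beta> 1"

definition directionally_weakly_mixing ::
    "'a measure \<Rightarrow> (int \<times> int \<Rightarrow> 'a \<Rightarrow> 'a) \<Rightarrow> real \<Rightarrow> bool" where
  "directionally_weakly_mixing \<mu> T \<beta> \<longleftrightarrow>
     (\<forall>B \<in> directional_kronecker \<mu> T \<beta>. measure \<mu> B = 0 \<or> measure \<mu> B = 1)"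

section \<open>Sequence entropy\<close>

text \<open>The convention \<open>0 log 0 = 0\<close> is built into HOL.\<close>

definition finite_measurable_partition :: "'a measure \<Rightarrow> 'a set set \<Rightarrow> bool" where
  "finite_measurable_partition \<mu> \<alpha> \<longleftrightarrow>
     finite \<alpha> \<and> \<alpha> \<subseteq> sets \<mu> \<and> partition_on (space \<mu>) \<alpha>"

definition partition_entropy :: "'a measure \<Rightarrow> 'a set set \<Rightarrow> real" where
  "partition_entropy \<mu> \<alpha> = - (\<Sum>A\<in>\<alpha>. measure \<mu> A * ln (measure \<mu> A))"

definition preimage_partition :: "('a \<Rightarrow> 'a) \<Rightarrow> 'a set set \<Rightarrow> 'a set set" where
  "preimage_partition f \<alpha> = (\<lambda>A. f -` A) ` \<alpha>"

text \<open>
  Sequences are indexed from \<open>0\<close>, so the first \<open>k\<close> terms are those with index in \<open>{..<k}\<close>.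
  \<open>common_refinement\<close> takes a set of partitions and discards empty cells; neither repetitions
  nor empty cells affect the entropy.  The term for \<open>k = 0\<close> is irrelevant for the upper limit.
\<close>

definition sequence_entropy ::
    "'a measure \<Rightarrow> (int \<times> int \<Rightarrow> 'a \<Rightarrow> 'a) \<Rightarrow> (nat \<Rightarrow> int \<times> int) \<Rightarrow> 'a set set \<Rightarrow> ereal" where
  "sequence_entropy \<mu> T S \<alpha> =
     limsup (\<lambda>k. ereal (1 / real k * partition_entropy \<mu>
       (common_refinement ((\<lambda>i. preimage_partition (T (S i)) \<alpha>) ` {..<k}))))"

section \<open>Independence of the width of the strip\<close>

lemma strip_covering:
  assumes "b > 0"
  shows "\<exists>F. finite F \<and> (\<forall>p\<in>strip \<beta> c. \<exists>q\<in>F. p - q \<in> strip \<beta> b)"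
proof -
  define v where "v p = of_int (snd p) - \<beta> * of_int (fst p)" for p :: "int \<times> int"
  have strip: "p \<in> strip \<beta> d \<longleftrightarrow> \<bar>v p\<bar> \<le> d" for p d
    by (auto simp: strip_def v_def abs_le_iff split: prod.splits)
  have diff: "v (p - q) = v p - v q" for p q
    by (simp add: v_def algebra_simps)
  define k where "k p = \<lfloor>v p / b\<rfloor>" for p
  have k: "\<bar>v (p - q)\<bar> \<le> b" if "k p = k q" for p q
  proof -
    have "\<bar>v p / b - v q / b\<bar> \<le> 1"
      using that unfolding k_def by linarith
    then show ?thesis
      using assms by (simp add: diff abs_divide flip: diff_divide_distrib)
  qed
  have "k ` strip \<beta> c \<subseteq> {\<lfloor>- c / b\<rfloor>..\<lfloor>c / b\<rfloor>}"
    using assms by (auto simp: strip k_def abs_le_iff intro!: floor_mono divide_right_mono)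
       (simp add: field_simps)
  then have fin: "finite (k ` strip \<beta> c)"
    by (rule finite_subset) simp
  define r where "r j = (SOME q. q \<in> strip \<beta> c \<and> k q = j)" for j
  have "k (r (k p)) = k p" if "p \<in> strip \<beta> c" for p
    unfolding r_def using someI[of "\<lambda>q. q \<in> strip \<beta> c \<and> k q = k p" p] that by blast
  then have "\<forall>p\<in>strip \<beta> c. \<exists>q\<in>r ` k ` strip \<beta> c. p - q \<in> strip \<beta> b"
    using k by (metis imageI strip)
  with fin show ?thesis
    by blast
qed

context Z2_mpds
begin

lemma measurable_T [measurable]: "T p \<in> measurable \<mu> \<mu>"
proof -
  have "continuous_on UNIV (T p)"
    using homeomorphism_T[of p] by (auto simp: homeomorphism_def)
  then have "T p \<in> borel_measurable borel"
    by (rule borel_measurable_continuous_onI)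
  then show ?thesis
    by (simp cong: measurable_cong_sets add: sets_borel)
qed

lemma integrable_T:
  fixes f :: "'a \<Rightarrow> real"
  assumes "integrable \<mu> f"
  shows "integrable \<mu> (\<lambda>x. f (T p x))"
  using assms invariant[of p] by (metis integrable_distr measurable_T)

lemma integral_T:
  fixes f :: "'a \<Rightarrow> real"
  assumes "f \<in> borel_measurable \<mu>"
  shows "(\<integral>x. f (T p x) \<partial>\<mu>) = (\<integral>x. f x \<partial>\<mu>)"
  using integral_distr[OF measurable_T assms, of p] by (simp add: invariant)

lemma koopman_L2:
  assumes "f \<in> L2_functions \<mu>"
  shows "koopman T p f \<in> L2_functions \<mu>"
  using assms integrable_T[of "\<lambda>x. (cmod (f x))\<^sup>2" p]
  by (auto simp: L2_functions_def koopman_def)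

lemma indicator_L2:
  assumes "B \<in> sets \<mu>"
  shows "indicator B \<in> L2_functions \<mu>"
proof -
  have "(\<lambda>x. (cmod (indicator B x))\<^sup>2) = (indicator B :: 'a \<Rightarrow> real)"
    by (auto simp: indicator_def)
  then show ?thesis
    using assms by (simp add: L2_functions_def emeasure_eq_measure)
qed

lemma koopman_add: "koopman T (p + q) f = koopman T q (koopman T p f)"
  by (simp add: koopman_def T_add comp_assoc)

lemma koopman_continuous:
  obtains U where "continuous_map (L2_topology \<mu>) (L2_topology \<mu>) U"
    "\<And>f. f \<in> L2_functions \<mu> \<Longrightarrow> U (L2_class \<mu> f) = L2_class \<mu> (koopman T q f)"
proof -
  define U where "U F = L2_class \<mu> (koopman T q (SOME f. f \<in> F))" for F
  interpret L2: Metric_space "L2_space \<mu>" "L2_dist \<mu>"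
    by (rule Metric_space_L2)
  have dist: "L2_dist \<mu> (L2_class \<mu> (koopman T q f)) (L2_class \<mu> (koopman T q g))
      = L2_dist \<mu> (L2_class \<mu> f) (L2_class \<mu> g)"
    if f: "f \<in> L2_functions \<mu>" and g: "g \<in> L2_functions \<mu>" for f g
  proof -
    have "(\<lambda>x. (cmod (f x - g x))\<^sup>2) \<in> borel_measurable \<mu>"
      using f g by (auto simp: L2_functions_def)
    from integral_T[OF this, of q] show ?thesis
      using f g by (simp add: L2_dist_class koopman_L2) (simp add: koopman_def)
  qed
  have U: "U (L2_class \<mu> f) = L2_class \<mu> (koopman T q f)" if f: "f \<in> L2_functions \<mu>" for f
  proof -
    let ?g = "SOME g. g \<in> L2_class \<mu> f"
    have g: "?g \<in> L2_functions \<mu>"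
      using L2_class_some(1)[OF f] .
    have "L2_class \<mu> ?g = L2_class \<mu> f"
      using L2_class_some[OF f] f by (simp add: L2_class_eq_iff)
    then have "L2_dist \<mu> (L2_class \<mu> (koopman T q ?g)) (L2_class \<mu> (koopman T q f)) = 0"
      using dist[OF g f] f by simp
    then show ?thesis
      using f g by (simp add: U_def koopman_L2)
  qed
  have iso: "U F \<in> L2_space \<mu> \<and> U G \<in> L2_space \<mu> \<and> L2_dist \<mu> (U F) (U G) = L2_dist \<mu> F G"
    if "F \<in> L2_space \<mu>" "G \<in> L2_space \<mu>" for F G
    using that by (metis L2_spaceE U dist koopman_L2 L2_class_in_space)
  have "continuous_map (L2_topology \<mu>) (L2_topology \<mu>) U"
    unfolding L2.metric_continuous_map[OF Metric_space_L2]
    using iso by (metis image_subsetI)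
  then show thesis
    using U that by blast
qed

lemma directional_kronecker_at_subset:
  assumes "b > 0"
  shows "directional_kronecker_at \<mu> T \<beta> b \<subseteq> directional_kronecker_at \<mu> T \<beta> c"
proof
  fix B assume B: "B \<in> directional_kronecker_at \<mu> T \<beta> b"
  interpret L2: Metric_space "L2_space \<mu>" "L2_dist \<mu>"
    by (rule Metric_space_L2)
  let ?t = "L2_topology \<mu>"
  define orb where "orb L = {L2_class \<mu> (koopman T p (indicator B)) | p. p \<in> L}"
    for L :: "(int \<times> int) set"
  have sets: "B \<in> sets \<mu>" and cpt: "compactin ?t (?t closure_of orb (strip \<beta> b))"
    using B by (auto simp: directional_kronecker_at_def orb_def)
  have L2: "koopman T p (indicator B) \<in> L2_functions \<mu>" for p
    using sets by (intro koopman_L2 indicator_L2)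
  have orb_sub: "orb L \<subseteq> L2_space \<mu>" for L
    using L2 by (auto simp: orb_def)
  obtain F where F: "finite F" "\<And>p. p \<in> strip \<beta> c \<Longrightarrow> \<exists>q\<in>F. p - q \<in> strip \<beta> b"
    using strip_covering[OF assms] by metis
  have "\<forall>q. \<exists>U. continuous_map ?t ?t U \<and>
      (\<forall>f\<in>L2_functions \<mu>. U (L2_class \<mu> f) = L2_class \<mu> (koopman T q f))"
    by (metis koopman_continuous)
  then obtain U where U: "\<And>q. continuous_map ?t ?t (U q)"
    "\<And>q f. f \<in> L2_functions \<mu> \<Longrightarrow> U q (L2_class \<mu> f) = L2_class \<mu> (koopman T q f)"
    by metis
  define K where "K = (\<Union>q\<in>F. U q ` (?t closure_of orb (strip \<beta> b)))"
  have K: "compactin ?t K"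
    unfolding K_def using F(1) cpt U(1) by (intro compactin_Union) (auto intro: image_compactin)
  have "orb (strip \<beta> c) \<subseteq> K"
  proof
    fix x assume "x \<in> orb (strip \<beta> c)"
    then obtain p where p: "p \<in> strip \<beta> c" "x = L2_class \<mu> (koopman T p (indicator B))"
      by (auto simp: orb_def)
    obtain q where q: "q \<in> F" "p - q \<in> strip \<beta> b"
      using F(2)[OF p(1)] by blast
    have "x = U q (L2_class \<mu> (koopman T (p - q) (indicator B)))"
      using L2 koopman_add[of "p - q" q] by (simp add: U(2) p(2))
    moreover have "L2_class \<mu> (koopman T (p - q) (indicator B)) \<in> orb (strip \<beta> b)"
      using q(2) unfolding orb_def by blast
    moreover have "orb (strip \<beta> b) \<subseteq> ?t closure_of orb (strip \<beta> b)"
      using orb_sub by (intro closure_of_subset) simp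
    ultimately show "x \<in> K"
      using q(1) by (auto simp: K_def)
  qed
  moreover have "closedin ?t K"
    using K compactin_imp_closedin L2.Hausdorff_space_mtopology by blast
  ultimately have "?t closure_of orb (strip \<beta> c) \<subseteq> K"
    by (rule closure_of_minimal)
  then have "compactin ?t (?t closure_of orb (strip \<beta> c))"
    using closed_compactin[OF K _ closedin_closure_of] by blast
  then show "B \<in> directional_kronecker_at \<mu> T \<beta> c"
    using sets by (simp add: directional_kronecker_at_def orb_def)
qed

lemma directional_kronecker_at_eq:
  assumes "b > 0"
  shows "directional_kronecker_at \<mu> T \<beta> b = directional_kronecker \<mu> T \<beta>"
  unfolding directional_kronecker_def
  by (intro subset_antisym directional_kronecker_at_subset assms zero_less_one)

end

end

theory Submission
  imports Defs "HOL-Real_Asymp.Real_Asymp"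
begin

text \<open>
  Let \<open>\<Gamma> f\<close> be the set of weak limits of \<open>f \<circ> T p\<close> along \<open>p = (m, n)\<close> whose offset \<open>n - \<beta> m\<close> tends to
  \<open>0\<close>.  It is weakly closed, and \<open>\<Gamma> g \<subseteq> \<Gamma> f\<close> for \<open>g \<in> \<Gamma> f\<close>.  Let \<open>g\<close> have the least norm in \<open>\<Gamma> f\<close>.
  Then all elements of \<open>\<Gamma> g\<close> have the same norm as \<open>g\<close>.  If \<open>g \<circ> T (q i)\<close> tends weakly to \<open>h\<close> and the offsets
  of \<open>q i\<close> converge, then a limit point of \<open>h \<circ> T (- q j)\<close> lies in \<open>\<Gamma> g\<close>, so \<open>h\<close> is as long as \<open>g\<close>
  and the convergence to \<open>h\<close> is strong.  Hence \<open>g\<close> has a precompact orbit along the strip, and so have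
  almost all of its level sets.  Under weak mixing \<open>g\<close> is therefore constant, which means that \<open>f\<close> becomes
  independent of any given finite family of sets along suitable \<open>p\<close>.  The times \<open>S k\<close> are chosen one after
  the other such that the new translates are almost independent of the previous ones, for a countable
  dense family of partitions.

  Conversely, the translates of a set of the Kronecker algebra are approximated by finitely many of them,
  so the entropy along any sequence in the strip vanishes.
\<close>

section \<open>Entropy of finite-valued functions\<close>

text \<open>The least norm takes the place of spectral theory: it selects a limit from which no norm
  can be lost any more, and a weak limit without loss of norm is a strong one. Offsets must tend to
  0 rather than stay bounded, because limits of limits are taken and offsets add up.

  This argument handles one function at a time, whereas a new time must serve finitely many sets at
  once. Functions that have already become constant are unaffected by further translations, so they
  can be treated one after the other. Distinct times are not automatic either, as the time 0 always
  has offset 0; spare shifts inside the strip provide them.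

  At step \<open>k\<close> only the first \<open>k + 1\<close> partitions of the dense family are
  considered, with error \<open>1 / (k + 1)\<close>. So each of them is neglected finitely often,
  and the error disappears in the mean. An arbitrary partition is replaced by a nearby one of the
  family at a small cost per time, the same at all times because the required closeness depends only
  on the number of labels and is invariant under the action.\<close>

definition eta :: "real \<Rightarrow> real" where
  "eta x = - (x * ln x)"

lemma eta_0 [simp]: "eta 0 = 0" and eta_1 [simp]: "eta 1 = 0"
  by (auto simp: eta_def)

lemma eta_nonneg: "0 \<le> x \<Longrightarrow> x \<le> 1 \<Longrightarrow> 0 \<le> eta x"
  by (cases "x = 0") (auto simp: eta_def mult_nonneg_nonpos)

lemma eta_pos: "0 < x \<Longrightarrow> x < 1 \<Longrightarrow> 0 < eta x"
  by (auto simp: eta_def mult_pos_neg)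

lemma continuous_on_eta: "continuous_on {0..1} eta"
  unfolding continuous_on_eq_continuous_within
proof
  fix x :: real assume x: "x \<in> {0..1}"
  show "continuous (at x within {0..1}) eta"
  proof (cases "x = 0")
    case True
    have "((\<lambda>x::real. - (x * ln x)) \<longlongrightarrow> 0) (at_right 0)"
      by real_asymp
    then have "(eta \<longlongrightarrow> eta 0) (at_right 0)"
      by (simp add: eta_def[abs_def])
    then have "(eta \<longlongrightarrow> eta 0) (at 0 within {0..1})"
      by (simp add: at_within_Icc_at_right)
    then show ?thesis
      by (simp add: True continuous_within)
  next
    case False
    then show ?thesis
      using x unfolding eta_def by (intro continuous_intros) auto
  qed
qed

lemma eta_uniformly_continuous:
  assumes "e > 0"
  obtains d where "d > 0"
    "\<And>s t. s \<in> {0..1} \<Longrightarrow> t \<in> {0..1} \<Longrightarrow> \<bar>s - t\<bar> < d \<Longrightarrow> \<bar>eta s - eta t\<bar> < e"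
  using compact_uniformly_continuous[OF continuous_on_eta] assms
  unfolding uniformly_continuous_on_def by (metis compact_Icc dist_real_def)

text \<open>Shares an error \<open>e\<close> among \<open>N\<close> terms. Dividing by
  \<open>N + 1\<close> instead of \<open>N\<close> keeps the share well defined and positive when
  \<open>N = 0\<close>.\<close>

lemma divide_Suc_bound:
  fixes e N :: real
  assumes "0 < e" "0 \<le> N"
  shows "0 < e / (N + 1)" "N * (e / (N + 1)) \<le> e"
proof -
  have "N * e \<le> e * (N + 1)"
    using assms by (simp add: algebra_simps)
  then show "N * (e / (N + 1)) \<le> e"
    using assms by (simp add: pos_divide_le_eq)
qed (use assms in simp)

context prob_space
begin

text \<open>Partitions are handled as functions whose fibres are the cells. Joins become tuples, and
  refinement means that one function determines another.\<close>

definition law :: "('a \<Rightarrow> 'b) \<Rightarrow> 'b \<Rightarrow> real" where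
  "law X v = prob {x \<in> space M. X x = v}"

definition ent :: "('a \<Rightarrow> 'b) \<Rightarrow> real" where
  "ent X = (\<Sum>v\<in>X ` space M. eta (law X v))"

lemma law_nonneg [simp]: "0 \<le> law X v" and law_le_1 [simp]: "law X v \<le> 1"
  by (auto simp: law_def)

lemma law_eq_0: "v \<notin> X ` space M \<Longrightarrow> law X v = 0"
proof -
  assume "v \<notin> X ` space M"
  then have *: "{x \<in> space M. X x = v} = {}"
    by auto
  show ?thesis
    unfolding law_def * by simp
qed

lemma simple_level_sets:
  assumes "simple_function M X"
  shows "{x \<in> space M. X x = v} \<in> events"
proof -
  have "{x \<in> space M. X x = v} = X -` {v} \<inter> space M"
    by auto
  then show ?thesis
    using simple_functionD(2)[OF assms, of "{v}"] by simp
qed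

lemma simple_Pair [simp, intro]:
  "simple_function M X \<Longrightarrow> simple_function M Y \<Longrightarrow> simple_function M (\<lambda>x. (X x, Y x))"
  by (rule simple_function_Pair)

lemma ent_superset:
  assumes "finite V" "X ` space M \<subseteq> V"
  shows "ent X = (\<Sum>v\<in>V. eta (law X v))"
  unfolding ent_def using assms by (intro sum.mono_neutral_left) (auto simp: law_eq_0)

lemma ent_nonneg: "0 \<le> ent X"
  unfolding ent_def by (intro sum_nonneg eta_nonneg) auto

lemma sum_law_inter:
  assumes X: "simple_function M X" and A: "A \<in> events"
    and V: "finite V" "X ` space M \<subseteq> V"
  shows "(\<Sum>v\<in>V. prob ({x \<in> space M. X x = v} \<inter> A)) = prob A"
proof -
  have "prob (\<Union>v\<in>V. {x \<in> space M. X x = v} \<inter> A) = (\<Sum>v\<in>V. prob ({x \<in> space M. X x = v} \<inter> A))"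
    using V A simple_level_sets[OF X]
    by (intro finite_measure_finite_Union) (auto simp: disjoint_family_on_def)
  moreover have "(\<Union>v\<in>V. {x \<in> space M. X x = v} \<inter> A) = A"
    using V sets.sets_into_space[OF A] by auto
  ultimately show ?thesis
    by simp
qed

lemma law_Pair_le:
  assumes "simple_function M X" "simple_function M Y"
  shows "law (\<lambda>x. (X x, Y x)) (v, w) \<le> law X v" "law (\<lambda>x. (X x, Y x)) (v, w) \<le> law Y w"
  unfolding law_def
  by (intro finite_measure_mono simple_level_sets assms; auto)+

lemma sum_law_Pair:
  assumes X: "simple_function M X" and Y: "simple_function M Y"
    and V: "finite V" "X ` space M \<subseteq> V"
  shows "(\<Sum>v\<in>V. law (\<lambda>x. (X x, Y x)) (v, w)) = law Y w"
proof -
  have "{x \<in> space M. X x = v} \<inter> {x \<in> space M. Y x = w} = {x \<in> space M. (X x, Y x) = (v, w)}" for v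
    by auto
  then show ?thesis
    using sum_law_inter[OF X simple_level_sets[OF Y] V, of w] by (simp add: law_def)
qed

lemma sum_law:
  assumes X: "simple_function M X" and V: "finite V" "X ` space M \<subseteq> V"
  shows "(\<Sum>v\<in>V. law X v) = 1"
proof -
  have "{x \<in> space M. X x = v} \<inter> space M = {x \<in> space M. X x = v}" for v
    by auto
  then show ?thesis
    using sum_law_inter[OF X sets.top V] by (simp add: law_def prob_space)
qed

section \<open>Shannon inequalities for finite-valued functions\<close>

lemma sum_law_comp:
  assumes X: "simple_function M X"
  shows "(\<Sum>v\<in>X ` space M. law X v * F (g v)) = (\<Sum>w\<in>(\<lambda>x. g (X x)) ` space M. law (\<lambda>x. g (X x)) w * F w)"
proof -
  have fin: "finite (X ` space M)"
    using X by (rule simple_functionD)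
  have "law (\<lambda>x. g (X x)) w = (\<Sum>v | v \<in> X ` space M \<and> g v = w. law X v)" for w
  proof -
    have "prob (\<Union>v\<in>{v \<in> X ` space M. g v = w}. {x \<in> space M. X x = v})
        = (\<Sum>v | v \<in> X ` space M \<and> g v = w. law X v)"
      unfolding law_def using fin simple_level_sets[OF X]
      by (intro finite_measure_finite_Union) (auto simp: disjoint_family_on_def)
    moreover have "(\<Union>v\<in>{v \<in> X ` space M. g v = w}. {x \<in> space M. X x = v}) = {x \<in> space M. g (X x) = w}"
      by auto
    ultimately show ?thesis
      by (simp add: law_def)
  qed
  then have "(\<Sum>w\<in>(\<lambda>x. g (X x)) ` space M. law (\<lambda>x. g (X x)) w * F w)
      = (\<Sum>w\<in>g ` X ` space M. \<Sum>v | v \<in> X ` space M \<and> g v = w. law X v * F (g v))"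
    by (simp add: sum_distrib_right image_image)
  also have "\<dots> = (\<Sum>v\<in>X ` space M. law X v * F (g v))"
    by (rule sum.image_gen[OF fin, symmetric])
  finally show ?thesis ..
qed

text \<open>Writing the entropy of a function of \<open>X\<close> as an average over the values of
  \<open>X\<close> itself puts all marginals of a tuple over the same index set, where they can be
  compared term by term.\<close>

lemma ent_comp:
  assumes X: "simple_function M X"
  shows "ent (\<lambda>x. g (X x)) = - (\<Sum>v\<in>X ` space M. law X v * ln (law (\<lambda>x. g (X x)) (g v)))"
  using sum_law_comp[OF X, of "\<lambda>w. ln (law (\<lambda>x. g (X x)) w)" g]
  by (simp add: ent_def eta_def sum_negf)

lemma ent_data_processing:
  assumes X: "simple_function M X"
  shows "ent (\<lambda>x. g (X x)) \<le> ent X"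
proof -
  have "law X v * ln (law X v) \<le> law X v * ln (law (\<lambda>x. g (X x)) (g v))" for v
  proof (cases "law X v = 0")
    case False
    have "law X v \<le> law (\<lambda>x. g (X x)) (g v)"
      unfolding law_def using simple_level_sets[OF X]
        simple_level_sets[OF simple_function_compose1[OF X, of g]]
      by (intro finite_measure_mono) auto
    moreover have "0 < law X v"
      using False by (simp add: less_le)
    ultimately show ?thesis
      by (intro mult_left_mono) (simp_all add: ln_mono)
  qed simp
  then show ?thesis
    using ent_comp[OF X, of "\<lambda>v. v"] ent_comp[OF X, of g] by (auto intro!: sum_mono)
qed

lemma ent_mono:
  assumes X: "simple_function M X"
    and f: "\<And>x y. x \<in> space M \<Longrightarrow> y \<in> space M \<Longrightarrow> X x = X y \<Longrightarrow> Y x = Y y"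
  shows "ent Y \<le> ent X"
proof -
  \<comment> \<open>As \<open>X\<close> determines \<open>Y\<close>, the function \<open>Y\<close>
    factors through \<open>X\<close> by this \<open>g\<close>.\<close>
  define g where "g v = Y (SOME x. x \<in> space M \<and> X x = v)" for v
  have g: "g (X x) = Y x" if "x \<in> space M" for x
    unfolding g_def using someI[of "\<lambda>y. y \<in> space M \<and> X y = X x" x] that f by blast
  then have "ent Y = ent (\<lambda>x. g (X x))"
    by (simp add: ent_def law_def cong: conj_cong image_cong)
  then show ?thesis
    using ent_data_processing[OF X] by simp
qed

lemma ent_cong:
  assumes "simple_function M X" "simple_function M Y"
    and "\<And>x y. x \<in> space M \<Longrightarrow> y \<in> space M \<Longrightarrow> X x = X y \<longleftrightarrow> Y x = Y y"
  shows "ent X = ent Y"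
  using assms by (intro antisym ent_mono) auto

text \<open>Nonnegativity of the conditional mutual information of \<open>A\<close> and
  \<open>B\<close> given \<open>C\<close>. The joint law \<open>p\<close> is compared with
  \<open>q * r / s\<close>, the law under which \<open>A\<close> and \<open>B\<close> are
  conditionally independent given \<open>C\<close>, by means of
  \<open>ln t \<le> t - 1\<close>.\<close>

lemma ent_strong_subadditive:
  assumes A: "simple_function M A" and B: "simple_function M B" and C: "simple_function M C"
  shows "ent (\<lambda>x. (A x, B x, C x)) + ent C \<le> ent (\<lambda>x. (A x, C x)) + ent (\<lambda>x. (B x, C x))"
proof -
  let ?ABC = "\<lambda>x. (A x, B x, C x)"
  let ?S = "?ABC ` space M"
  let ?U = "A ` space M \<times> B ` space M \<times> C ` space M"
  define p where "p = law ?ABC"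
  define q where "q = law (\<lambda>x. (A x, C x))"
  define r where "r = law (\<lambda>x. (B x, C x))"
  define s where "s = law C"
  have ABC: "simple_function M ?ABC"
    using A B C by auto
  note fin = simple_functionD(1)[OF A] simple_functionD(1)[OF B] simple_functionD(1)[OF C]
    simple_functionD(1)[OF ABC]
  have e1: "ent ?ABC = - (\<Sum>(a, b, c)\<in>?S. p (a, b, c) * ln (p (a, b, c)))"
    using ent_comp[OF ABC, of "\<lambda>v. v"] by (simp add: p_def case_prod_unfold)
  have e2: "ent (\<lambda>x. (A x, C x)) = - (\<Sum>(a, b, c)\<in>?S. p (a, b, c) * ln (q (a, c)))"
    using ent_comp[OF ABC, of "\<lambda>(a, b, c). (a, c)"] by (simp add: p_def q_def case_prod_unfold)
  have e3: "ent (\<lambda>x. (B x, C x)) = - (\<Sum>(a, b, c)\<in>?S. p (a, b, c) * ln (r (b, c)))"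
    using ent_comp[OF ABC, of "\<lambda>(a, b, c). (b, c)"] by (simp add: p_def r_def case_prod_unfold)
  have e4: "ent C = - (\<Sum>(a, b, c)\<in>?S. p (a, b, c) * ln (s c))"
    using ent_comp[OF ABC, of "\<lambda>(a, b, c). c"] by (simp add: p_def s_def case_prod_unfold)
  have nn: "0 \<le> p x" "0 \<le> q y" "0 \<le> r z" "0 \<le> s c" for x y z c
    by (auto simp: p_def q_def r_def s_def)
  have key: "p (a, b, c) - q (a, c) * r (b, c) / s c
      \<le> p (a, b, c) * ln (p (a, b, c)) + p (a, b, c) * ln (s c)
        - p (a, b, c) * ln (q (a, c)) - p (a, b, c) * ln (r (b, c))" for a b c
  proof (cases "p (a, b, c) = 0")
    case False
    then have p: "p (a, b, c) > 0"
      using nn(1)[of "(a, b, c)"] by simp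
    have "p (a, b, c) \<le> q (a, c)" "p (a, b, c) \<le> r (b, c)" "p (a, b, c) \<le> s c"
      unfolding p_def q_def r_def s_def law_def
      using simple_level_sets[OF C] simple_level_sets[OF simple_Pair[OF A C]] simple_level_sets[OF simple_Pair[OF B C]]
      by (intro finite_measure_mono; auto)+
    then have pos: "q (a, c) > 0" "r (b, c) > 0" "s c > 0"
      using p by auto
    define t where "t = q (a, c) * r (b, c) / (s c * p (a, b, c))"
    have t: "t > 0"
      using p pos by (simp add: t_def)
    have "p (a, b, c) * ln t \<le> p (a, b, c) * (t - 1)"
      using ln_le_minus_one[OF t] p by (intro mult_left_mono) auto
    moreover have "ln t = ln (q (a, c)) + ln (r (b, c)) - ln (s c) - ln (p (a, b, c))"
      unfolding t_def using p pos by (simp add: ln_div ln_mult)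
    moreover have "p (a, b, c) * t = q (a, c) * r (b, c) / s c"
      using p by (simp add: t_def)
    ultimately show ?thesis
      by (simp add: algebra_simps)
  qed (use nn in auto)
  \<comment> \<open>Enlarging the attained triples to the full product makes the sum factorise over
    \<open>a\<close> and \<open>b\<close>.\<close>
  have "(\<Sum>(a, b, c)\<in>?S. q (a, c) * r (b, c) / s c) \<le> (\<Sum>(a, b, c)\<in>?U. q (a, c) * r (b, c) / s c)"
    using fin nn by (intro sum_mono2) auto
  also have "\<dots> = (\<Sum>a\<in>A ` space M. \<Sum>b\<in>B ` space M. \<Sum>c\<in>C ` space M. q (a, c) * r (b, c) / s c)"
    by (simp add: sum.cartesian_product)
  also have "\<dots> = (\<Sum>a\<in>A ` space M. \<Sum>c\<in>C ` space M. \<Sum>b\<in>B ` space M. q (a, c) * r (b, c) / s c)"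
    by (intro sum.cong sum.swap refl)
  also have "\<dots> = (\<Sum>c\<in>C ` space M. \<Sum>a\<in>A ` space M. \<Sum>b\<in>B ` space M. q (a, c) * r (b, c) / s c)"
    by (rule sum.swap)
  also have "\<dots> = (\<Sum>c\<in>C ` space M. (\<Sum>a\<in>A ` space M. q (a, c)) * (\<Sum>b\<in>B ` space M. r (b, c)) / s c)"
    by (simp add: sum_product sum_divide_distrib)
  \<comment> \<open>The terms have the form \<open>s c * s c / s c\<close>; for
    \<open>s c = 0\<close> this is still \<open>s c\<close>, since division by zero gives 0.\<close>
  also have "\<dots> = (\<Sum>c\<in>C ` space M. s c)"
    unfolding q_def r_def
    by (simp add: sum_law_Pair[OF A C fin(1)] sum_law_Pair[OF B C fin(2)] s_def)
  also have "\<dots> = 1"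
    unfolding s_def using fin by (intro sum_law C) auto
  finally have "(\<Sum>(a, b, c)\<in>?S. q (a, c) * r (b, c) / s c) \<le> 1" .
  moreover have "(\<Sum>(a, b, c)\<in>?S. p (a, b, c)) = 1"
    unfolding p_def using sum_law[OF ABC fin(4)] by (simp add: case_prod_unfold)
  ultimately have "0 \<le> (\<Sum>(a, b, c)\<in>?S. p (a, b, c) - q (a, c) * r (b, c) / s c)"
    by (simp add: case_prod_unfold sum_subtractf)
  also have "\<dots> \<le> (\<Sum>(a, b, c)\<in>?S. p (a, b, c) * ln (p (a, b, c)) + p (a, b, c) * ln (s c)
        - p (a, b, c) * ln (q (a, c)) - p (a, b, c) * ln (r (b, c)))"
    using key by (intro sum_mono) auto
  also have "\<dots> = ent (\<lambda>x. (A x, C x)) + ent (\<lambda>x. (B x, C x)) - ent ?ABC - ent C"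
    unfolding e1 e2 e3 e4 by (simp add: case_prod_unfold sum.distrib sum_subtractf)
  finally show ?thesis
    by simp
qed

lemma ent_const [simp]: "ent (\<lambda>x. c) = 0"
proof -
  have "law (\<lambda>x. c) c = 1"
    by (simp add: law_def prob_space)
  then show ?thesis
    using ent_superset[of "{c}" "\<lambda>x. c"] by (auto simp del: image_constant_conv)
qed

lemma ent_subadditive:
  assumes A: "simple_function M A" and B: "simple_function M B"
  shows "ent (\<lambda>x. (A x, B x)) \<le> ent A + ent B"
proof -
  have "ent (\<lambda>x. (A x, B x, ())) + ent (\<lambda>x. ()) \<le> ent (\<lambda>x. (A x, ())) + ent (\<lambda>x. (B x, ()))"
    using A B by (intro ent_strong_subadditive) auto
  moreover have "ent (\<lambda>x. (A x, B x, ())) = ent (\<lambda>x. (A x, B x))"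
    "ent (\<lambda>x. (A x, ())) = ent A" "ent (\<lambda>x. (B x, ())) = ent B"
    using A B by (auto intro!: ent_cong)
  ultimately show ?thesis
    by simp
qed

text \<open>The differences are conditional entropies, and conditioning on the finer
  \<open>D\<close> lowers them. This is strong subadditivity with \<open>X\<close> as the common
  component, as \<open>X\<close> adds nothing to \<open>D\<close>.\<close>

lemma ent_increment_antimono:
  assumes D: "simple_function M D" and X: "simple_function M X" and Y: "simple_function M Y"
    and f: "\<And>x y. x \<in> space M \<Longrightarrow> y \<in> space M \<Longrightarrow> D x = D y \<Longrightarrow> X x = X y"
  shows "ent (\<lambda>x. (D x, Y x)) - ent D \<le> ent (\<lambda>x. (X x, Y x)) - ent X"
proof -
  have "ent (\<lambda>x. (D x, Y x, X x)) + ent X \<le> ent (\<lambda>x. (D x, X x)) + ent (\<lambda>x. (Y x, X x))"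
    by (rule ent_strong_subadditive[OF D Y X])
  moreover have "ent (\<lambda>x. (D x, Y x, X x)) = ent (\<lambda>x. (D x, Y x))"
    by (rule ent_cong) (use D X Y in auto, use f in blast)
  moreover have "ent (\<lambda>x. (D x, X x)) = ent D"
    by (rule ent_cong) (use D X in auto, use f in blast)
  moreover have "ent (\<lambda>x. (Y x, X x)) = ent (\<lambda>x. (X x, Y x))"
    using X Y by (intro ent_cong) auto
  ultimately show ?thesis
    by linarith
qed

text \<open>When \<open>X\<close> and \<open>Y\<close> rarely differ, their joint law is close to
  the law of \<open>(X, X)\<close>, whose entropy is \<open>ent X\<close>. The bound
  \<open>d\<close> depends only on the number \<open>r\<close> of labels, so it serves all
  translates at once.\<close>

lemma ent_joint_close:
  fixes r :: nat
  assumes e: "e > 0"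
  obtains d where "d > 0"
    "\<And>X Y. simple_function M X \<Longrightarrow> simple_function M Y \<Longrightarrow>
      X ` space M \<subseteq> {..<r} \<Longrightarrow> Y ` space M \<subseteq> {..<r} \<Longrightarrow>
      prob {x \<in> space M. X x \<noteq> Y x} < d \<Longrightarrow> ent (\<lambda>x. (X x, Y x)) \<le> ent X + e"
proof -
  \<comment> \<open>The joint law has \<open>r * r\<close> cells, and each may contribute an error
    \<open>e'\<close>.\<close>
  define e' where "e' = e / (real r * real r + 1)"
  have e': "e' > 0" "real r * real r * e' \<le> e"
    using divide_Suc_bound[OF e, of "real r * real r"] by (simp_all add: e'_def)
  obtain d where d: "d > 0"
    "\<And>s t. s \<in> {0..1} \<Longrightarrow> t \<in> {0..1} \<Longrightarrow> \<bar>s - t\<bar> < d \<Longrightarrow> \<bar>eta s - eta t\<bar> < e'"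
    using eta_uniformly_continuous[OF e'(1)] by blast
  show thesis
  proof
    show "d > 0" by fact
    fix X Y :: "'a \<Rightarrow> nat"
    assume X: "simple_function M X" and Y: "simple_function M Y"
      and rX: "X ` space M \<subseteq> {..<r}" and rY: "Y ` space M \<subseteq> {..<r}"
      and close: "prob {x \<in> space M. X x \<noteq> Y x} < d"
    let ?XY = "\<lambda>x. (X x, Y x)"
    define u where "u i j = (if i = j then law X i else 0)" for i j
    have ev: "{x \<in> space M. X x \<noteq> Y x} \<in> events"
    proof -
      have "{x \<in> space M. (X x = Y x) = False} \<in> events"
        by (rule simple_level_sets) (use X Y in \<open>rule simple_function_compose2\<close>)
      then show ?thesis by simp
    qed
    note lv = simple_level_sets[OF X] simple_level_sets[OF simple_Pair[OF X Y]]
    have "\<bar>law ?XY (i, j) - u i j\<bar> < d" for i j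
    proof (cases "i = j")
      case False
      have "law ?XY (i, j) \<le> prob {x \<in> space M. X x \<noteq> Y x}"
        unfolding law_def using False ev by (intro finite_measure_mono) auto
      then show ?thesis
        using False close by (simp add: u_def)
    next
      case True
      have "law X i \<le> prob ({x \<in> space M. ?XY x = (i, i)} \<union> {x \<in> space M. X x \<noteq> Y x})"
        unfolding law_def using ev lv by (intro finite_measure_mono) auto
      also have "\<dots> \<le> law ?XY (i, i) + prob {x \<in> space M. X x \<noteq> Y x}"
        unfolding law_def using ev lv by (intro measure_Un_le) auto
      finally show ?thesis
        using True close law_Pair_le(1)[OF X Y, of i i] by (simp add: u_def abs_less_iff)
    qed
    then have c: "\<bar>eta (law ?XY (i, j)) - eta (u i j)\<bar> < e'" for i j
      by (intro d(2)) (auto simp: u_def)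
    have "ent ?XY = (\<Sum>(i, j)\<in>{..<r} \<times> {..<r}. eta (law ?XY (i, j)))"
      using ent_superset[of "{..<r} \<times> {..<r}" ?XY] rX rY by (force simp: case_prod_unfold)
    also have "\<dots> = (\<Sum>i<r. \<Sum>j<r. eta (law ?XY (i, j)))"
      by (simp add: sum.cartesian_product)
    also have "\<dots> \<le> (\<Sum>i<r. \<Sum>j<r. eta (u i j) + e')"
      using c by (intro sum_mono) (smt (verit))
    also have "\<dots> = (\<Sum>i<r. \<Sum>j<r. eta (u i j)) + real r * real r * e'"
      by (simp add: sum.distrib)
    also have "(\<Sum>i<r. \<Sum>j<r. eta (u i j)) = (\<Sum>i<r. eta (law X i))"
    proof (intro sum.cong refl)
      fix i assume "i \<in> {..<r}"
      have "(\<Sum>j<r. eta (u i j)) = (\<Sum>j<r. if j = i then eta (law X i) else 0)"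
        by (intro sum.cong) (auto simp: u_def)
      then show "(\<Sum>j<r. eta (u i j)) = eta (law X i)"
        using \<open>i \<in> {..<r}\<close> by simp
    qed
    also have "\<dots> = ent X"
      using rX by (intro ent_superset[symmetric]) auto
    finally show "ent ?XY \<le> ent X + e"
      using e'(2) by linarith
  qed
qed

text \<open>A product law has the sum of the entropies, and entropy is continuous in the law.
  \<open>Z\<close> is compared with the law of \<open>Y\<close> because it will be a translate of
  \<open>Y\<close> by a time that is not yet known; \<open>d\<close> has to be fixed before.\<close>

lemma ent_near_independent:
  assumes W: "simple_function M W" and Y: "simple_function M Y"
    and e: "e > 0"
  obtains d where "d > 0"
    "\<And>Z. simple_function M Z \<Longrightarrow> Z ` space M \<subseteq> Y ` space M \<Longrightarrow>
      (\<And>w y. w \<in> W ` space M \<Longrightarrow> y \<in> Y ` space M \<Longrightarrow>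
        \<bar>law (\<lambda>x. (W x, Z x)) (w, y) - law W w * law Y y\<bar> < d) \<Longrightarrow>
      ent W + ent Y - e \<le> ent (\<lambda>x. (W x, Z x))"
proof -
  let ?RW = "W ` space M" and ?RY = "Y ` space M"
  note fin = simple_functionD(1)[OF W] simple_functionD(1)[OF Y]
  define N where "N = real (card ?RW) * real (card ?RY)"
  define e' where "e' = e / (N + 1)"
  have N: "N \<ge> 0"
    by (simp add: N_def)
  have e': "e' > 0" "N * e' \<le> e"
    using divide_Suc_bound[OF e N] by (simp_all add: e'_def)
  obtain d where d: "d > 0"
    "\<And>s t. s \<in> {0..1} \<Longrightarrow> t \<in> {0..1} \<Longrightarrow> \<bar>s - t\<bar> < d \<Longrightarrow> \<bar>eta s - eta t\<bar> < e'"
    using eta_uniformly_continuous[OF e'(1)] by blast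
  show thesis
  proof
    show "d > 0" by fact
    fix Z assume Z: "simple_function M Z" and rZ: "Z ` space M \<subseteq> ?RY"
      and ind: "\<And>w y. w \<in> ?RW \<Longrightarrow> y \<in> ?RY \<Longrightarrow>
        \<bar>law (\<lambda>x. (W x, Z x)) (w, y) - law W w * law Y y\<bar> < d"
    have "eta (s * t) = t * eta s + s * eta t" if "s \<ge> 0" "t \<ge> 0" for s t
    proof (cases "s = 0 \<or> t = 0")
      case False
      then show ?thesis
        using that by (simp add: eta_def ln_mult algebra_simps)
    qed auto
    then have "(\<Sum>w\<in>?RW. \<Sum>y\<in>?RY. eta (law W w * law Y y))
        = (\<Sum>w\<in>?RW. \<Sum>y\<in>?RY. law Y y * eta (law W w)) + (\<Sum>w\<in>?RW. \<Sum>y\<in>?RY. law W w * eta (law Y y))"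
      by (simp add: sum.distrib)
    also have "\<dots> = ent W + ent Y"
      using sum_law[OF W fin(1)] sum_law[OF Y fin(2)]
      by (simp add: ent_def flip: sum_distrib_right sum_distrib_left)
    finally have "ent W + ent Y - N * e' = (\<Sum>w\<in>?RW. \<Sum>y\<in>?RY. eta (law W w * law Y y) - e')"
      by (simp add: sum_subtractf N_def)
    also have "\<dots> \<le> (\<Sum>w\<in>?RW. \<Sum>y\<in>?RY. eta (law (\<lambda>x. (W x, Z x)) (w, y)))"
    proof (intro sum_mono)
      fix w y assume "w \<in> ?RW" "y \<in> ?RY"
      then have "\<bar>eta (law (\<lambda>x. (W x, Z x)) (w, y)) - eta (law W w * law Y y)\<bar> < e'"
        by (intro d(2) ind) (auto intro: mult_le_one)
      then show "eta (law W w * law Y y) - e' \<le> eta (law (\<lambda>x. (W x, Z x)) (w, y))"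
        by linarith
    qed
    also have "\<dots> = ent (\<lambda>x. (W x, Z x))"
      using ent_superset[of "?RW \<times> ?RY" "\<lambda>x. (W x, Z x)"] rZ fin
      by (force simp: sum.cartesian_product case_prod_unfold)
    finally show "ent W + ent Y - e \<le> ent (\<lambda>x. (W x, Z x))"
      using e'(2) by linarith
  qed
qed

end

section \<open>Weak limits of functions with values in the unit interval\<close>

lemma compact_unit_sequences: "compact {s :: nat \<Rightarrow> real. \<forall>k. s k \<in> {0..1}}"
proof -
  have "compactin (product_topology (\<lambda>_::nat. euclideanreal) UNIV) (PiE UNIV (\<lambda>_. {0..1}))"
    by (simp add: compactin_PiE)
  moreover have "PiE UNIV (\<lambda>_::nat. {0..1::real}) = {s. \<forall>k. s k \<in> {0..1}}"
    by (auto simp: PiE_def)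
  ultimately show ?thesis
    by (simp add: euclidean_product_topology)
qed

text \<open>A diagonal subsequence, obtained from the compactness of the countable product of unit
  intervals.\<close>

lemma unit_sequences_subseq:
  fixes s :: "nat \<Rightarrow> nat \<Rightarrow> real"
  assumes "\<And>n k. s n k \<in> {0..1}"
  obtains r where "strict_mono r" "\<And>k. convergent (\<lambda>n. s (r n) k)"
proof -
  have "seq_compact {s :: nat \<Rightarrow> real. \<forall>k. s k \<in> {0..1}}"
    by (rule compact_imp_seq_compact[OF compact_unit_sequences])
  moreover have "\<forall>n. s n \<in> {s. \<forall>k. s k \<in> {0..1}}"
    using assms by simp
  ultimately obtain l r where r: "strict_mono r" and l: "(s \<circ> r) \<longlonglongrightarrow> l"
    by (rule seq_compactE)
  have "(\<lambda>n. s (r n) k) \<longlonglongrightarrow> l k" for k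
  proof -
    have "continuous_on UNIV (\<lambda>f :: nat \<Rightarrow> real. f k)"
      by (rule continuous_on_product_coordinates)
    then have "isCont (\<lambda>f :: nat \<Rightarrow> real. f k) l"
      using continuous_on_eq_continuous_at[OF open_UNIV] by blast
    from isCont_tendsto_compose[OF this l] show ?thesis
      by (simp add: o_def)
  qed
  then show thesis
    using that r by (auto simp: convergent_def)
qed

text \<open>With \<open>y = N * g x\<close> this counts the levels \<open>k / N\<close> that
  \<open>g\<close> reaches at \<open>x\<close>, so that \<open>g\<close> is an average of indicators
  of superlevel sets up to \<open>1 / N\<close>.\<close>

lemma sum_of_bool_floor:
  assumes "0 \<le> y" "y \<le> real N"
  shows "(\<Sum>k=1..N. of_bool (real k \<le> y)) = real_of_int \<lfloor>y\<rfloor>"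
proof -
  have "{k \<in> {1..N}. real k \<le> y} = {1..nat \<lfloor>y\<rfloor>}"
    using assms by (auto simp: le_nat_iff le_floor_iff nat_le_iff floor_le_iff)
  then have "(\<Sum>k=1..N. of_bool (real k \<le> y)) = real (card {1..nat \<lfloor>y\<rfloor>})"
    by (simp add: of_bool_def sum.If_cases Int_def)
  then show ?thesis
    using assms by simp
qed

context prob_space
begin

text \<open>The bounds hold everywhere rather than almost everywhere, so they survive composition
  with any map and give integrability of products at once.\<close>

definition unit_functions :: "('a \<Rightarrow> real) set" where
  "unit_functions = {f \<in> borel_measurable M. \<forall>x. 0 \<le> f x \<and> f x \<le> 1}"

definition weight :: "('a \<Rightarrow> real) \<Rightarrow> 'a set \<Rightarrow> real" where
  "weight f B = (\<integral>x. f x * indicator B x \<partial>M)"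

text \<open>For uniformly bounded functions it is enough to test on indicators;
  \<open>weak_limit_integral\<close> passes from these to other test functions.\<close>

definition weak_limit :: "(nat \<Rightarrow> 'a \<Rightarrow> real) \<Rightarrow> ('a \<Rightarrow> real) \<Rightarrow> bool" where
  "weak_limit u h \<longleftrightarrow> (\<forall>B\<in>events. (\<lambda>n. weight (u n) B) \<longlonglongrightarrow> weight h B)"

definition measure_dense :: "(nat \<Rightarrow> 'a set) \<Rightarrow> bool" where
  "measure_dense D \<longleftrightarrow> range D \<subseteq> events \<and>
    (\<forall>B\<in>events. \<forall>e>0. \<exists>k. prob ((B - D k) \<union> (D k - B)) < e)"

lemma unit_functionsD:
  assumes "f \<in> unit_functions"
  shows "f \<in> borel_measurable M" "0 \<le> f x" "f x \<le> 1"
  using assms by (auto simp: unit_functions_def)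

lemma unit_const: "0 \<le> c \<Longrightarrow> c \<le> 1 \<Longrightarrow> (\<lambda>_. c) \<in> unit_functions"
  by (simp add: unit_functions_def)

lemma unit_indicator: "B \<in> events \<Longrightarrow> indicator B \<in> unit_functions"
  by (auto simp: unit_functions_def indicator_def)

lemma unit_mult:
  assumes "f \<in> unit_functions" "g \<in> unit_functions"
  shows "(\<lambda>x. f x * g x) \<in> unit_functions"
  using assms by (auto simp: unit_functions_def intro: mult_le_one)

lemma unit_integrable: "f \<in> unit_functions \<Longrightarrow> integrable M f"
  by (rule integrable_const_bound[where B=1]) (auto simp: unit_functions_def)

lemma integrable_unit_mult:
  "f \<in> unit_functions \<Longrightarrow> g \<in> unit_functions \<Longrightarrow> integrable M (\<lambda>x. f x * g x)"
  by (intro unit_integrable unit_mult)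

lemma weight_bounds:
  assumes f: "f \<in> unit_functions" and B: "B \<in> events"
  shows "0 \<le> weight f B" "weight f B \<le> prob B"
proof -
  show "0 \<le> weight f B"
    unfolding weight_def using f by (intro Bochner_Integration.integral_nonneg) (auto simp: unit_functions_def)
  have "weight f B \<le> (\<integral>x. indicator B x \<partial>M)"
    unfolding weight_def using f B unit_indicator[OF B]
    by (intro integral_mono integrable_unit_mult unit_integrable)
       (auto simp: unit_functions_def indicator_def)
  then show "weight f B \<le> prob B"
    using B by simp
qed

lemma weight_le_1: "f \<in> unit_functions \<Longrightarrow> B \<in> events \<Longrightarrow> weight f B \<le> 1"
  using weight_bounds(2) prob_le_1 by (meson order_trans)

lemma weight_space: "weight f (space M) = (\<integral>x. f x \<partial>M)"
  unfolding weight_def by (intro Bochner_Integration.integral_cong) auto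

lemma weight_Un:
  assumes f: "f \<in> unit_functions" and "A \<in> events" "B \<in> events" "A \<inter> B = {}"
  shows "weight f (A \<union> B) = weight f A + weight f B"
proof -
  have "weight f (A \<union> B) = (\<integral>x. f x * indicator A x + f x * indicator B x \<partial>M)"
    unfolding weight_def using assms(4)
    by (intro Bochner_Integration.integral_cong) (auto simp: indicator_def)
  also have "\<dots> = weight f A + weight f B"
    unfolding weight_def using assms
    by (intro Bochner_Integration.integral_add integrable_unit_mult unit_indicator)
  finally show ?thesis .
qed

text \<open>The bound does not depend on \<open>f\<close>. Hence convergence of weights on a dense
  family of sets carries over to all events.\<close>

lemma weight_approx:
  assumes f: "f \<in> unit_functions" and A: "A \<in> events" and B: "B \<in> events"
  shows "\<bar>weight f A - weight f B\<bar> \<le> prob ((A - B) \<union> (B - A))"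
proof -
  have "\<bar>weight f A - weight f B\<bar> = \<bar>\<integral>x. f x * indicator A x - f x * indicator B x \<partial>M\<bar>"
    unfolding weight_def using f A B
    by (subst Bochner_Integration.integral_diff) (auto intro!: integrable_unit_mult unit_indicator)
  also have "\<dots> \<le> (\<integral>x. indicator ((A - B) \<union> (B - A)) x \<partial>M)"
    using f A B
    by (intro integral_abs_bound[THEN order_trans] integral_mono integrable_abs
        Bochner_Integration.integrable_diff integrable_unit_mult unit_indicator unit_integrable)
       (auto simp: unit_functions_def indicator_def)
  also have "\<dots> = prob ((A - B) \<union> (B - A))"
    using A B by simp
  finally show ?thesis .
qed

lemma convergent_weight:
  assumes D: "measure_dense D" and u: "\<And>n. u n \<in> unit_functions"
    and conv: "\<And>k. convergent (\<lambda>n. weight (u n) (D k))" and B: "B \<in> events"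
  shows "convergent (\<lambda>n. weight (u n) B)"
proof -
  have "Cauchy (\<lambda>n. weight (u n) B)"
  proof (rule metric_CauchyI)
    fix e :: real assume "e > 0"
    then obtain k where k: "prob ((B - D k) \<union> (D k - B)) < e / 3"
      using D B unfolding measure_dense_def by (meson divide_pos_pos zero_less_numeral)
    have Dk: "D k \<in> events"
      using D by (auto simp: measure_dense_def)
    have c: "\<bar>weight (u n) B - weight (u n) (D k)\<bar> < e / 3" for n
      using weight_approx[OF u B Dk] k by (meson le_less_trans)
    obtain N where N: "\<And>m n. m \<ge> N \<Longrightarrow> n \<ge> N \<Longrightarrow> dist (weight (u m) (D k)) (weight (u n) (D k)) < e / 3"
      using convergent_Cauchy[OF conv[of k]] \<open>e > 0\<close> unfolding Cauchy_def
      by (meson divide_pos_pos zero_less_numeral)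
    have "dist (weight (u m) B) (weight (u n) B) < e" if "m \<ge> N" "n \<ge> N" for m n
      using N[OF that] c[of m] c[of n] unfolding dist_real_def by linarith
    then show "\<exists>N. \<forall>m\<ge>N. \<forall>n\<ge>N. dist (weight (u m) B) (weight (u n) B) < e"
      by blast
  qed
  then show ?thesis
    by (rule Cauchy_convergent)
qed

lemma weak_limit_dense:
  assumes D: "measure_dense D" and u: "\<And>n. u n \<in> unit_functions" and h: "h \<in> unit_functions"
    and lim: "\<And>k. (\<lambda>n. weight (u n) (D k)) \<longlonglongrightarrow> weight h (D k)"
  shows "weak_limit u h"
  unfolding weak_limit_def
proof
  fix B assume B: "B \<in> events"
  show "(\<lambda>n. weight (u n) B) \<longlonglongrightarrow> weight h B"
  proof (rule metric_LIMSEQ_I)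
    fix e :: real assume "e > 0"
    then obtain k where k: "prob ((B - D k) \<union> (D k - B)) < e / 3"
      using D B unfolding measure_dense_def by (meson divide_pos_pos zero_less_numeral)
    have Dk: "D k \<in> events"
      using D by (auto simp: measure_dense_def)
    have c: "\<bar>weight f B - weight f (D k)\<bar> < e / 3" if "f \<in> unit_functions" for f
      using weight_approx[OF that B Dk] k by (meson le_less_trans)
    obtain N where N: "\<And>n. n \<ge> N \<Longrightarrow> dist (weight (u n) (D k)) (weight h (D k)) < e / 3"
      using metric_LIMSEQ_D[OF lim[of k]] \<open>e > 0\<close> by (meson divide_pos_pos zero_less_numeral)
    have "dist (weight (u n) B) (weight h B) < e" if "n \<ge> N" for n
      using N[OF that] c[OF u[of n]] c[OF h] unfolding dist_real_def by linarith
    then show "\<exists>N. \<forall>n\<ge>N. dist (weight (u n) B) (weight h B) < e"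
      by blast
  qed
qed

text \<open>Radon-Nikodym for a set function that is only known to be finitely additive. Domination
  by \<open>prob\<close> yields continuity at the empty set, hence countable additivity; it also
  yields absolute continuity and the bound 1 for the density.\<close>

lemma density_of_dominated:
  assumes L: "\<And>B. B \<in> events \<Longrightarrow> 0 \<le> L B \<and> L B \<le> prob B"
    and add: "\<And>A B. A \<in> events \<Longrightarrow> B \<in> events \<Longrightarrow> A \<inter> B = {} \<Longrightarrow> L (A \<union> B) = L A + L B"
  obtains h where "h \<in> unit_functions" "\<And>B. B \<in> events \<Longrightarrow> weight h B = L B"
proof -
  define \<nu> where "\<nu> B = ennreal (L B)" for B
  have empty: "L {} = 0"
    using L[of "{}"] by simp
  have "positive events \<nu>"
    by (simp add: positive_def \<nu>_def empty)
  have ca: "countably_additive events \<nu>"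
  proof (rule sets.empty_continuous_imp_countably_additive)
    show "positive events \<nu>" by fact
    show "additive events \<nu>"
      using add L by (simp add: additive_def \<nu>_def)
    show "\<forall>A\<in>events. \<nu> A \<noteq> \<infinity>"
      by (simp add: \<nu>_def)
    fix A :: "nat \<Rightarrow> 'a set"
    assume A: "range A \<subseteq> events" "decseq A" "(\<Inter>i. A i) = {}"
    have lim: "(\<lambda>i. prob (A i)) \<longlonglongrightarrow> 0"
      using finite_Lim_measure_decseq[OF A(1,2)] A(3) by simp
    have "(\<lambda>i. L (A i)) \<longlonglongrightarrow> 0"
      by (rule tendsto_sandwich[OF _ _ tendsto_const lim]) (use L A(1) in auto)
    then show "(\<lambda>i. \<nu> (A i)) \<longlonglongrightarrow> 0"
      unfolding \<nu>_def using tendsto_ennrealI by fastforce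
  qed
  define N where "N = measure_of (space M) events \<nu>"
  have N_sets: "sets N = events"
    by (simp add: N_def)
  have N: "emeasure N B = \<nu> B" if "B \<in> events" for B
    unfolding N_def using sets.sigma_algebra_axioms \<open>positive events \<nu>\<close> ca that
    by (rule emeasure_measure_of_sigma)
  have "absolutely_continuous M N"
    unfolding absolutely_continuous_def
  proof
    fix B assume B: "B \<in> null_sets M"
    then have "B \<in> events" "prob B = 0"
      by (auto simp: measure_def)
    then have "L B = 0"
      using L[of B] by simp
    then show "B \<in> null_sets N"
      using \<open>B \<in> events\<close> N by (auto simp: null_sets_def N_sets \<nu>_def)
  qed
  then obtain f where f [measurable]: "f \<in> borel_measurable M" and fN: "density M f = N"
    using Radon_Nikodym[OF _ N_sets] by blast
  have nf: "(\<integral>\<^sup>+x. f x * indicator B x \<partial>M) = \<nu> B" if "B \<in> events" for B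
    using N[OF that] that by (simp add: emeasure_density flip: fN)
  have "(\<integral>\<^sup>+x. f x \<partial>M) = (\<integral>\<^sup>+x. f x * indicator (space M) x \<partial>M)"
    by (intro nn_integral_cong) simp
  also have "\<dots> = ennreal (L (space M))"
    by (rule nf[OF sets.top, unfolded \<nu>_def])
  finally have fin: "(\<integral>\<^sup>+x. f x \<partial>M) \<noteq> \<infinity>"
    by simp
  define g where "g x = enn2real (f x)" for x
  have [measurable]: "g \<in> borel_measurable M"
    unfolding g_def by measurable
  have fg: "AE x in M. f x = ennreal (g x)"
    using nn_integral_PInf_AE[OF f fin] by eventually_elim (simp add: g_def less_top)
  have g: "integrable M (\<lambda>x. g x * indicator B x)" "(\<integral>x. g x * indicator B x \<partial>M) = L B"
    if B [measurable]: "B \<in> events" for B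
  proof -
    have eq: "(\<integral>\<^sup>+x. ennreal (g x * indicator B x) \<partial>M) = \<nu> B"
      unfolding nf[OF B, symmetric] using fg
      by (intro nn_integral_cong_AE) (auto elim!: eventually_mono simp: indicator_def)
    show "integrable M (\<lambda>x. g x * indicator B x)"
      by (rule integrableI_nonneg) (auto simp: eq \<nu>_def, simp add: g_def)
    show "(\<integral>x. g x * indicator B x \<partial>M) = L B"
      by (subst integral_eq_nn_integral) (auto simp: eq \<nu>_def L[OF B], simp add: g_def)
  qed
  \<comment> \<open>On \<open>A\<close>, where the density exceeds 1, the integral of
    \<open>g - 1\<close> is \<open>L A - prob A\<close>, which is at most 0.\<close>
  have "AE x in M. g x \<le> 1"
  proof -
    define A where "A = {x \<in> space M. g x > 1}"
    have [measurable]: "A \<in> events"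
      by (simp add: A_def)
    have "integrable M (\<lambda>x. g x * indicator A x - indicator A x)"
      using g(1)[of A] by (intro Bochner_Integration.integrable_diff) (auto simp: emeasure_eq_measure)
    moreover have "(\<integral>x. g x * indicator A x - indicator A x \<partial>M) = L A - prob A"
      using g[of A] by (subst Bochner_Integration.integral_diff) (auto simp: emeasure_eq_measure)
    moreover have nn: "0 \<le> g x * indicator A x - indicator A x" for x
      by (auto simp: indicator_def A_def)
    ultimately have "(\<integral>x. g x * indicator A x - indicator A x \<partial>M) = 0"
      using L[of A] Bochner_Integration.integral_nonneg[of M "\<lambda>x. g x * indicator A x - indicator A x"] by simp
    then have "AE x in M. g x * indicator A x - indicator A x = 0"
      using \<open>integrable M (\<lambda>x. g x * indicator A x - indicator A x)\<close> nn
      by (subst (asm) integral_nonneg_eq_0_iff_AE) auto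
    then show ?thesis
      using AE_space by eventually_elim (auto simp: A_def indicator_def split: if_splits)
  qed
  \<comment> \<open>The truncation alters \<open>g\<close> on a null set only and provides the bound
    at every point.\<close>
  define h where "h x = min 1 (g x)" for x
  have "h \<in> unit_functions"
    unfolding unit_functions_def h_def by (auto simp: g_def)
  moreover have "weight h B = L B" if B: "B \<in> events" for B
    unfolding weight_def g(2)[OF B, symmetric]
    using \<open>AE x in M. g x \<le> 1\<close> B unfolding h_def
    by (intro integral_cong_AE) (auto elim!: eventually_mono)
  ultimately show thesis
    using that by blast
qed

text \<open>A subsequence converges on a countable dense family of sets, hence on all events. The
  limiting set function is additive and dominated by \<open>prob\<close>, so it has a density in the
  unit interval.\<close>

lemma weak_compactness:
  fixes u :: "nat \<Rightarrow> 'a \<Rightarrow> real"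
  assumes D: "measure_dense D" and u: "\<And>n. u n \<in> unit_functions"
  obtains r h where "strict_mono r" "h \<in> unit_functions" "weak_limit (u \<circ> r) h"
proof -
  have Dev: "D k \<in> events" for k
    using D by (auto simp: measure_dense_def)
  have "weight (u n) (D k) \<in> {0..1}" for n k
    using weight_bounds[OF u Dev] weight_le_1[OF u Dev] by auto
  then obtain r where r: "strict_mono r" "\<And>k. convergent (\<lambda>n. weight (u (r n)) (D k))"
    using unit_sequences_subseq[of "\<lambda>n k. weight (u n) (D k)"] by blast
  define L where "L B = lim (\<lambda>n. weight (u (r n)) B)" for B
  have L: "(\<lambda>n. weight (u (r n)) B) \<longlonglongrightarrow> L B" if "B \<in> events" for B
    unfolding L_def using convergent_weight[OF D, of "\<lambda>n. u (r n)"] u r(2) that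
    by (simp add: convergent_LIMSEQ_iff)
  have "0 \<le> L B \<and> L B \<le> prob B" if B: "B \<in> events" for B
    using weight_bounds[OF u B] by (auto intro: LIMSEQ_le_const[OF L[OF B]] LIMSEQ_le_const2[OF L[OF B]])
  moreover have "L (A \<union> B) = L A + L B" if "A \<in> events" "B \<in> events" "A \<inter> B = {}" for A B
  proof (rule LIMSEQ_unique)
    show "(\<lambda>n. weight (u (r n)) (A \<union> B)) \<longlonglongrightarrow> L (A \<union> B)"
      using that by (intro L) auto
    show "(\<lambda>n. weight (u (r n)) (A \<union> B)) \<longlonglongrightarrow> L A + L B"
      using weight_Un[OF u that] tendsto_add[OF L L] that by simp
  qed
  ultimately obtain h where h: "h \<in> unit_functions" "\<And>B. B \<in> events \<Longrightarrow> weight h B = L B"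
    using density_of_dominated by blast
  then have "weak_limit (u \<circ> r) h"
    using L by (simp add: weak_limit_def)
  with r(1) h(1) show thesis
    by (rule that)
qed

text \<open>Up to \<open>1 / N\<close>, the test function \<open>g\<close> is the mean of the
  indicators of the sets where \<open>g\<close> is at least \<open>k / N\<close>. The error is
  uniform in the function integrated against \<open>g\<close>, and the finite mean converges by
  definition.\<close>

lemma weak_limit_integral:
  assumes lim: "weak_limit u h" and u: "\<And>n. u n \<in> unit_functions" and h: "h \<in> unit_functions"
    and g: "g \<in> unit_functions"
  shows "(\<lambda>n. \<integral>x. u n x * g x \<partial>M) \<longlonglongrightarrow> (\<integral>x. h x * g x \<partial>M)"
proof (rule metric_LIMSEQ_I)
  fix e :: real assume "e > 0"
  obtain N :: nat where N: "N > 0" "1 / real N < e / 3"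
    using \<open>e > 0\<close> by (metis nat_approx_posE zero_less_Suc divide_pos_pos zero_less_numeral)
  define A where "A k = {x \<in> space M. real k \<le> real N * g x}" for k
  have A: "A k \<in> events" for k
    unfolding A_def using unit_functionsD(1)[OF g] by measurable
  define s where "s f = (\<Sum>k=1..N. weight f (A k)) / real N" for f
  have s: "\<bar>(\<integral>x. f x * g x \<partial>M) - s f\<bar> \<le> 1 / real N" if f: "f \<in> unit_functions" for f
  proof -
    have int: "integrable M (\<lambda>x. f x * indicator (A k) x)" for k
      using f A by (intro integrable_unit_mult unit_indicator)
    have "s f = (\<integral>x. (\<Sum>k=1..N. f x * indicator (A k) x) / real N \<partial>M)"
      unfolding s_def weight_def by (simp only: integral_divide_zero Bochner_Integration.integral_sum[OF int])
    moreover have int_sum: "integrable M (\<lambda>x. (\<Sum>k=1..N. f x * indicator (A k) x) / real N)"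
      by (intro integrable_divide_zero Bochner_Integration.integrable_sum int impI)
    ultimately have "(\<integral>x. f x * g x \<partial>M) - s f
        = (\<integral>x. f x * g x - (\<Sum>k=1..N. f x * indicator (A k) x) / real N \<partial>M)"
      by (simp only: Bochner_Integration.integral_diff[OF integrable_unit_mult[OF f g]])
    moreover have "\<bar>\<dots>\<bar> \<le> (\<integral>x. 1 / real N \<partial>M)"
    proof (rule integral_abs_bound[THEN order_trans], rule integral_mono)
      show "integrable M (\<lambda>x. \<bar>f x * g x - (\<Sum>k=1..N. f x * indicator (A k) x) / real N\<bar>)"
        by (intro integrable_abs Bochner_Integration.integrable_diff integrable_unit_mult f g int_sum)
      fix x assume x: "x \<in> space M"
      let ?y = "real N * g x"
      have y: "0 \<le> ?y" "?y \<le> real N"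
        using unit_functionsD(2,3)[OF g, of x] by (auto simp: mult_left_le)
      have "(\<Sum>k=1..N. f x * indicator (A k) x) = f x * (\<Sum>k=1..N. of_bool (real k \<le> ?y))"
        using x by (simp add: A_def indicator_def sum_distrib_left)
      then have eq: "(\<Sum>k=1..N. f x * indicator (A k) x) = f x * real_of_int \<lfloor>?y\<rfloor>"
        by (simp only: sum_of_bool_floor[OF y])
      have "f x * g x - f x * real_of_int \<lfloor>?y\<rfloor> / real N = f x * (?y - real_of_int \<lfloor>?y\<rfloor>) / real N"
        using N(1) by (simp add: field_simps)
      also have "\<bar>\<dots>\<bar> \<le> 1 / real N"
        using unit_functionsD(2,3)[OF f, of x]
        by (auto simp: abs_mult intro!: divide_right_mono mult_le_one) linarith+
      finally show "\<bar>f x * g x - (\<Sum>k=1..N. f x * indicator (A k) x) / real N\<bar> \<le> 1 / real N"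
        by (simp only: eq)
    qed simp
    ultimately show ?thesis
      by (simp add: prob_space)
  qed
  have "(\<lambda>n. s (u n)) \<longlonglongrightarrow> s h"
    unfolding s_def using lim A N(1) by (intro tendsto_intros) (auto simp: weak_limit_def)
  then obtain n0 where n0: "\<And>n. n \<ge> n0 \<Longrightarrow> dist (s (u n)) (s h) < e / 3"
    using metric_LIMSEQ_D \<open>e > 0\<close> by (meson divide_pos_pos zero_less_numeral)
  have "dist (\<integral>x. u n x * g x \<partial>M) (\<integral>x. h x * g x \<partial>M) < e" if "n \<ge> n0" for n
    using n0[OF that] s[OF u[of n]] s[OF h] N(2) unfolding dist_real_def by linarith
  then show "\<exists>n0. \<forall>n\<ge>n0. dist (\<integral>x. u n x * g x \<partial>M) (\<integral>x. h x * g x \<partial>M) < e"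
    by blast
qed

text \<open>After expanding the square, the mixed term tends to twice the squared norm of
  \<open>h\<close>. The limit thus measures the loss of norm: it is nonnegative, and it vanishes
  exactly for strong convergence.\<close>

lemma weak_limit_square_dist:
  assumes lim: "weak_limit u h" and u: "\<And>n. u n \<in> unit_functions" and h: "h \<in> unit_functions"
    and c: "(\<lambda>n. \<integral>x. (u n x)\<^sup>2 \<partial>M) \<longlonglongrightarrow> c"
  shows "(\<lambda>n. \<integral>x. (u n x - h x)\<^sup>2 \<partial>M) \<longlonglongrightarrow> c - (\<integral>x. (h x)\<^sup>2 \<partial>M)"
proof -
  have "(\<integral>x. (u n x - h x)\<^sup>2 \<partial>M)
      = (\<integral>x. (u n x)\<^sup>2 \<partial>M) - 2 * (\<integral>x. u n x * h x \<partial>M) + (\<integral>x. (h x)\<^sup>2 \<partial>M)" for n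
  proof -
    note int = integrable_unit_mult[OF u h, of n] integrable_unit_mult[OF u u, of n n]
      integrable_unit_mult[OF h h]
    have "(\<integral>x. (u n x - h x)\<^sup>2 \<partial>M) = (\<integral>x. u n x * u n x - 2 * (u n x * h x) + h x * h x \<partial>M)"
      by (intro Bochner_Integration.integral_cong) (auto simp: power2_eq_square algebra_simps)
    then show ?thesis
      using int by (simp add: power2_eq_square)
  qed
  moreover have "(\<lambda>n. (\<integral>x. (u n x)\<^sup>2 \<partial>M) - 2 * (\<integral>x. u n x * h x \<partial>M) + (\<integral>x. (h x)\<^sup>2 \<partial>M))
      \<longlonglongrightarrow> c - 2 * (\<integral>x. h x * h x \<partial>M) + (\<integral>x. (h x)\<^sup>2 \<partial>M)"
    by (intro tendsto_intros c weak_limit_integral[OF lim u h h])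
  ultimately show ?thesis
    by (simp add: power2_eq_square)
qed

lemma weak_limit_norm_le:
  assumes "weak_limit u h" "\<And>n. u n \<in> unit_functions" "h \<in> unit_functions"
    and "(\<lambda>n. \<integral>x. (u n x)\<^sup>2 \<partial>M) \<longlonglongrightarrow> c"
  shows "(\<integral>x. (h x)\<^sup>2 \<partial>M) \<le> c"
  using LIMSEQ_le_const[OF weak_limit_square_dist[OF assms], of 0] by simp

end

section \<open>Weak limits of translates with small offset\<close>

text \<open>Terms for the algebra generated by a sequence of sets, which is therefore countable.\<close>

datatype nor_expr = Atom nat | Nor nor_expr nor_expr

instance nor_expr :: countable
  by countable_datatype

primrec nor_eval :: "'a set \<Rightarrow> (nat \<Rightarrow> 'a set) \<Rightarrow> nor_expr \<Rightarrow> 'a set" where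
  "nor_eval \<Omega> e (Atom n) = e n"
| "nor_eval \<Omega> e (Nor a b) = \<Omega> - (nor_eval \<Omega> e a \<union> nor_eval \<Omega> e b)"

context prob_space
begin

text \<open>The sets approximable by terms form a sigma-algebra: complements and finite unions are
  terms again, and a countable union is cut off after finitely many sets at a small loss.\<close>

lemma measure_dense_exists:
  fixes e :: "nat \<Rightarrow> 'a set"
  assumes e: "events = sigma_sets (space M) (range e)" "range e \<subseteq> Pow (space M)"
  shows "\<exists>D. measure_dense D"
proof -
  define E where "E = nor_eval (space M) e"
  define \<Delta> where "\<Delta> A B = (A - B) \<union> (B - A)" for A B :: "'a set"
  have atom: "e n \<in> events" for n
    unfolding e(1) by (rule sigma_sets.Basic) simp
  have E: "E x \<in> events" for x
    by (induction x) (auto simp: E_def atom)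
  have Un: "\<exists>z. E z = E x \<union> E y" for x y
  proof
    show "E (Nor (Nor x y) (Nor x y)) = E x \<union> E y"
      using sets.sets_into_space[OF E[of x]] sets.sets_into_space[OF E[of y]] by (auto simp: E_def)
  qed
  have empty: "\<exists>z. E z = {}"
  proof
    show "E (Nor (Atom 0) (Nor (Atom 0) (Atom 0))) = {}"
      by (auto simp: E_def)
  qed
  have approx: "\<forall>d>0. \<exists>x. prob (\<Delta> B (E x)) < d" if "B \<in> sigma_sets (space M) (range e)" for B
    using that
  proof induction
    case (Basic A)
    then obtain n where "A = E (Atom n)"
      by (auto simp: E_def)
    then show ?case
      by (intro allI impI exI[of _ "Atom n"]) (simp add: \<Delta>_def)
  next
    case Empty
    obtain z where "E z = {}"
      using empty by blast
    then show ?case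
      by (intro allI impI exI[of _ z]) (simp add: \<Delta>_def)
  next
    case (Compl A)
    have A: "A \<subseteq> space M"
      using Compl.hyps e(2) sigma_sets_into_sp by metis
    show ?case
    proof (intro allI impI)
      fix d :: real assume "d > 0"
      then obtain x where x: "prob (\<Delta> A (E x)) < d"
        using Compl.IH by blast
      have "\<Delta> (space M - A) (E (Nor x x)) = \<Delta> A (E x)"
        using A sets.sets_into_space[OF E[of x]] by (auto simp: \<Delta>_def E_def)
      with x show "\<exists>x. prob (\<Delta> (space M - A) (E x)) < d"
        by metis
    qed
  next
    case (Union A)
    have A: "A i \<in> events" for i
      using Union.hyps e(1) by blast
    show ?case
    proof (intro allI impI)
      fix d :: real assume "d > 0"
      define B where "B = (\<Union>i. A i)"
      have B: "B \<in> events"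
        using A by (auto simp: B_def)
      \<comment> \<open>Half of \<open>d\<close> is spent on the tail \<open>C n\<close>, which
        shrinks to the empty set; the other half is shared by the first \<open>n\<close>
        sets.\<close>
      define C where "C n = B - (\<Union>i<n. A i)" for n
      have C: "C n \<in> events" for n
        using A B by (auto simp: C_def)
      have "decseq C"
        unfolding decseq_def C_def by fastforce
      moreover have "(\<Inter>n. C n) = {}"
        unfolding C_def B_def by auto
      ultimately have "(\<lambda>n. prob (C n)) \<longlonglongrightarrow> 0"
        using finite_Lim_measure_decseq[of C] C by auto
      then obtain n where n: "prob (C n) < d / 2"
        using \<open>d > 0\<close> metric_LIMSEQ_D[of _ 0 "d / 2"] by (fastforce simp: dist_real_def)
      have "\<exists>x. prob (\<Delta> (A i) (E x)) < d / 2 / (real n + 1)" for i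
        using Union.IH \<open>d > 0\<close> by simp
      then obtain x where x: "\<And>i. prob (\<Delta> (A i) (E (x i))) < d / 2 / (real n + 1)"
        by metis
      have "\<exists>z. E z = (\<Union>i<m. E (x i))" for m
      proof (induction m)
        case (Suc m)
        then show ?case
          using Un by (metis UN_insert lessThan_Suc)
      qed (use empty in simp)
      then obtain z where z: "E z = (\<Union>i<n. E (x i))"
        by blast
      have \<Delta>: "\<Delta> (A i) (E (x i)) \<in> events" for i
        using A E by (auto simp: \<Delta>_def)
      have "prob (\<Delta> B (E z)) \<le> prob (C n \<union> (\<Union>i<n. \<Delta> (A i) (E (x i))))"
        using C \<Delta> by (intro finite_measure_mono) (auto simp: \<Delta>_def z C_def B_def)
      also have "\<dots> \<le> prob (C n) + prob (\<Union>i<n. \<Delta> (A i) (E (x i)))"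
        using C \<Delta> by (intro measure_Un_le) auto
      also have "prob (\<Union>i<n. \<Delta> (A i) (E (x i))) \<le> (\<Sum>i<n. prob (\<Delta> (A i) (E (x i))))"
        using \<Delta> by (intro finite_measure_subadditive_finite) auto
      also have "\<dots> \<le> (\<Sum>i<n. d / 2 / (real n + 1))"
        using x by (intro sum_mono less_imp_le)
      also have "\<dots> \<le> d / 2"
        using divide_Suc_bound(2)[of "d / 2" "real n"] \<open>d > 0\<close> by simp
      finally have "prob (\<Delta> B (E z)) < d"
        using n by simp
      then show "\<exists>x. prob (\<Delta> (\<Union>i. A i) (E x)) < d"
        unfolding B_def by blast
    qed
  qed
  have "measure_dense (\<lambda>k. E (from_nat k))"
    unfolding measure_dense_def
  proof (intro conjI ballI allI impI)
    show "range (\<lambda>k. E (from_nat k)) \<subseteq> events"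
      using E by auto
    fix B and d :: real assume "B \<in> events" "d > 0"
    then obtain x where "prob (\<Delta> B (E x)) < d"
      using approx e(1) by blast
    then show "\<exists>k. prob ((B - E (from_nat k)) \<union> (E (from_nat k) - B)) < d"
      by (intro exI[of _ "to_nat x"]) (simp add: \<Delta>_def)
  qed
  then show ?thesis
    by blast
qed

end

lemma compact_countable_basis:
  assumes "compact (UNIV :: 'a::metric_space set)"
  obtains B :: "'a::metric_space set set" where "countable B" "topological_basis B"
proof -
  have "\<exists>K. finite K \<and> (\<forall>x::'a. \<exists>y\<in>K. dist y x < 1 / real (Suc n))" for n
  proof -
    have "\<exists>K. finite K \<and> K \<subseteq> UNIV \<and> (UNIV :: 'a set) \<subseteq> (\<Union>x\<in>K. ball x (1 / real (Suc n)))"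
      using seq_compact_imp_totally_bounded[of "UNIV :: 'a set"] assms
      unfolding compact_eq_seq_compact_metric by simp
    then obtain K where K: "finite K" "(UNIV :: 'a set) \<subseteq> (\<Union>x\<in>K. ball x (1 / real (Suc n)))"
      by blast
    have "\<exists>y\<in>K. dist y x < 1 / real (Suc n)" for x :: 'a
      using subsetD[OF K(2), of x] by auto
    with K(1) show ?thesis
      by blast
  qed
  then obtain K where K: "\<And>n. finite (K n)" "\<And>n (x::'a). \<exists>y\<in>K n. dist y x < 1 / real (Suc n)"
    by metis
  define B where "B = (\<Union>n. (\<lambda>y. ball y (1 / real (Suc n))) ` K n)"
  have "countable B"
    unfolding B_def using K(1) by (intro countable_UN) (auto intro: countable_finite)
  moreover have "topological_basis B"
  proof (rule topological_basisI)
    show "open b" if "b \<in> B" for b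
      using that by (auto simp: B_def)
    fix S and x :: 'a assume "open S" "x \<in> S"
    then obtain e where e: "e > 0" "\<And>y. dist y x < e \<Longrightarrow> y \<in> S"
      unfolding open_dist by blast
    obtain n where n: "1 / real (Suc n) < e / 2"
      using e(1) nat_approx_posE[of "e / 2"] by auto
    obtain y where y: "y \<in> K n" "dist y x < 1 / real (Suc n)"
      using K(2) by blast
    have "ball y (1 / real (Suc n)) \<subseteq> S"
    proof
      fix z assume "z \<in> ball y (1 / real (Suc n))"
      then have "dist z x < e"
        using dist_triangle[of z x y] y(2) n by (simp add: dist_commute)
      then show "z \<in> S"
        by (rule e(2))
    qed
    with y show "\<exists>b\<in>B. x \<in> b \<and> b \<subseteq> S"
      by (intro bexI[of _ "ball y (1 / real (Suc n))"]) (auto simp: B_def)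
  qed
  ultimately show thesis
    by (rule that)
qed

section \<open>Offsets and directional limits\<close>

definition offset :: "real \<Rightarrow> int \<times> int \<Rightarrow> real" where
  "offset \<beta> p = of_int (snd p) - \<beta> * of_int (fst p)"

lemma strip_iff_offset: "p \<in> strip \<beta> b \<longleftrightarrow> \<bar>offset \<beta> p\<bar> \<le> b"
  by (auto simp: strip_def offset_def abs_le_iff split: prod.splits)

lemma offset_add [simp]: "offset \<beta> (p + q) = offset \<beta> p + offset \<beta> q"
  and offset_diff [simp]: "offset \<beta> (p - q) = offset \<beta> p - offset \<beta> q"
  and offset_0 [simp]: "offset \<beta> 0 = 0"
  by (simp_all add: offset_def algebra_simps)

text \<open>By \<open>strip_covering\<close>, finitely many translates of the given strip cover the
  strip of width 1, and that one contains the point \<open>s n\<close> for every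
  \<open>n\<close>.\<close>

lemma infinite_strip:
  assumes "b > 0"
  shows "infinite (strip \<beta> b)"
proof
  assume fin: "finite (strip \<beta> b)"
  define s where "s n = (int n, \<lfloor>\<beta> * real n\<rfloor>)" for n
  obtain F where F: "finite F" "\<And>p. p \<in> strip \<beta> 1 \<Longrightarrow> \<exists>q\<in>F. p - q \<in> strip \<beta> b"
    using strip_covering[OF assms] by metis
  have "s n \<in> strip \<beta> 1" for n
    unfolding strip_iff_offset s_def offset_def by (simp add: abs_le_iff) linarith
  have "range s \<subseteq> (\<Union>q\<in>F. (\<lambda>p. q + p) ` strip \<beta> b)"
  proof
    fix p assume "p \<in> range s"
    then obtain q where q: "q \<in> F" "p - q \<in> strip \<beta> b"
      using F(2) \<open>\<And>n. s n \<in> strip \<beta> 1\<close> by blast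
    have "p = q + (p - q)"
      by simp
    with q show "p \<in> (\<Union>q\<in>F. (\<lambda>p. q + p) ` strip \<beta> b)"
      by blast
  qed
  then have "finite (range s)"
    using F(1) fin by (metis (no_types, lifting) finite_UN finite_imageI finite_subset)
  moreover have "inj s"
    by (rule injI) (simp add: s_def)
  ultimately show False
    using finite_imageD by blast
qed

context Z2_mpds
begin

lemma space_UNIV: "space \<mu> = UNIV"
  using sets_eq_imp_space_eq[OF sets_borel] by simp

text \<open>The homomorphism property makes \<open>T 0\<close> idempotent; an injective idempotent
  map is the identity.\<close>

lemma T_zero: "T 0 x = x"
proof -
  obtain S where "\<And>y. S (T 0 y) = y"
    using homeomorphism_T[of 0] by (auto simp: homeomorphism_def)
  moreover have "T 0 (T 0 x) = T 0 x"
    using T_add[of 0 0] by (metis add.right_neutral comp_apply)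
  ultimately show ?thesis
    by metis
qed

lemma T_comp: "T p (T q x) = T (p + q) x"
  by (simp add: T_add)

lemma T_cancel [simp]: "T (- p) (T p x) = x" "T p (T (- p) x) = x"
  by (simp_all add: T_comp T_zero)

lemma vimage_T_events [measurable]: "B \<in> events \<Longrightarrow> T p -` B \<in> events"
  using measurable_sets[OF measurable_T, of B p] by (simp add: space_UNIV)

lemma prob_vimage_T: "B \<in> events \<Longrightarrow> prob (T p -` B) = prob B"
  using measure_distr[OF measurable_T, of B p] by (simp add: space_UNIV invariant)

lemma dense_sequence:
  obtains D where "measure_dense D"
proof -
  obtain B :: "'a set set" where B: "countable B" "topological_basis B"
    using compact_countable_basis[OF compact_space] .
  \<comment> \<open>The empty set ensures that the enumerated basis is nonempty.\<close>
  let ?B = "insert {} B"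
  have basis: "topological_basis ?B"
    using B(2) unfolding topological_basis_def by (simp, meson subset_insertI2)
  define e where "e = from_nat_into ?B"
  have e: "range e = ?B"
    unfolding e_def using B(1) by (intro range_from_nat_into) auto
  have "events = sigma_sets (space \<mu>) (range e)"
  proof -
    have "borel = sigma UNIV ?B"
      using B(1) by (intro borel_eq_countable_basis basis) simp
    then show ?thesis
      unfolding sets_borel space_UNIV e by (metis sets_measure_of subset_UNIV Pow_UNIV)
  qed
  then show thesis
    using measure_dense_exists that by (auto simp: space_UNIV)
qed

lemma unit_T: "f \<in> unit_functions \<Longrightarrow> f \<circ> T p \<in> unit_functions"
  by (auto simp: unit_functions_def)

lemma weight_T:
  assumes "f \<in> unit_functions" "B \<in> events"
  shows "weight (f \<circ> T q) B = weight f (T (- q) -` B)"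
proof -
  have m: "(\<lambda>y. f y * indicator (T (- q) -` B) y) \<in> borel_measurable \<mu>"
    using assms unit_functionsD(1)[OF assms(1)] by measurable
  have "weight (f \<circ> T q) B = (\<integral>x. f (T q x) * indicator (T (- q) -` B) (T q x) \<partial>\<mu>)"
    unfolding weight_def by (intro Bochner_Integration.integral_cong) (auto simp: indicator_def)
  also have "\<dots> = weight f (T (- q) -` B)"
    unfolding weight_def by (rule integral_T[OF m])
  finally show ?thesis .
qed

lemma integral_square_T:
  "f \<in> unit_functions \<Longrightarrow> (\<integral>x. ((f \<circ> T p) x)\<^sup>2 \<partial>\<mu>) = (\<integral>x. (f x)\<^sup>2 \<partial>\<mu>)"
  using integral_T[of "\<lambda>x. (f x)\<^sup>2" p] unit_functionsD(1)[of f] by simp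

lemma weak_limit_T:
  assumes "weak_limit u h" "\<And>n. u n \<in> unit_functions" "h \<in> unit_functions"
  shows "weak_limit (\<lambda>n. u n \<circ> T q) (h \<circ> T q)"
  using assms by (simp add: weak_limit_def weight_T)

definition directional_limit ::
    "real \<Rightarrow> 'i set \<Rightarrow> ('i \<Rightarrow> 'a \<Rightarrow> real) \<Rightarrow> ('i \<Rightarrow> 'a \<Rightarrow> real) \<Rightarrow> bool" where
  "directional_limit \<beta> I f h \<longleftrightarrow>
    (\<forall>\<epsilon>>0. \<forall>\<D>. finite \<D> \<and> \<D> \<subseteq> events \<longrightarrow>
      (\<exists>p. \<bar>offset \<beta> p\<bar> < \<epsilon> \<and> (\<forall>i\<in>I. \<forall>B\<in>\<D>. \<bar>weight (f i \<circ> T p) B - weight (h i) B\<bar> < \<epsilon>)))"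

lemma directional_limitD:
  assumes "directional_limit \<beta> I f h" "\<epsilon> > 0" "finite \<D>" "\<D> \<subseteq> events"
  obtains p where "\<bar>offset \<beta> p\<bar> < \<epsilon>" "\<And>i B. i \<in> I \<Longrightarrow> B \<in> \<D> \<Longrightarrow> \<bar>weight (f i \<circ> T p) B - weight (h i) B\<bar> < \<epsilon>"
  using assms unfolding directional_limit_def by metis

lemma directional_limit_refl: "directional_limit \<beta> I f f"
  unfolding directional_limit_def
  by (intro allI impI exI[of _ 0]) (simp add: o_def T_zero)

text \<open>If \<open>q\<close> brings \<open>h\<close> close to \<open>k\<close> on the test sets,
  then \<open>p\<close> has to bring \<open>f\<close> close to \<open>h\<close> on these sets
  translated by \<open>q\<close>. So \<open>q\<close> comes first. Offsets add, so each receives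
  half of \<open>\<epsilon>\<close>.\<close>

lemma directional_limit_trans:
  assumes fh: "directional_limit \<beta> I f h" and hk: "directional_limit \<beta> I h k"
    and f: "\<And>i. i \<in> I \<Longrightarrow> f i \<in> unit_functions" and h: "\<And>i. i \<in> I \<Longrightarrow> h i \<in> unit_functions"
  shows "directional_limit \<beta> I f k"
  unfolding directional_limit_def
proof (intro allI impI)
  fix \<epsilon> :: real and \<D> assume "\<epsilon> > 0" and \<D>: "finite \<D> \<and> \<D> \<subseteq> events"
  then have \<epsilon>: "\<epsilon> / 2 > 0"
    by simp
  obtain q where q: "\<bar>offset \<beta> q\<bar> < \<epsilon> / 2"
    "\<And>i B. i \<in> I \<Longrightarrow> B \<in> \<D> \<Longrightarrow> \<bar>weight (h i \<circ> T q) B - weight (k i) B\<bar> < \<epsilon> / 2"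
    using directional_limitD[OF hk \<epsilon>, of \<D>] \<D> by blast
  have "finite ((\<lambda>B. T (- q) -` B) ` \<D>)" "(\<lambda>B. T (- q) -` B) ` \<D> \<subseteq> events"
    using \<D> by auto
  from directional_limitD[OF fh \<epsilon> this] obtain p where p: "\<bar>offset \<beta> p\<bar> < \<epsilon> / 2"
    "\<And>i B. i \<in> I \<Longrightarrow> B \<in> (\<lambda>B. T (- q) -` B) ` \<D> \<Longrightarrow> \<bar>weight (f i \<circ> T p) B - weight (h i) B\<bar> < \<epsilon> / 2"
    by blast
  show "\<exists>p. \<bar>offset \<beta> p\<bar> < \<epsilon> \<and> (\<forall>i\<in>I. \<forall>B\<in>\<D>. \<bar>weight (f i \<circ> T p) B - weight (k i) B\<bar> < \<epsilon>)"
  proof (intro exI[of _ "p + q"] conjI ballI)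
    show "\<bar>offset \<beta> (p + q)\<bar> < \<epsilon>"
      using p(1) q(1) by simp
    fix i B assume iB: "i \<in> I" "B \<in> \<D>"
    then have B: "B \<in> events"
      using \<D> by blast
    have "weight (f i \<circ> T (p + q)) B = weight ((f i \<circ> T p) \<circ> T q) B"
      by (simp add: T_add o_assoc)
    then have "weight (f i \<circ> T (p + q)) B = weight (f i \<circ> T p) (T (- q) -` B)"
      using weight_T[OF unit_T[OF f[OF iB(1)]] B] by simp
    moreover have "weight (h i \<circ> T q) B = weight (h i) (T (- q) -` B)"
      using weight_T[OF h[OF iB(1)] B] .
    ultimately show "\<bar>weight (f i \<circ> T (p + q)) B - weight (k i) B\<bar> < \<epsilon>"
      using p(2)[OF iB(1) imageI[OF iB(2)]] q(2)[OF iB] by linarith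
  qed
qed

text \<open>A dense sequence of test sets suffices for bounded functions; at stage \<open>n\<close>
  its first \<open>n + 1\<close> members are tested.\<close>

lemma directional_limit_sequence:
  assumes lim: "directional_limit \<beta> I f h"
    and f: "\<And>i. i \<in> I \<Longrightarrow> f i \<in> unit_functions" and h: "\<And>i. i \<in> I \<Longrightarrow> h i \<in> unit_functions"
  obtains p where "(\<lambda>n. offset \<beta> (p n)) \<longlonglongrightarrow> 0"
    "\<And>i. i \<in> I \<Longrightarrow> weak_limit (\<lambda>n. f i \<circ> T (p n)) (h i)"
proof -
  obtain D where D: "measure_dense D"
    using dense_sequence .
  have "\<exists>p. \<bar>offset \<beta> p\<bar> < 1 / real (Suc n) \<and>
      (\<forall>i\<in>I. \<forall>k\<le>n. \<bar>weight (f i \<circ> T p) (D k) - weight (h i) (D k)\<bar> < 1 / real (Suc n))" for n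
  proof -
    have "finite (D ` {..n})" "D ` {..n} \<subseteq> events" "0 < 1 / real (Suc n)"
      using D by (auto simp: measure_dense_def)
    from directional_limitD[OF lim this(3,1,2)] obtain p where p: "\<bar>offset \<beta> p\<bar> < 1 / real (Suc n)"
      "\<And>i B. i \<in> I \<Longrightarrow> B \<in> D ` {..n} \<Longrightarrow> \<bar>weight (f i \<circ> T p) B - weight (h i) B\<bar> < 1 / real (Suc n)"
      by blast
    then show ?thesis
      by (intro exI[of _ p]) auto
  qed
  then obtain p where p: "\<And>n. \<bar>offset \<beta> (p n)\<bar> < 1 / real (Suc n)"
    "\<And>n i k. i \<in> I \<Longrightarrow> k \<le> n \<Longrightarrow> \<bar>weight (f i \<circ> T (p n)) (D k) - weight (h i) (D k)\<bar> < 1 / real (Suc n)"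
    by metis
  have lim0: "(\<lambda>n. 1 / real (Suc n)) \<longlonglongrightarrow> 0"
    using LIMSEQ_inverse_real_of_nat by (simp add: inverse_eq_divide)
  show thesis
  proof
    show "(\<lambda>n. offset \<beta> (p n)) \<longlonglongrightarrow> 0"
      using p(1) by (intro Lim_null_comparison[OF _ lim0]) (auto intro: always_eventually less_imp_le)
    fix i assume i: "i \<in> I"
    show "weak_limit (\<lambda>n. f i \<circ> T (p n)) (h i)"
    proof (rule weak_limit_dense[OF D])
      fix k
      have "(\<lambda>n. weight (f i \<circ> T (p n)) (D k) - weight (h i) (D k)) \<longlonglongrightarrow> 0"
        using p(2)[OF i] by (intro Lim_null_comparison[OF _ lim0])
          (auto intro!: eventually_sequentiallyI[of k] less_imp_le)
      then show "(\<lambda>n. weight (f i \<circ> T (p n)) (D k)) \<longlonglongrightarrow> weight (h i) (D k)"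
        by (rule LIM_zero_cancel)
    qed (use f h i unit_T in auto)
  qed
qed

lemma directional_limitI_sequence:
  assumes I: "finite I" and p: "(\<lambda>n. offset \<beta> (p n)) \<longlonglongrightarrow> 0"
    and lim: "\<And>i. i \<in> I \<Longrightarrow> weak_limit (\<lambda>n. f i \<circ> T (p n)) (h i)"
  shows "directional_limit \<beta> I f h"
  unfolding directional_limit_def
proof (intro allI impI)
  fix \<epsilon> :: real and \<D> assume \<epsilon>: "\<epsilon> > 0" and \<D>: "finite \<D> \<and> \<D> \<subseteq> events"
  have "\<forall>\<^sub>F n in sequentially. \<bar>offset \<beta> (p n)\<bar> < \<epsilon>"
    using tendstoD[OF p \<epsilon>] by (simp add: dist_real_def)
  moreover have "\<forall>\<^sub>F n in sequentially. \<forall>i\<in>I. \<forall>B\<in>\<D>. \<bar>weight (f i \<circ> T (p n)) B - weight (h i) B\<bar> < \<epsilon>"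
  proof (intro eventually_ball_finite ballI I)
    show "finite \<D>"
      using \<D> by simp
    fix i B assume "i \<in> I" "B \<in> \<D>"
    then have "(\<lambda>n. weight (f i \<circ> T (p n)) B) \<longlonglongrightarrow> weight (h i) B"
      using lim \<D> by (auto simp: weak_limit_def)
    from tendstoD[OF this \<epsilon>] show "\<forall>\<^sub>F n in sequentially. \<bar>weight (f i \<circ> T (p n)) B - weight (h i) B\<bar> < \<epsilon>"
      by (simp add: dist_real_def)
  qed
  ultimately have "\<forall>\<^sub>F n in sequentially. \<bar>offset \<beta> (p n)\<bar> < \<epsilon> \<and>
      (\<forall>i\<in>I. \<forall>B\<in>\<D>. \<bar>weight (f i \<circ> T (p n)) B - weight (h i) B\<bar> < \<epsilon>)"
    by eventually_elim simp
  then show "\<exists>p. \<bar>offset \<beta> p\<bar> < \<epsilon> \<and> (\<forall>i\<in>I. \<forall>B\<in>\<D>. \<bar>weight (f i \<circ> T p) B - weight (h i) B\<bar> < \<epsilon>)"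
    using eventually_happens'[OF sequentially_bot] by blast
qed

text \<open>Along a sequence that realises the limits on \<open>I\<close>, a subsequence also makes
  \<open>f j\<close> converge, by weak compactness. The new limit \<open>g\<close> is not under
  control here.\<close>

lemma directional_limit_extend:
  assumes I: "finite I" "j \<notin> I" and lim: "directional_limit \<beta> I f h"
    and f: "\<And>i. i \<in> insert j I \<Longrightarrow> f i \<in> unit_functions" and h: "\<And>i. i \<in> I \<Longrightarrow> h i \<in> unit_functions"
  obtains g where "g \<in> unit_functions" "directional_limit \<beta> (insert j I) f (h(j := g))"
proof -
  obtain p where p: "(\<lambda>n. offset \<beta> (p n)) \<longlonglongrightarrow> 0"
    "\<And>i. i \<in> I \<Longrightarrow> weak_limit (\<lambda>n. f i \<circ> T (p n)) (h i)"
    using directional_limit_sequence[OF lim] f h by (metis insertCI)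
  obtain D where D: "measure_dense D"
    using dense_sequence .
  obtain r g where r: "strict_mono r" and g: "g \<in> unit_functions"
    and rg: "weak_limit ((\<lambda>n. f j \<circ> T (p n)) \<circ> r) g"
    using weak_compactness[OF D, of "\<lambda>n. f j \<circ> T (p n)"] f unit_T by (metis insertI1)
  have "directional_limit \<beta> (insert j I) f (h(j := g))"
  proof (rule directional_limitI_sequence[where p="p \<circ> r"])
    show "finite (insert j I)"
      using I by simp
    show "(\<lambda>n. offset \<beta> ((p \<circ> r) n)) \<longlonglongrightarrow> 0"
      using LIMSEQ_subseq_LIMSEQ[OF p(1) r] by (simp add: o_def)
    fix i assume i: "i \<in> insert j I"
    show "weak_limit (\<lambda>n. f i \<circ> T ((p \<circ> r) n)) ((h(j := g)) i)"
    proof (cases "i = j")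
      case True
      then show ?thesis
        using rg by (simp add: o_def)
    next
      case False
      then have "weak_limit (\<lambda>n. f i \<circ> T (p n)) (h i)"
        using i p(2) by auto
      then show ?thesis
        using False LIMSEQ_subseq_LIMSEQ[OF _ r] by (fastforce simp: weak_limit_def o_def)
    qed
  qed
  with g show thesis
    by (rule that)
qed

lemma directional_limit_integral:
  assumes "directional_limit \<beta> I f h" "i \<in> I" "f i \<in> unit_functions"
  shows "(\<integral>x. h i x \<partial>\<mu>) = (\<integral>x. f i x \<partial>\<mu>)"
proof (rule ccontr)
  assume "(\<integral>x. h i x \<partial>\<mu>) \<noteq> (\<integral>x. f i x \<partial>\<mu>)"
  then have "\<bar>(\<integral>x. f i x \<partial>\<mu>) - (\<integral>x. h i x \<partial>\<mu>)\<bar> > 0"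
    by simp
  then obtain p where "\<bar>weight (f i \<circ> T p) (space \<mu>) - weight (h i) (space \<mu>)\<bar> < \<bar>(\<integral>x. f i x \<partial>\<mu>) - (\<integral>x. h i x \<partial>\<mu>)\<bar>"
    using directional_limitD[OF assms(1), of _ "{space \<mu>}"] assms(2) by blast
  moreover have "weight (f i \<circ> T p) (space \<mu>) = (\<integral>x. f i x \<partial>\<mu>)"
    using integral_T[OF unit_functionsD(1)[OF assms(3)], of p] by (simp add: weight_space)
  ultimately show False
    by (simp add: weight_space)
qed

end

section \<open>Minimal weak limits have compact orbits\<close>

context prob_space
begin

text \<open>A nonconstant \<open>g\<close> has mass above and below its mean \<open>a\<close>. Just
  above \<open>a\<close> there is an interval of levels that all split the space, and only countably
  many of them carry mass. A level without mass is wanted because there the level sets are stable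
  under small perturbations of \<open>g\<close>.\<close>

lemma nonconstant_splitting_level:
  assumes g: "g \<in> unit_functions" and nc: "\<not> (AE x in M. g x = (\<integral>x. g x \<partial>M))"
  obtains c where "prob {x \<in> space M. g x = c} = 0"
    "0 < prob {x \<in> space M. g x > c}" "prob {x \<in> space M. g x > c} < 1"
proof -
  define a where "a = (\<integral>x. g x \<partial>M)"
  have [measurable]: "g \<in> borel_measurable M"
    using unit_functionsD(1)[OF g] .
  note int = unit_integrable[OF g]
  have below: "prob {x \<in> space M. g x < a} \<noteq> 0"
  proof
    assume "prob {x \<in> space M. g x < a} = 0"
    then have ge: "AE x in M. 0 \<le> g x - a"
      by (subst (asm) prob_eq_0) (auto simp: not_less elim!: eventually_mono)
    have "(\<integral>x. g x - a \<partial>M) = 0"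
      using int by (simp add: prob_space a_def)
    then have "AE x in M. g x - a = 0"
      using integral_nonneg_eq_0_iff_AE[OF _ ge] int by simp
    then show False
      using nc by (simp add: a_def)
  qed
  have above: "prob {x \<in> space M. g x > a} \<noteq> 0"
  proof
    assume "prob {x \<in> space M. g x > a} = 0"
    then have ge: "AE x in M. 0 \<le> a - g x"
      by (subst (asm) prob_eq_0) (auto simp: not_less elim!: eventually_mono)
    have "(\<integral>x. a - g x \<partial>M) = 0"
      using int by (simp add: prob_space a_def)
    then have "AE x in M. a - g x = 0"
      using integral_nonneg_eq_0_iff_AE[OF _ ge] int by simp
    then have "AE x in M. g x = a"
      by eventually_elim simp
    then show False
      using nc by (simp add: a_def)
  qed
  have UN: "(\<Union>n. {x \<in> space M. g x \<ge> a + 1 / real (Suc n)}) = {x \<in> space M. g x > a}" (is "(\<Union>n. ?A n) = _")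
  proof (intro set_eqI iffI)
    fix x assume x: "x \<in> {x \<in> space M. g x > a}"
    show "x \<in> (\<Union>n. ?A n)"
    proof -
      obtain n where "1 / real (Suc n) < g x - a"
        using x nat_approx_posE[of "g x - a"] by auto
      with x show ?thesis
        by (intro UN_I[of n]) (simp_all del: of_nat_Suc)
    qed
  next
    fix x assume "x \<in> (\<Union>n. ?A n)"
    then obtain n where "x \<in> space M" "a + 1 / real (Suc n) \<le> g x"
      by blast
    moreover have "0 < 1 / real (Suc n)"
      by simp
    ultimately have "a < g x"
      by linarith
    with \<open>x \<in> space M\<close> show "x \<in> {x \<in> space M. g x > a}"
      by simp
  qed
  obtain n where n: "prob (?A n) \<noteq> 0"
  proof (rule ccontr)
    assume "\<not> thesis"
    then have "prob (?A n) = 0" for n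
      using that by blast
    then have "?A n \<in> null_sets M" for n
      by (intro null_setsI) (auto simp: emeasure_eq_measure)
    then have "(\<Union>n. ?A n) \<in> null_sets M"
      by (rule null_sets_UN)
    then show False
      using above unfolding UN by (simp add: measure_eq_0_null_sets)
  qed
  interpret G: prob_space "distr M borel g"
    by (rule prob_space_distr) simp
  obtain c where c: "a < c" "c < a + 1 / real (Suc n)" "measure (distr M borel g) {c} = 0"
    using real_interval_avoid_countable_set[OF _ G.countable_support, of a "a + 1 / real (Suc n)"] by auto
  show thesis
  proof
    have "g -` {c} \<inter> space M = {x \<in> space M. g x = c}"
      by auto
    then show "prob {x \<in> space M. g x = c} = 0"
      using c(3) by (simp add: measure_distr)
    have "prob (?A n) \<le> prob {x \<in> space M. g x > c}"
      using c(2) by (intro finite_measure_mono) auto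
    then show "0 < prob {x \<in> space M. g x > c}"
      using n measure_nonneg[of M "?A n"] by linarith
    have "prob {x \<in> space M. g x > c} \<le> prob (space M - {x \<in> space M. g x < a})"
      using c(1) by (intro finite_measure_mono) auto
    also have "\<dots> = 1 - prob {x \<in> space M. g x < a}"
      by (intro prob_compl) measurable
    finally show "prob {x \<in> space M. g x > c} < 1"
      using below measure_nonneg[of M "{x \<in> space M. g x < a}"] by linarith
  qed
qed

lemma integrable_unit_diff_square:
  assumes f: "f \<in> unit_functions" and h: "h \<in> unit_functions"
  shows "integrable M (\<lambda>x. (f x - h x)\<^sup>2)"
proof -
  have "integrable M (\<lambda>x. f x * f x - 2 * (f x * h x) + h x * h x)"
    by (intro Bochner_Integration.integrable_add Bochner_Integration.integrable_diff
        integrable_mult_right integrable_unit_mult f h)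
  then show ?thesis
    by (simp add: power2_eq_square algebra_simps)
qed

text \<open>A point where exactly one of \<open>u\<close> and \<open>h\<close> exceeds
  \<open>c\<close> has \<open>u\<close> within \<open>\<eta>\<close> of \<open>c\<close>, or else
  \<open>u\<close> and \<open>h\<close> at least \<open>\<eta>\<close> apart; the second case is
  bounded by Markov's inequality. The last term mentions \<open>u\<close> alone: \<open>u\<close>
  will be a translate of a fixed function, and then the term does not depend on the
  translation.\<close>

lemma level_set_dist:
  fixes u h :: "'a \<Rightarrow> real" and c \<eta> :: real
  assumes u: "u \<in> borel_measurable M" "integrable M (\<lambda>x. (u x - h x)\<^sup>2)" and h: "h \<in> borel_measurable M"
    and "\<eta> > 0"
  defines "A \<equiv> {x \<in> space M. u x > c}" and "B \<equiv> {x \<in> space M. h x > c}"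
  shows "prob ((A - B) \<union> (B - A)) \<le> (\<integral>x. (u x - h x)\<^sup>2 \<partial>M) / \<eta>\<^sup>2 + prob {x \<in> space M. \<bar>u x - c\<bar> \<le> \<eta>}"
proof -
  note [measurable] = u(1) h
  have "prob ((A - B) \<union> (B - A)) \<le> prob ({x \<in> space M. (u x - h x)\<^sup>2 \<ge> \<eta>\<^sup>2} \<union> {x \<in> space M. \<bar>u x - c\<bar> \<le> \<eta>})"
  proof (intro finite_measure_mono subsetI)
    fix x assume x: "x \<in> (A - B) \<union> (B - A)"
    have "\<eta> \<le> \<bar>u x - h x\<bar>" if "\<eta> < \<bar>u x - c\<bar>"
      using x that by (auto simp: A_def B_def)
    then have "(u x - h x)\<^sup>2 \<ge> \<eta>\<^sup>2" if "\<eta> < \<bar>u x - c\<bar>"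
      using that \<open>\<eta> > 0\<close> power_mono[of \<eta> "\<bar>u x - h x\<bar>" 2] by simp
    then show "x \<in> {x \<in> space M. (u x - h x)\<^sup>2 \<ge> \<eta>\<^sup>2} \<union> {x \<in> space M. \<bar>u x - c\<bar> \<le> \<eta>}"
      using x by (cases "\<bar>u x - c\<bar> \<le> \<eta>") (auto simp: A_def B_def)
  qed measurable
  also have "\<dots> \<le> prob {x \<in> space M. (u x - h x)\<^sup>2 \<ge> \<eta>\<^sup>2} + prob {x \<in> space M. \<bar>u x - c\<bar> \<le> \<eta>}"
    by (intro measure_Un_le) measurable
  also have "prob {x \<in> space M. (u x - h x)\<^sup>2 \<ge> \<eta>\<^sup>2} \<le> (\<integral>x. (u x - h x)\<^sup>2 \<partial>M) / \<eta>\<^sup>2"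
    using u(2) \<open>\<eta> > 0\<close> by (intro integral_Markov_inequality_measure[where A="{}"]) auto
  finally show ?thesis
    by simp
qed

lemma small_level_neighbourhood:
  fixes g :: "'a \<Rightarrow> real"
  assumes [measurable]: "g \<in> borel_measurable M" and 0: "prob {x \<in> space M. g x = c} = 0" and "e > 0"
  obtains \<eta> where "\<eta> > 0" "prob {x \<in> space M. \<bar>g x - c\<bar> \<le> \<eta>} < e"
proof -
  let ?A = "\<lambda>n. {x \<in> space M. \<bar>g x - c\<bar> \<le> 1 / real (Suc n)}"
  have dec: "decseq ?A"
  proof (rule decseq_SucI, rule subsetI)
    fix n x assume "x \<in> ?A (Suc n)"
    moreover have "1 / real (Suc (Suc n)) \<le> 1 / real (Suc n)"
      by (intro divide_left_mono) auto
    ultimately show "x \<in> ?A n"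
      by (simp del: of_nat_Suc)
  qed
  have "(\<Inter>n. ?A n) = {x \<in> space M. g x = c}"
  proof (intro set_eqI iffI)
    fix x assume x: "x \<in> (\<Inter>n. ?A n)"
    have "\<bar>g x - c\<bar> \<le> 0"
    proof (rule field_le_epsilon)
      fix d :: real assume "0 < d"
      then obtain n where "1 / real (Suc n) < d"
        using nat_approx_posE by blast
      moreover have "\<bar>g x - c\<bar> \<le> 1 / real (Suc n)"
        using x by blast
      ultimately show "\<bar>g x - c\<bar> \<le> 0 + d"
        by linarith
    qed
    with x show "x \<in> {x \<in> space M. g x = c}"
      by auto
  qed auto
  moreover have "(\<lambda>n. prob (?A n)) \<longlonglongrightarrow> prob (\<Inter>n. ?A n)"
    using dec by (intro finite_Lim_measure_decseq) auto
  ultimately have "(\<lambda>n. prob (?A n)) \<longlonglongrightarrow> 0"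
    using 0 by simp
  then obtain n where "prob (?A n) < e"
    using metric_LIMSEQ_D[of "\<lambda>n. prob (?A n)" 0 e] \<open>e > 0\<close> by (auto simp: dist_real_def simp del: of_nat_Suc)
  then show thesis
    by (intro that[of "1 / real (Suc n)"]) auto
qed

end

section \<open>Minimal limits and the Kronecker algebra\<close>

context Z2_mpds
begin

lemma L2_dist_indicator:
  assumes "A \<in> events" "B \<in> events"
  shows "L2_dist \<mu> (L2_class \<mu> (indicator A)) (L2_class \<mu> (indicator B)) = sqrt (prob ((A - B) \<union> (B - A)))"
proof -
  have "(\<lambda>x. (cmod (indicator A x - indicator B x))\<^sup>2) = (indicator ((A - B) \<union> (B - A)) :: 'a \<Rightarrow> real)"
    by (auto simp: indicator_def)
  then show ?thesis
    using assms by (simp add: L2_dist_class indicator_L2)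
qed

lemma koopman_indicator: "koopman T p (indicator B) = indicator (T p -` B)"
  by (auto simp: koopman_def indicator_def)

text \<open>Minimality refers to the limits of \<open>g\<close> alone, so the function from which
  \<open>g\<close> arose can be forgotten. The index set \<open>{()}\<close> is the case of a single
  function.\<close>

definition limit_minimal :: "real \<Rightarrow> ('a \<Rightarrow> real) \<Rightarrow> bool" where
  "limit_minimal \<beta> g \<longleftrightarrow> g \<in> unit_functions \<and>
    (\<forall>h\<in>unit_functions. directional_limit \<beta> {()} (\<lambda>_. g) (\<lambda>_. h) \<longrightarrow>
      (\<integral>x. (g x)\<^sup>2 \<partial>\<mu>) \<le> (\<integral>x. (h x)\<^sup>2 \<partial>\<mu>))"

text \<open>Direct method: a minimising sequence has a weak limit \<open>g\<close>, the norm does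
  not increase in the limit, and \<open>g\<close> is a limit of \<open>f\<close> again. Limits of
  \<open>g\<close> are limits of \<open>f\<close> by transitivity, so they compete for the same
  infimum \<open>m\<close>.\<close>

lemma limit_minimal_exists:
  assumes f: "f \<in> unit_functions"
  obtains g where "limit_minimal \<beta> g" "directional_limit \<beta> {()} (\<lambda>_. f) (\<lambda>_. g)"
proof -
  define sq where "sq h = (\<integral>x. (h x)\<^sup>2 \<partial>\<mu>)" for h :: "'a \<Rightarrow> real"
  define S where "S = {h \<in> unit_functions. directional_limit \<beta> {()} (\<lambda>_. f) (\<lambda>_. h)}"
  define m where "m = Inf (sq ` S)"
  have "f \<in> S"
    using f by (simp add: S_def directional_limit_refl)
  have bdd: "bdd_below (sq ` S)"
    by (intro bdd_belowI[of _ 0]) (auto simp: sq_def)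
  have "\<exists>h\<in>S. sq h < m + 1 / real (Suc n)" for n
    using cInf_lessD[of "sq ` S" "m + 1 / real (Suc n)"] \<open>f \<in> S\<close> unfolding m_def by force
  then obtain h where h: "\<And>n. h n \<in> S" "\<And>n. sq (h n) < m + 1 / real (Suc n)"
    by metis
  have m: "m \<le> sq k" if "k \<in> S" for k
    unfolding m_def using bdd that by (intro cInf_lower) auto
  have sq_lim: "(\<lambda>n. sq (h n)) \<longlonglongrightarrow> m"
  proof (rule tendsto_sandwich[OF always_eventually always_eventually tendsto_const])
    show "(\<lambda>n. m + inverse (real (Suc n))) \<longlonglongrightarrow> m"
      by (rule LIMSEQ_inverse_real_of_nat_add)
    show "\<forall>n. m \<le> sq (h n)"
      using m h(1) by blast
    show "\<forall>n. sq (h n) \<le> m + inverse (real (Suc n))"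
      using less_imp_le[OF h(2)] by (simp add: inverse_eq_divide)
  qed
  have hu: "h n \<in> unit_functions" for n
    using h(1) by (simp add: S_def)
  obtain D where D: "measure_dense D"
    using dense_sequence .
  obtain r g where r: "strict_mono r" and g: "g \<in> unit_functions" and lim: "weak_limit (h \<circ> r) g"
    by (rule weak_compactness[OF D hu])
  have "sq g \<le> m"
    unfolding sq_def
  proof (rule weak_limit_norm_le[OF lim _ g])
    show "(h \<circ> r) n \<in> unit_functions" for n
      using hu by simp
    show "(\<lambda>n. \<integral>x. ((h \<circ> r) n x)\<^sup>2 \<partial>\<mu>) \<longlonglongrightarrow> m"
      using LIMSEQ_subseq_LIMSEQ[OF sq_lim r] by (simp add: sq_def o_def)
  qed
  have fg: "directional_limit \<beta> {()} (\<lambda>_. f) (\<lambda>_. g)"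
    unfolding directional_limit_def
  proof (intro allI impI)
    fix \<epsilon> :: real and \<D> assume \<epsilon>: "\<epsilon> > 0" and \<D>: "finite \<D> \<and> \<D> \<subseteq> events"
    have "\<forall>\<^sub>F n in sequentially. \<forall>B\<in>\<D>. \<bar>weight (h (r n)) B - weight g B\<bar> < \<epsilon> / 2"
    proof (intro eventually_ball_finite ballI)
      fix B assume "B \<in> \<D>"
      then have "(\<lambda>n. weight (h (r n)) B) \<longlonglongrightarrow> weight g B"
        using lim \<D> by (auto simp: weak_limit_def)
      from tendstoD[OF this, of "\<epsilon> / 2"] \<epsilon> show "\<forall>\<^sub>F n in sequentially. \<bar>weight (h (r n)) B - weight g B\<bar> < \<epsilon> / 2"
        by (simp add: dist_real_def)
    qed (use \<D> in simp)
    then obtain n where n: "\<And>B. B \<in> \<D> \<Longrightarrow> \<bar>weight (h (r n)) B - weight g B\<bar> < \<epsilon> / 2"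
      using eventually_happens'[OF sequentially_bot] by blast
    have "directional_limit \<beta> {()} (\<lambda>_. f) (\<lambda>_. h (r n))"
      using h(1) by (simp add: S_def)
    from directional_limitD[OF this half_gt_zero[OF \<epsilon>], of \<D>] \<D>
    obtain p where p: "\<bar>offset \<beta> p\<bar> < \<epsilon> / 2"
      "\<And>i B. i \<in> {()} \<Longrightarrow> B \<in> \<D> \<Longrightarrow> \<bar>weight (f \<circ> T p) B - weight (h (r n)) B\<bar> < \<epsilon> / 2"
      by blast
    show "\<exists>p. \<bar>offset \<beta> p\<bar> < \<epsilon> \<and> (\<forall>i\<in>{()}. \<forall>B\<in>\<D>. \<bar>weight (f \<circ> T p) B - weight g B\<bar> < \<epsilon>)"
    proof (intro exI[of _ p] conjI ballI)
      show "\<bar>offset \<beta> p\<bar> < \<epsilon>"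
        using p(1) \<epsilon> by simp
      fix i B assume iB: "i \<in> {()}" "B \<in> \<D>"
      show "\<bar>weight (f \<circ> T p) B - weight g B\<bar> < \<epsilon>"
        using p(2)[OF iB] n[OF iB(2)] by linarith
    qed
  qed
  have "limit_minimal \<beta> g"
    unfolding limit_minimal_def
  proof (intro conjI ballI impI g)
    fix k assume k: "k \<in> unit_functions" "directional_limit \<beta> {()} (\<lambda>_. g) (\<lambda>_. k)"
    have "directional_limit \<beta> {()} (\<lambda>_. f) (\<lambda>_. k)"
      using fg k(2) by (rule directional_limit_trans) (use f g in auto)
    then have "m \<le> sq k"
      using k(1) by (intro m) (simp add: S_def)
    then show "(\<integral>x. (g x)\<^sup>2 \<partial>\<mu>) \<le> (\<integral>x. (k x)\<^sup>2 \<partial>\<mu>)"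
      using \<open>sq g \<le> m\<close> by (simp add: sq_def)
  qed
  then show thesis
    using fg by (rule that)
qed

text \<open>Minimality bounds the norm of \<open>g\<close> by that of \<open>k\<close>, while norms
  do not grow in the weak limits leading from \<open>g\<close> to \<open>h\<close> and from
  \<open>h\<close> to \<open>k\<close>. So all three norms agree, and the weak convergence to
  \<open>h\<close> loses no norm.\<close>

lemma limit_minimal_compact_orbit:
  fixes p :: "nat \<Rightarrow> int \<times> int"
  assumes "limit_minimal \<beta> g" and p: "\<And>n. \<bar>offset \<beta> (p n)\<bar> \<le> c"
  obtains r h where "strict_mono r" "h \<in> unit_functions"
    "(\<lambda>n. \<integral>x. (g (T (p (r n)) x) - h x)\<^sup>2 \<partial>\<mu>) \<longlonglongrightarrow> 0"
proof -
  have g: "g \<in> unit_functions"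
    and min: "\<And>h. h \<in> unit_functions \<Longrightarrow> directional_limit \<beta> {()} (\<lambda>_. g) (\<lambda>_. h) \<Longrightarrow>
      (\<integral>x. (g x)\<^sup>2 \<partial>\<mu>) \<le> (\<integral>x. (h x)\<^sup>2 \<partial>\<mu>)"
    using assms(1) by (auto simp: limit_minimal_def)
  obtain D where D: "measure_dense D"
    using dense_sequence .
  have compact: "seq_compact {-c..c}"
    by (simp add: compact_imp_seq_compact)
  have "offset \<beta> (p n) \<in> {-c..c}" for n
    using p[of n] by (auto simp: abs_le_iff minus_le_iff)
  then have "\<exists>l\<in>{-c..c}. \<exists>r. strict_mono r \<and> ((\<lambda>n. offset \<beta> (p n)) \<circ> r) \<longlonglongrightarrow> l"
    using compact[unfolded seq_compact_def, THEN spec, of "\<lambda>n. offset \<beta> (p n)"] by simp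
  then obtain l r0 where r0: "strict_mono r0" and l: "((\<lambda>n. offset \<beta> (p n)) \<circ> r0) \<longlonglongrightarrow> l"
    by blast
  obtain r1 h where r1: "strict_mono r1" and h: "h \<in> unit_functions"
    and lim1: "weak_limit ((\<lambda>n. g \<circ> T (p (r0 n))) \<circ> r1) h"
    by (rule weak_compactness[OF D, of "\<lambda>n. g \<circ> T (p (r0 n))"]) (rule unit_T[OF g])
  define q where "q n = p (r0 (r1 n))" for n
  have lim_q: "weak_limit (\<lambda>n. g \<circ> T (q n)) h"
    using lim1 by (simp add: q_def o_def)
  have "(\<lambda>n. offset \<beta> (q n)) \<longlonglongrightarrow> l"
    using LIMSEQ_subseq_LIMSEQ[OF l r1] by (simp add: q_def o_def)
  then have Cauchy: "Cauchy (\<lambda>n. offset \<beta> (q n))"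
    by (rule LIMSEQ_imp_Cauchy)
  obtain r2 k where r2: "strict_mono r2" and k: "k \<in> unit_functions"
    and lim2: "weak_limit ((\<lambda>n. h \<circ> T (- q n)) \<circ> r2) k"
    by (rule weak_compactness[OF D, of "\<lambda>n. h \<circ> T (- q n)"]) (rule unit_T[OF h])
  \<comment> \<open>\<open>k\<close> is a double limit of the translates of \<open>g\<close> by \<open>q i - q j\<close>, whose offsets tend to \<open>0\<close>.\<close>
  have "directional_limit \<beta> {()} (\<lambda>_. g) (\<lambda>_. k)"
    unfolding directional_limit_def
  proof (intro allI impI)
    fix \<epsilon> :: real and \<D> assume \<epsilon>: "\<epsilon> > 0" and \<D>: "finite \<D> \<and> \<D> \<subseteq> events"
    obtain N where N: "\<And>m n. m \<ge> N \<Longrightarrow> n \<ge> N \<Longrightarrow> dist (offset \<beta> (q m)) (offset \<beta> (q n)) < \<epsilon>"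
      using Cauchy \<epsilon> unfolding Cauchy_def by meson
    have ev: "\<forall>\<^sub>F n in sequentially. \<forall>B\<in>\<D>. \<bar>weight (u n) B - weight w B\<bar> < \<epsilon> / 2"
      if "weak_limit u w" for u w
    proof (intro eventually_ball_finite ballI)
      fix B assume "B \<in> \<D>"
      then have "(\<lambda>n. weight (u n) B) \<longlonglongrightarrow> weight w B"
        using that \<D> by (auto simp: weak_limit_def)
      from tendstoD[OF this, of "\<epsilon> / 2"] \<epsilon> show "\<forall>\<^sub>F n in sequentially. \<bar>weight (u n) B - weight w B\<bar> < \<epsilon> / 2"
        by (simp add: dist_real_def)
    qed (use \<D> in simp)
    have "\<forall>\<^sub>F n in sequentially. r2 n \<ge> N"
      using filterlim_subseq[OF r2] by (simp add: filterlim_at_top)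
    then have "\<forall>\<^sub>F n in sequentially. r2 n \<ge> N \<and> (\<forall>B\<in>\<D>. \<bar>weight (h \<circ> T (- q (r2 n))) B - weight k B\<bar> < \<epsilon> / 2)"
      using ev[OF lim2] by eventually_elim simp
    \<comment> \<open>\<open>j\<close> is fixed before \<open>i\<close>, because the closeness of
      \<open>g \<circ> T (q i)\<close> to \<open>h\<close> has to be tested after a translation by
      \<open>- q j\<close>. Both indices are at least \<open>N\<close>, so that the offsets nearly
      cancel.\<close>
    then obtain j where j: "j \<ge> N" "\<And>B. B \<in> \<D> \<Longrightarrow> \<bar>weight (h \<circ> T (- q j)) B - weight k B\<bar> < \<epsilon> / 2"
      using eventually_happens'[OF sequentially_bot] by blast
    have "weak_limit (\<lambda>n. (g \<circ> T (q n)) \<circ> T (- q j)) (h \<circ> T (- q j))"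
      using lim_q unit_T[OF g] h by (rule weak_limit_T)
    from ev[OF this] eventually_ge_at_top[of N]
    have "\<forall>\<^sub>F n in sequentially. n \<ge> N \<and>
        (\<forall>B\<in>\<D>. \<bar>weight ((g \<circ> T (q n)) \<circ> T (- q j)) B - weight (h \<circ> T (- q j)) B\<bar> < \<epsilon> / 2)"
      by eventually_elim simp
    then obtain i where i: "i \<ge> N"
      "\<And>B. B \<in> \<D> \<Longrightarrow> \<bar>weight ((g \<circ> T (q i)) \<circ> T (- q j)) B - weight (h \<circ> T (- q j)) B\<bar> < \<epsilon> / 2"
      using eventually_happens'[OF sequentially_bot] by blast
    have eq: "(g \<circ> T (q i)) \<circ> T (- q j) = g \<circ> T (q i - q j)"
      using T_add[of "q i" "- q j"] by (simp add: o_assoc)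
    show "\<exists>p. \<bar>offset \<beta> p\<bar> < \<epsilon> \<and> (\<forall>a\<in>{()}. \<forall>B\<in>\<D>. \<bar>weight (g \<circ> T p) B - weight k B\<bar> < \<epsilon>)"
    proof (intro exI[of _ "q i - q j"] conjI ballI)
      show "\<bar>offset \<beta> (q i - q j)\<bar> < \<epsilon>"
        using N[OF i(1) j(1)] by (simp add: dist_real_def)
      fix B assume B: "B \<in> \<D>"
      show "\<bar>weight (g \<circ> T (q i - q j)) B - weight k B\<bar> < \<epsilon>"
        using i(2)[OF B] j(2)[OF B] unfolding eq by linarith
    qed
  qed
  then have "(\<integral>x. (g x)\<^sup>2 \<partial>\<mu>) \<le> (\<integral>x. (k x)\<^sup>2 \<partial>\<mu>)"
    using k by (rule min[rotated])
  also have "\<dots> \<le> (\<integral>x. (h x)\<^sup>2 \<partial>\<mu>)"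
  proof (rule weak_limit_norm_le[OF lim2 _ k])
    show "((\<lambda>n. h \<circ> T (- q n)) \<circ> r2) n \<in> unit_functions" for n
      using unit_T[OF h] by simp
    show "(\<lambda>n. \<integral>x. (((\<lambda>n. h \<circ> T (- q n)) \<circ> r2) n x)\<^sup>2 \<partial>\<mu>) \<longlonglongrightarrow> (\<integral>x. (h x)\<^sup>2 \<partial>\<mu>)"
      using integral_square_T[OF h] by (simp add: o_def)
  qed
  finally have le: "(\<integral>x. (g x)\<^sup>2 \<partial>\<mu>) \<le> (\<integral>x. (h x)\<^sup>2 \<partial>\<mu>)" .
  have "(\<lambda>n. \<integral>x. ((g \<circ> T (q n)) x)\<^sup>2 \<partial>\<mu>) \<longlonglongrightarrow> (\<integral>x. (g x)\<^sup>2 \<partial>\<mu>)"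
    by (simp only: integral_square_T[OF g] tendsto_const)
  from weak_limit_square_dist[OF lim_q unit_T[OF g] h this]
  have lim: "(\<lambda>n. \<integral>x. (g (T (q n) x) - h x)\<^sup>2 \<partial>\<mu>) \<longlonglongrightarrow> (\<integral>x. (g x)\<^sup>2 \<partial>\<mu>) - (\<integral>x. (h x)\<^sup>2 \<partial>\<mu>)"
    by simp
  \<comment> \<open>A limit of squared distances is nonnegative, which is the opposite inequality
    between the norms.\<close>
  have "0 \<le> (\<integral>x. (g x)\<^sup>2 \<partial>\<mu>) - (\<integral>x. (h x)\<^sup>2 \<partial>\<mu>)"
    by (rule LIMSEQ_le_const[OF lim]) auto
  with le lim have "(\<lambda>n. \<integral>x. (g (T (q n) x) - h x)\<^sup>2 \<partial>\<mu>) \<longlonglongrightarrow> 0"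
    by simp
  moreover have "strict_mono (r0 \<circ> r1)"
    using r0 r1 by (rule strict_mono_o)
  ultimately show thesis
    using h by (intro that[of "r0 \<circ> r1" h]) (simp_all add: q_def)
qed

text \<open>Compactness of the closure is checked by accumulation of infinite subsets of the orbit.
  A subsequence of translates of \<open>g\<close> converges in mean square to some \<open>h\<close>,
  and the level sets follow. \<open>\<eta>\<close> is chosen from \<open>g\<close> alone and works
  for all translates, as the action preserves the measure.\<close>

lemma level_set_in_kronecker:
  assumes min: "limit_minimal \<beta> g" and c: "prob {x \<in> space \<mu>. g x = c} = 0"
  shows "{x \<in> space \<mu>. g x > c} \<in> directional_kronecker \<mu> T \<beta>"
proof -
  interpret L2: Metric_space "L2_space \<mu>" "L2_dist \<mu>"
    by (rule Metric_space_L2)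
  have g: "g \<in> unit_functions"
    using min by (simp add: limit_minimal_def)
  have [measurable]: "g \<in> borel_measurable \<mu>"
    using unit_functionsD(1)[OF g] .
  define B where "B = {x \<in> space \<mu>. g x > c}"
  have B: "B \<in> events"
    unfolding B_def by measurable
  define orb where "orb = {L2_class \<mu> (koopman T p (indicator B)) | p. p \<in> strip \<beta> 1}"
  have "compactin L2.mtopology (L2.mtopology closure_of orb)"
    unfolding L2.compact_closure_of_eq_Bolzano_Weierstrass
  proof (intro allI impI)
    fix S assume S: "infinite S \<and> S \<subseteq> orb \<and> S \<subseteq> L2_space \<mu>"
    then obtain \<sigma> :: "nat \<Rightarrow> _" where \<sigma>: "inj \<sigma>" "range \<sigma> \<subseteq> S"
      using infinite_countable_subset by blast
    have "\<exists>p. \<bar>offset \<beta> p\<bar> \<le> 1 \<and> \<sigma> n = L2_class \<mu> (indicator (T p -` B))" for n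
      using \<sigma>(2) S unfolding orb_def koopman_indicator strip_iff_offset by blast
    then obtain p where p: "\<And>n. \<bar>offset \<beta> (p n)\<bar> \<le> 1" "\<And>n. \<sigma> n = L2_class \<mu> (indicator (T (p n) -` B))"
      by metis
    obtain r h where r: "strict_mono r" and h: "h \<in> unit_functions"
      and lim: "(\<lambda>n. \<integral>x. (g (T (p (r n)) x) - h x)\<^sup>2 \<partial>\<mu>) \<longlonglongrightarrow> 0"
      by (rule limit_minimal_compact_orbit[OF min p(1)])
    have [measurable]: "h \<in> borel_measurable \<mu>"
      using unit_functionsD(1)[OF h] .
    define C where "C = {x \<in> space \<mu>. h x > c}"
    have C: "C \<in> events"
      unfolding C_def by measurable
    have "L2_class \<mu> (indicator C) \<in> L2.mtopology derived_set_of S"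
      unfolding L2.metric_derived_set_of
    proof (intro CollectI conjI allI impI)
      show "L2_class \<mu> (indicator C) \<in> L2_space \<mu>"
        using C by (simp add: indicator_L2)
      fix e :: real assume e: "e > 0"
      then have "e\<^sup>2 / 2 > 0"
        by simp
      then obtain \<eta> where \<eta>: "\<eta> > 0" "prob {x \<in> space \<mu>. \<bar>g x - c\<bar> \<le> \<eta>} < e\<^sup>2 / 2"
        using small_level_neighbourhood[OF _ c, of "e\<^sup>2 / 2"] by auto
      have "e\<^sup>2 / 2 * \<eta>\<^sup>2 > 0"
        using e \<eta>(1) by simp
      then obtain N where N: "\<And>n. n \<ge> N \<Longrightarrow> (\<integral>x. (g (T (p (r n)) x) - h x)\<^sup>2 \<partial>\<mu>) < e\<^sup>2 / 2 * \<eta>\<^sup>2"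
        using order_tendstoD(2)[OF lim] unfolding eventually_sequentially by blast
      have close: "\<sigma> (r n) \<in> L2.mball (L2_class \<mu> (indicator C)) e" if "n \<ge> N" for n
      proof -
        let ?A = "T (p (r n)) -` B"
        have A: "?A = {x \<in> space \<mu>. (g \<circ> T (p (r n))) x > c}"
          by (auto simp: B_def space_UNIV)
        have u: "g \<circ> T (p (r n)) \<in> unit_functions"
          by (rule unit_T[OF g])
        have "integrable \<mu> (\<lambda>x. ((g \<circ> T (p (r n))) x - h x)\<^sup>2)"
          using u h by (rule integrable_unit_diff_square)
        from level_set_dist[OF unit_functionsD(1)[OF u] this unit_functionsD(1)[OF h] \<eta>(1), of c]
        have "prob ((?A - C) \<union> (C - ?A)) \<le> (\<integral>x. (g (T (p (r n)) x) - h x)\<^sup>2 \<partial>\<mu>) / \<eta>\<^sup>2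
            + prob {x \<in> space \<mu>. \<bar>(g \<circ> T (p (r n))) x - c\<bar> \<le> \<eta>}"
          unfolding A C_def by simp
        moreover have "{x \<in> space \<mu>. \<bar>(g \<circ> T (p (r n))) x - c\<bar> \<le> \<eta>} =
            T (p (r n)) -` {x \<in> space \<mu>. \<bar>g x - c\<bar> \<le> \<eta>}"
          by (auto simp: space_UNIV)
        then have "prob {x \<in> space \<mu>. \<bar>(g \<circ> T (p (r n))) x - c\<bar> \<le> \<eta>} = prob {x \<in> space \<mu>. \<bar>g x - c\<bar> \<le> \<eta>}"
          by (simp only:) (rule prob_vimage_T, measurable)
        moreover have "(\<integral>x. (g (T (p (r n)) x) - h x)\<^sup>2 \<partial>\<mu>) / \<eta>\<^sup>2 < e\<^sup>2 / 2"
          using N[OF that] \<eta>(1) by (simp add: pos_divide_less_eq)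
        ultimately have "prob ((?A - C) \<union> (C - ?A)) < e\<^sup>2"
          using \<eta>(2) by linarith
        then have "prob ((C - ?A) \<union> (?A - C)) < e\<^sup>2"
          by (simp only: Un_commute)
        then have "sqrt (prob ((C - ?A) \<union> (?A - C))) < e"
          using e by (intro real_less_lsqrt) auto
        moreover have "?A \<in> events"
          using B by simp
        ultimately show ?thesis
          using C by (simp add: p(2) L2_dist_indicator indicator_L2)
      qed
      \<comment> \<open>A derived set asks for a point different from the limit; of two distinct
        terms at least one qualifies.\<close>
      have "\<sigma> (r N) \<noteq> \<sigma> (r (Suc N))"
        using \<sigma>(1) r by (simp add: inj_eq strict_mono_eq)
      then obtain n where n: "n \<ge> N" "\<sigma> (r n) \<noteq> L2_class \<mu> (indicator C)"
        by (metis le_Suc_eq order_refl)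
      then show "\<exists>y\<in>S. y \<noteq> L2_class \<mu> (indicator C) \<and> y \<in> L2.mball (L2_class \<mu> (indicator C)) e"
        using close[OF n(1)] \<sigma>(2) by blast
    qed
    then show "L2.mtopology derived_set_of S \<noteq> {}"
      by blast
  qed
  then show ?thesis
    using B by (simp add: directional_kronecker_def directional_kronecker_at_def orb_def B_def)
qed

lemma weakly_mixing_limit_const:
  assumes wm: "directionally_weakly_mixing \<mu> T \<beta>" and f: "f \<in> unit_functions"
  shows "directional_limit \<beta> {()} (\<lambda>_. f) (\<lambda>_ _. \<integral>x. f x \<partial>\<mu>)"
proof -
  obtain g where g: "limit_minimal \<beta> g" and fg: "directional_limit \<beta> {()} (\<lambda>_. f) (\<lambda>_. g)"
    using limit_minimal_exists[OF f] .
  have gu: "g \<in> unit_functions"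
    using g by (simp add: limit_minimal_def)
  have const: "AE x in \<mu>. g x = (\<integral>x. g x \<partial>\<mu>)"
  proof (rule ccontr)
    assume "\<not> (AE x in \<mu>. g x = (\<integral>x. g x \<partial>\<mu>))"
    then obtain c where c: "prob {x \<in> space \<mu>. g x = c} = 0"
      "0 < prob {x \<in> space \<mu>. g x > c}" "prob {x \<in> space \<mu>. g x > c} < 1"
      using nonconstant_splitting_level[OF gu] by blast
    show False
      using level_set_in_kronecker[OF g c(1)] wm c(2,3) unfolding directionally_weakly_mixing_def by force
  qed
  \<comment> \<open>Integrals pass to the limit, since the whole space is an admissible test set;
    this identifies the constant.\<close>
  have mean: "(\<integral>x. g x \<partial>\<mu>) = (\<integral>x. f x \<partial>\<mu>)"
    using directional_limit_integral[OF fg] f by simp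
  have "weight g B = weight (\<lambda>_. \<integral>x. f x \<partial>\<mu>) B" if "B \<in> events" for B
    unfolding weight_def using const that unit_functionsD(1)[OF gu]
    by (intro integral_cong_AE) (auto simp: mean elim!: eventually_mono)
  then have eq: "weight g B = (\<integral>x. f x \<partial>\<mu>) * prob B" if "B \<in> events" for B
    using that by (simp add: weight_def)
  show ?thesis
    unfolding directional_limit_def
  proof (intro allI impI)
    fix \<epsilon> :: real and \<D> assume \<epsilon>: "\<epsilon> > 0" and \<D>: "finite \<D> \<and> \<D> \<subseteq> events"
    obtain p where p: "\<bar>offset \<beta> p\<bar> < \<epsilon>"
      "\<And>i B. i \<in> {()} \<Longrightarrow> B \<in> \<D> \<Longrightarrow> \<bar>weight (f \<circ> T p) B - weight g B\<bar> < \<epsilon>"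
      using directional_limitD[OF fg \<epsilon>, of \<D>] \<D> by blast
    show "\<exists>p. \<bar>offset \<beta> p\<bar> < \<epsilon> \<and>
        (\<forall>i\<in>{()}. \<forall>B\<in>\<D>. \<bar>weight (f \<circ> T p) B - weight (\<lambda>_. \<integral>x. f x \<partial>\<mu>) B\<bar> < \<epsilon>)"
    proof (intro exI[of _ p] conjI ballI p(1))
      fix i B assume iB: "i \<in> {()}" "B \<in> \<D>"
      then have "B \<in> events"
        using \<D> by blast
      then show "\<bar>weight (f \<circ> T p) B - weight (\<lambda>_. \<integral>x. f x \<partial>\<mu>) B\<bar> < \<epsilon>"
        using p(2)[OF iB] eq by (simp add: weight_def)
    qed
  qed
qed

end

section \<open>Mixing along the strip\<close>

context Z2_mpds
begin

text \<open>Induction on the index set. With the functions on \<open>I\<close> already constant in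
  the limit, the remaining one has some limit \<open>g\<close>, and a further translation takes
  \<open>g\<close> to its mean while leaving constants as they are.\<close>

lemma weakly_mixing_joint_limit_const:
  assumes wm: "directionally_weakly_mixing \<mu> T \<beta>" and "finite I"
    and "\<And>i. i \<in> I \<Longrightarrow> f i \<in> unit_functions"
  shows "directional_limit \<beta> I f (\<lambda>i _. \<integral>x. f i x \<partial>\<mu>)"
  using assms(2,3)
proof (induction I rule: finite_induct)
  case empty
  show ?case
    unfolding directional_limit_def by (intro allI impI exI[of _ 0]) simp
next
  case (insert j I)
  define m where "m i = (\<integral>x. f i x \<partial>\<mu>)" for i
  have fu: "f i \<in> unit_functions" if "i \<in> insert j I" for i
    using insert.prems that .
  have mu: "(\<lambda>_. m i) \<in> unit_functions" if "i \<in> insert j I" for i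
  proof (rule unit_const)
    show "0 \<le> m i"
      unfolding m_def using fu[OF that] by (intro Bochner_Integration.integral_nonneg) (auto simp: unit_functions_def)
    show "m i \<le> 1"
      using weight_le_1[OF fu[OF that] sets.top] by (simp add: weight_space m_def)
  qed
  have IH: "directional_limit \<beta> I f (\<lambda>i _. m i)"
    unfolding m_def using insert.IH fu by simp
  obtain g where g: "g \<in> unit_functions" and lim: "directional_limit \<beta> (insert j I) f ((\<lambda>i _. m i)(j := g))"
    by (rule directional_limit_extend[OF insert.hyps IH]) (use fu mu in auto)
  have "(\<integral>x. g x \<partial>\<mu>) = m j"
    using directional_limit_integral[OF lim, of j] fu by (simp add: m_def)
  then have gm: "directional_limit \<beta> {()} (\<lambda>_. g) (\<lambda>_ _. m j)"
    using weakly_mixing_limit_const[OF wm g] by simp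
  have "directional_limit \<beta> (insert j I) ((\<lambda>i _. m i)(j := g)) (\<lambda>i _. m i)"
    unfolding directional_limit_def
  proof (intro allI impI)
    fix \<epsilon> :: real and \<D> assume \<epsilon>: "\<epsilon> > 0" and \<D>: "finite \<D> \<and> \<D> \<subseteq> events"
    obtain p where p: "\<bar>offset \<beta> p\<bar> < \<epsilon>"
      "\<And>i B. i \<in> {()} \<Longrightarrow> B \<in> \<D> \<Longrightarrow> \<bar>weight (g \<circ> T p) B - weight (\<lambda>_. m j) B\<bar> < \<epsilon>"
      using directional_limitD[OF gm \<epsilon>, of \<D>] \<D> by blast
    show "\<exists>p. \<bar>offset \<beta> p\<bar> < \<epsilon> \<and> (\<forall>i\<in>insert j I. \<forall>B\<in>\<D>.
        \<bar>weight (((\<lambda>i _. m i)(j := g)) i \<circ> T p) B - weight (\<lambda>_. m i) B\<bar> < \<epsilon>)"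
      using p \<epsilon> by (intro exI[of _ p]) (auto simp: o_def)
  qed
  with lim show ?case
    unfolding m_def[symmetric] by (rule directional_limit_trans) (use fu mu g in auto)
qed

text \<open>The limit relation does not exclude the times in \<open>F\<close>. Therefore
  \<open>p\<close> is corrected by a shift \<open>q\<close> from a supply \<open>Q\<close> with one
  element more than \<open>F\<close>. All test sets are translated by every \<open>q\<close>
  beforehand, so the estimate for \<open>p\<close> becomes one for \<open>p + q\<close>. Each of the
  two offsets takes half of \<open>b\<close>.\<close>

lemma weakly_mixing_independence:
  assumes wm: "directionally_weakly_mixing \<mu> T \<beta>" and I: "finite I" "\<And>i. i \<in> I \<Longrightarrow> A i \<in> events"
    and \<D>: "finite \<D>" "\<D> \<subseteq> events" and F: "finite F" and pos: "b > 0" "\<epsilon> > 0"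
  obtains p where "p \<in> strip \<beta> b" "p \<notin> F"
    "\<And>i B. i \<in> I \<Longrightarrow> B \<in> \<D> \<Longrightarrow> \<bar>prob (T p -` A i \<inter> B) - prob (A i) * prob B\<bar> < \<epsilon>"
proof -
  obtain Q where Q: "Q \<subseteq> strip \<beta> (b / 2)" "finite Q" "card Q = Suc (card F)"
    using infinite_arbitrarily_large[OF infinite_strip[OF half_gt_zero[OF pos(1)]]] by blast
  define \<D>' where "\<D>' = (\<lambda>(q, B). T (- q) -` B) ` (Q \<times> \<D>)"
  have \<D>': "finite \<D>'" "\<D>' \<subseteq> events"
    using Q(2) \<D> by (auto simp: \<D>'_def)
  have "directional_limit \<beta> I (\<lambda>i. indicator (A i)) (\<lambda>i _. prob (A i))"
    using weakly_mixing_joint_limit_const[OF wm I(1), of "\<lambda>i. indicator (A i)"] I(2)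
    unfolding directional_limit_def by (simp add: unit_indicator)
  moreover have "min \<epsilon> (b / 2) > 0"
    using pos by simp
  ultimately obtain p where p: "\<bar>offset \<beta> p\<bar> < min \<epsilon> (b / 2)"
    "\<And>i B. i \<in> I \<Longrightarrow> B \<in> \<D>' \<Longrightarrow> \<bar>weight (indicator (A i) \<circ> T p) B - weight (\<lambda>_. prob (A i)) B\<bar> < min \<epsilon> (b / 2)"
    using directional_limitD[OF _ _ \<D>'] by blast
  have "\<not> (\<lambda>q. p + q) ` Q \<subseteq> F"
  proof
    assume "(\<lambda>q. p + q) ` Q \<subseteq> F"
    then have "card Q \<le> card F"
      using card_mono[OF F] by (metis card_image inj_on_def add_left_cancel)
    then show False
      using Q(3) by simp
  qed
  then obtain q where q: "q \<in> Q" "p + q \<notin> F"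
    by blast
  show thesis
  proof
    show "p + q \<in> strip \<beta> b"
      using p(1) q(1) Q(1) by (force simp: strip_iff_offset)
    show "p + q \<notin> F"
      by fact
    fix i B assume i: "i \<in> I" and B: "B \<in> \<D>"
    then have ev: "A i \<in> events" "B \<in> events"
      using I \<D> by auto
    have "T (- q) -` B \<in> \<D>'"
      using q(1) B by (auto simp: \<D>'_def intro!: rev_image_eqI[of "(q, B)"])
    from p(2)[OF i this]
    have "\<bar>weight (indicator (A i) \<circ> T p) (T (- q) -` B) - weight (\<lambda>_. prob (A i)) (T (- q) -` B)\<bar> < \<epsilon>"
      by simp
    moreover have "weight (\<lambda>_. prob (A i)) (T (- q) -` B) = prob (A i) * prob B"
      using ev by (simp add: weight_def prob_vimage_T)
    moreover have "weight (indicator (A i) \<circ> T p) (T (- q) -` B) = prob (T (p + q) -` A i \<inter> B)"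
    proof -
      have "weight (indicator (A i) \<circ> T p) (T (- q) -` B) = weight ((indicator (A i) \<circ> T p) \<circ> T q) B"
        using ev by (intro weight_T[symmetric] unit_T unit_indicator)
      also have "\<dots> = (\<integral>x. indicator (T (p + q) -` A i \<inter> B) x \<partial>\<mu>)"
        unfolding weight_def by (intro Bochner_Integration.integral_cong) (auto simp: T_comp indicator_def)
      also have "\<dots> = prob (T (p + q) -` A i \<inter> B)"
        using ev by simp
      finally show ?thesis .
    qed
    ultimately show "\<bar>prob (T (p + q) -` A i \<inter> B) - prob (A i) * prob B\<bar> < \<epsilon>"
      by simp
  qed
qed

end

section \<open>Partitions and labellings\<close>

definition fibre_partition :: "('a \<Rightarrow> 'b) \<Rightarrow> 'a set set" where
  "fibre_partition X = range (\<lambda>x. {y. X y = X x})"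

lemma fibre_partitionE:
  assumes "A \<in> fibre_partition X"
  obtains z where "A = {y. X y = X z}"
  using assms by (auto simp: fibre_partition_def)

lemma preimage_fibre_partition:
  assumes "surj f"
  shows "preimage_partition f (fibre_partition X) = fibre_partition (\<lambda>x. X (f x))"
proof -
  have "preimage_partition f (fibre_partition X) = (\<lambda>x. {y. X (f y) = X x}) ` UNIV"
    by (auto simp: preimage_partition_def fibre_partition_def image_image vimage_def)
  also have "\<dots> = (\<lambda>x. {y. X (f y) = X x}) ` range f"
    using assms by simp
  finally show ?thesis
    by (simp add: fibre_partition_def image_image)
qed

text \<open>A choice of cells with nonempty intersection is determined by any point of the
  intersection: each chosen cell is the one containing that point.\<close>

lemma common_refinement_fibre_partition:
  "common_refinement ((\<lambda>i. fibre_partition (Y i)) ` I) = range (\<lambda>x. {y. \<forall>i\<in>I. Y i y = Y i x})"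
proof (intro subset_antisym subsetI)
  let ?P = "(\<lambda>i. fibre_partition (Y i)) ` I"
  fix A assume "A \<in> common_refinement ?P"
  then obtain f where f: "\<And>P. P \<in> ?P \<Longrightarrow> f P \<in> P" and A: "A = \<Inter> (f ` ?P)" "A \<noteq> {}"
    unfolding common_refinement by (auto simp: Pi_iff)
  obtain x where x: "x \<in> A"
    using A(2) by blast
  have "f (fibre_partition (Y i)) = {y. Y i y = Y i x}" if "i \<in> I" for i
  proof -
    have "f (fibre_partition (Y i)) \<in> fibre_partition (Y i)"
      using f that by blast
    then obtain z where z: "f (fibre_partition (Y i)) = {y. Y i y = Y i z}"
      by (rule fibre_partitionE)
    have "x \<in> f (fibre_partition (Y i))"
      using x that unfolding A(1) by blast
    then have "Y i x = Y i z"
      by (simp only: z mem_Collect_eq)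
    then show ?thesis
      using z by simp
  qed
  then have "(\<lambda>i. f (fibre_partition (Y i))) ` I = (\<lambda>i. {y. Y i y = Y i x}) ` I"
    by (intro image_cong refl)
  then have "A = {y. \<forall>i\<in>I. Y i y = Y i x}"
    unfolding A(1) image_image by (simp only:) blast
  then show "A \<in> range (\<lambda>x. {y. \<forall>i\<in>I. Y i y = Y i x})"
    by blast
next
  let ?P = "(\<lambda>i. fibre_partition (Y i)) ` I"
  fix A assume "A \<in> range (\<lambda>x. {y. \<forall>i\<in>I. Y i y = Y i x})"
  then obtain x where A: "A = {y. \<forall>i\<in>I. Y i y = Y i x}"
    by blast
  \<comment> \<open>The choice depends on the partition and not on an index, because equal
    partitions for different \<open>i\<close> coincide in \<open>?P\<close>; the union consists of
    the single cell of \<open>x\<close>.\<close>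
  define f where "f P = \<Union>{C \<in> P. x \<in> C}" for P
  have f: "f (fibre_partition (Y i)) = {y. Y i y = Y i x}" for i
    unfolding f_def fibre_partition_def by auto
  have "{y. Y i y = Y i x} \<in> fibre_partition (Y i)" for i
    unfolding fibre_partition_def by blast
  then have "f \<in> (\<Pi> P\<in>?P. P)"
    using f by auto
  moreover have "A = \<Inter> (f ` ?P)"
    unfolding A image_image f by blast
  moreover have "A \<noteq> {}"
    unfolding A by blast
  ultimately show "A \<in> common_refinement ?P"
    unfolding common_refinement by blast
qed

text \<open>Lists, because the number \<open>k\<close> of components varies.\<close>

definition joint :: "(nat \<Rightarrow> 'a \<Rightarrow> 'b) \<Rightarrow> nat \<Rightarrow> 'a \<Rightarrow> 'b list" where
  "joint Y k x = map (\<lambda>i. Y i x) [0..<k]"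

lemma joint_eq_iff: "joint Y k x = joint Y k y \<longleftrightarrow> (\<forall>i<k. Y i x = Y i y)"
  by (auto simp: joint_def)

lemma joint_0 [simp]: "joint Y 0 = (\<lambda>_. [])"
  by (simp add: joint_def fun_eq_iff)

text \<open>The point is countability: a labelling is coded by a finite list of naturals, so a dense
  sequence of sets yields a countable dense family of labellings. Points outside all listed sets
  receive the additional label \<open>length ns\<close>.\<close>

primrec first_hit :: "(nat \<Rightarrow> 'a set) \<Rightarrow> nat list \<Rightarrow> 'a \<Rightarrow> nat" where
  "first_hit D [] x = 0"
| "first_hit D (n # ns) x = (if x \<in> D n then 0 else Suc (first_hit D ns x))"

lemma first_hit_le: "first_hit D ns x \<le> length ns"
  by (induction ns) auto

lemma first_hit_eq:
  "j < length ns \<Longrightarrow> x \<in> D (ns ! j) \<Longrightarrow> (\<And>i. i < j \<Longrightarrow> x \<notin> D (ns ! i)) \<Longrightarrow> first_hit D ns x = j"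
proof (induction ns arbitrary: j)
  case (Cons n ns)
  show ?case
  proof (cases j)
    case 0
    then show ?thesis
      using Cons.prems by simp
  next
    case (Suc i)
    have "x \<notin> D n"
      using Cons.prems(3)[of 0] Suc by simp
    moreover have "first_hit D ns x = i"
    proof (rule Cons.IH)
      show "x \<notin> D (ns ! l)" if "l < i" for l
        using Cons.prems(3)[of "Suc l"] that Suc by simp
    qed (use Cons.prems Suc in auto)
    ultimately show ?thesis
      using Suc by simp
  qed
qed simp

context prob_space
begin

lemma simple_functionI_finite:
  assumes "finite (X ` space M)" "\<And>v. {x \<in> space M. X x = v} \<in> events"
  shows "simple_function M X"
proof -
  have "X -` {v} \<inter> space M = {x \<in> space M. X x = v}" for v
    by auto
  then show ?thesis
    using assms by (simp add: simple_function_def)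
qed

lemma simple_first_hit:
  assumes D: "range D \<subseteq> events"
  shows "simple_function M (first_hit D ns)"
proof (rule simple_functionI_finite)
  have "first_hit D ns ` space M \<subseteq> {..length ns}"
    using first_hit_le[of D ns] by (simp add: image_subset_iff)
  then show "finite (first_hit D ns ` space M)"
    by (rule finite_subset) simp
  show "{x \<in> space M. first_hit D ns x = v} \<in> events" for v
  proof (induction ns arbitrary: v)
    case (Cons n ns)
    have Dn: "D n \<in> events"
      using D by auto
    show ?case
    proof (cases v)
      case 0
      have "{x \<in> space M. first_hit D (n # ns) x = v} = D n"
        using sets.sets_into_space[OF Dn] 0 by auto
      then show ?thesis
        using Dn by simp
    next
      case (Suc w)
      have "{x \<in> space M. first_hit D (n # ns) x = v} = {x \<in> space M. first_hit D ns x = w} - D n"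
        using Suc by auto
      then show ?thesis
        using Dn Cons.IH[of w] by simp
    qed
  qed simp
qed

text \<open>The set listed at position \<open>i\<close> approximates the level set of
  \<open>i\<close>. Off the \<open>r\<close> error sets, \<open>x\<close> lies in the listed set of
  \<open>X x\<close> and in no other, so the first hit is exact.\<close>

lemma first_hit_approximation:
  assumes D: "measure_dense D" and X: "simple_function M X" and r: "X ` space M \<subseteq> {..<r}" and d: "d > 0"
  obtains ns where "length ns = r" "prob {x \<in> space M. X x \<noteq> first_hit D ns x} < d"
proof -
  define \<Delta> where "\<Delta> i n = ({x \<in> space M. X x = i} - D n) \<union> (D n - {x \<in> space M. X x = i})" for i n
  have Dev: "D n \<in> events" for n
    using D by (auto simp: measure_dense_def)
  have \<Delta>: "\<Delta> i n \<in> events" for i n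
    unfolding \<Delta>_def using Dev simple_level_sets[OF X] by (intro sets.Un sets.Diff)
  have pos: "0 < d / 2 / (real r + 1)"
    using d by simp
  have "\<exists>n. prob (\<Delta> i n) < d / 2 / (real r + 1)" for i
    using D simple_level_sets[OF X, of i] pos unfolding measure_dense_def \<Delta>_def by blast
  then obtain n where n: "\<And>i. prob (\<Delta> i (n i)) < d / 2 / (real r + 1)"
    by metis
  define ns where "ns = map n [0..<r]"
  have sub: "{x \<in> space M. X x \<noteq> first_hit D ns x} \<subseteq> (\<Union>i<r. \<Delta> i (n i))"
  proof (rule subsetI, rule ccontr)
    fix x assume x: "x \<in> {x \<in> space M. X x \<noteq> first_hit D ns x}" "x \<notin> (\<Union>i<r. \<Delta> i (n i))"
    have xM: "x \<in> space M"
      using x(1) by simp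
    have iff: "x \<in> D (n i) \<longleftrightarrow> X x = i" if "i < r" for i
    proof -
      have "x \<notin> \<Delta> i (n i)"
        using x(2) that by blast
      then show ?thesis
        unfolding \<Delta>_def using xM by blast
    qed
    have "X x < r"
      using r xM by blast
    then have "first_hit D ns x = X x"
      by (intro first_hit_eq) (simp_all add: ns_def iff)
    then show False
      using x(1) by simp
  qed
  have "prob {x \<in> space M. X x \<noteq> first_hit D ns x} \<le> prob (\<Union>i<r. \<Delta> i (n i))"
    using sub \<Delta> by (intro finite_measure_mono) auto
  also have "\<dots> \<le> (\<Sum>i<r. prob (\<Delta> i (n i)))"
    using \<Delta> by (intro finite_measure_subadditive_finite) auto
  also have "\<dots> \<le> (\<Sum>i<r. d / 2 / (real r + 1))"
    using n by (intro sum_mono less_imp_le)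
  also have "\<dots> \<le> d / 2"
    using divide_Suc_bound(2)[of "d / 2" "real r"] d by simp
  finally show thesis
    using d by (intro that[of ns]) (auto simp: ns_def)
qed

lemma simple_joint:
  assumes "\<And>i. simple_function M (Y i)"
  shows "simple_function M (joint Y k)"
proof (induction k)
  case (Suc k)
  have "joint Y (Suc k) = (\<lambda>x. (\<lambda>(l, v). l @ [v]) (joint Y k x, Y k x))"
    by (simp add: joint_def fun_eq_iff)
  then show ?case
    using simple_function_compose1[OF simple_Pair[OF Suc assms], of "\<lambda>(l, v). l @ [v]"] by simp
qed simp

lemma ent_joint_Suc:
  assumes "\<And>i. simple_function M (Y i)"
  shows "ent (joint Y (Suc k)) = ent (\<lambda>x. (joint Y k x, Y k x))"
  by (rule ent_cong) (auto simp: joint_eq_iff less_Suc_eq intro: simple_joint assms)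

text \<open>Conditional on \<open>W\<close>, the component \<open>Y i\<close> costs at most
  \<open>e\<close>, since it does so conditional on the coarser \<open>Z\<close>; the chain rule
  adds the costs. This compares two processes when \<open>W\<close> is a joint labelling of the same
  length, and it shows slow growth when \<open>W\<close> does not depend on
  \<open>k\<close>.\<close>

lemma ent_joint_conditional:
  assumes W: "simple_function M W" and Y: "\<And>i. simple_function M (Y i)"
    and close: "\<And>i. i < k \<Longrightarrow> \<exists>Z :: 'a \<Rightarrow> 'c. simple_function M Z \<and> (\<forall>x y. W x = W y \<longrightarrow> Z x = Z y)
      \<and> ent (\<lambda>x. (Z x, Y i x)) \<le> ent Z + e"
  shows "ent (joint Y k) \<le> ent W + real k * e"
proof -
  have "ent (\<lambda>x. (W x, joint Y k x)) \<le> ent W + real k * e"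
    using close
  proof (induction k)
    case 0
    have "ent (\<lambda>x. (W x, joint Y 0 x)) = ent W"
      using W by (intro ent_cong) auto
    then show ?case
      by simp
  next
    case (Suc k)
    let ?D = "\<lambda>x. (W x, joint Y k x)"
    obtain Z :: "'a \<Rightarrow> 'c" where Z: "simple_function M Z" "\<And>x y. W x = W y \<Longrightarrow> Z x = Z y"
      "ent (\<lambda>x. (Z x, Y k x)) \<le> ent Z + e"
      using Suc.prems[of k] by blast
    have D: "simple_function M ?D"
      using W Y by (intro simple_Pair simple_joint)
    have "ent (\<lambda>x. (?D x, Y k x)) - ent ?D \<le> ent (\<lambda>x. (Z x, Y k x)) - ent Z"
      using D Z(1) Y by (rule ent_increment_antimono) (use Z(2) in blast)
    moreover have "ent (\<lambda>x. (W x, joint Y (Suc k) x)) = ent (\<lambda>x. (?D x, Y k x))"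
    proof (rule ent_cong)
      show "simple_function M (\<lambda>x. (W x, joint Y (Suc k) x))"
        using W Y by (intro simple_Pair simple_joint)
      show "simple_function M (\<lambda>x. (?D x, Y k x))"
        using D Y by (rule simple_Pair)
    qed (auto simp: joint_eq_iff less_Suc_eq)
    ultimately show ?case
      using Suc Z(3) by (simp add: algebra_simps)
  qed
  moreover have "ent (joint Y k) \<le> ent (\<lambda>x. (W x, joint Y k x))"
    by (rule ent_mono) (auto intro: simple_joint W Y)
  ultimately show ?thesis
    by linarith
qed

lemma ent_joint_le_sum:
  assumes Y: "\<And>i. simple_function M (Y i)" and h: "\<And>i. ent (Y i) = h"
  shows "ent (joint Y k) \<le> real k * h"
proof (induction k)
  case (Suc k)
  have "ent (joint Y (Suc k)) \<le> ent (joint Y k) + ent (Y k)"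
    unfolding ent_joint_Suc[OF Y] using Y by (intro ent_subadditive simple_joint)
  then show ?case
    using Suc h by (simp add: algebra_simps)
qed simp

end

section \<open>From partitions to labels on the system\<close>

context Z2_mpds
begin

lemma partition_entropy_fibre:
  assumes X: "simple_function \<mu> X"
  shows "partition_entropy \<mu> (fibre_partition X) = ent X"
proof -
  have "fibre_partition X = (\<lambda>v. {y. X y = v}) ` range X"
    by (simp add: fibre_partition_def image_image)
  moreover have "inj_on (\<lambda>v. {y. X y = v}) (range X)"
    by (rule inj_onI) blast
  ultimately have "partition_entropy \<mu> (fibre_partition X)
      = - (\<Sum>v\<in>range X. prob {y. X y = v} * ln (prob {y. X y = v}))"
    by (simp add: partition_entropy_def sum.reindex)
  then show ?thesis
    by (simp add: ent_def eta_def law_def space_UNIV sum_negf)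
qed

lemma fibre_partition_measurable:
  assumes X: "simple_function \<mu> X"
  shows "finite_measurable_partition \<mu> (fibre_partition X)"
proof -
  have "fibre_partition X = (\<lambda>v. {y. X y = v}) ` range X"
    by (simp add: fibre_partition_def image_image)
  then have "finite (fibre_partition X)"
    using simple_functionD(1)[OF X] by (simp add: space_UNIV)
  moreover have "fibre_partition X \<subseteq> events"
    using simple_level_sets[OF X] by (auto simp: fibre_partition_def space_UNIV)
  moreover have "partition_on UNIV (fibre_partition X)"
    by (rule partition_onI) (auto simp: fibre_partition_def disjnt_def)
  ultimately show ?thesis
    by (simp add: finite_measurable_partition_def space_UNIV)
qed

lemma partition_labels:
  assumes \<alpha>: "finite_measurable_partition \<mu> \<alpha>"
  obtains X :: "'a \<Rightarrow> nat" and r where "simple_function \<mu> X" "range X \<subseteq> {..<r}" "\<alpha> = fibre_partition X"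
proof -
  have fin: "finite \<alpha>" and ev: "\<alpha> \<subseteq> events" and part: "partition_on UNIV \<alpha>"
    using \<alpha> by (auto simp: finite_measurable_partition_def space_UNIV)
  obtain h where h: "bij_betw h \<alpha> {0..<card \<alpha>}"
    using ex_bij_betw_finite_nat[OF fin] by blast
  have "\<exists>A\<in>\<alpha>. x \<in> A" for x
    using partition_onD1[OF part] by blast
  then obtain cell where cell: "\<And>x. cell x \<in> \<alpha>" "\<And>x. x \<in> cell x"
    by metis
  have cell_eq: "cell x = A" if "A \<in> \<alpha>" "x \<in> A" for x A
    using partition_onD2[OF part] cell[of x] that unfolding disjoint_def by blast
  define X where "X x = h (cell x)" for x
  have X_eq: "X y = X x \<longleftrightarrow> y \<in> cell x" for x y
    using h cell cell_eq unfolding X_def bij_betw_def inj_on_def by metis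
  have "range X \<subseteq> {..<card \<alpha>}"
    using h cell unfolding X_def bij_betw_def by fastforce
  moreover have "simple_function \<mu> X"
  proof (rule simple_functionI_finite)
    show "finite (X ` space \<mu>)"
      using \<open>range X \<subseteq> {..<card \<alpha>}\<close> by (metis finite_lessThan finite_subset space_UNIV)
    fix v
    show "{x \<in> space \<mu>. X x = v} \<in> events"
    proof (cases "v \<in> range X")
      case True
      then obtain x where "v = X x"
        by blast
      then have "{x \<in> space \<mu>. X x = v} = cell x"
        using X_eq by (auto simp: space_UNIV)
      then show ?thesis
        using cell ev by auto
    next
      case False
      then have "{x \<in> space \<mu>. X x = v} = {}"
        by auto
      then show ?thesis
        by (metis sets.empty_sets)
    qed
  qed
  moreover have "\<alpha> = fibre_partition X"
  proof -
    have "fibre_partition X = range cell"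
      by (simp add: fibre_partition_def X_eq)
    also have "\<dots> = \<alpha>"
    proof (intro subset_antisym subsetI)
      fix A assume A: "A \<in> \<alpha>"
      then obtain x where "x \<in> A"
        using partition_onD3[OF part] by (metis ex_in_conv)
      then show "A \<in> range cell"
        using cell_eq[OF A] by blast
    qed (use cell in auto)
    finally show ?thesis ..
  qed
  ultimately show thesis
    using that by blast
qed

lemma simple_T: "simple_function \<mu> X \<Longrightarrow> simple_function \<mu> (\<lambda>x. X (T p x))"
proof (rule simple_functionI_finite)
  assume X: "simple_function \<mu> X"
  show "finite ((\<lambda>x. X (T p x)) ` space \<mu>)"
    using simple_functionD(1)[OF X] by (rule finite_subset[rotated]) (auto simp: space_UNIV)
  have eq: "{x \<in> space \<mu>. X (T p x) = v} = T p -` {x \<in> space \<mu>. X x = v}" for v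
    by (auto simp: space_UNIV)
  show "{x \<in> space \<mu>. X (T p x) = v} \<in> events" for v
    unfolding eq by (intro vimage_T_events simple_level_sets X)
qed

lemma surj_T: "surj (T p)"
  by (rule surjI[of _ "T (- p)"]) simp

lemma ent_T:
  assumes X: "simple_function \<mu> X"
  shows "ent (\<lambda>x. X (T p x)) = ent X"
proof -
  have "law (\<lambda>x. X (T p x)) v = law X v" for v
  proof -
    have eq: "{x \<in> space \<mu>. X (T p x) = v} = T p -` {x \<in> space \<mu>. X x = v}"
      by (auto simp: space_UNIV)
    show ?thesis
      unfolding law_def eq by (intro prob_vimage_T simple_level_sets X)
  qed
  moreover have "(\<lambda>x. X (T p x)) ` space \<mu> = X ` space \<mu>"
    using surj_T[of p] by (metis image_image space_UNIV)
  ultimately show ?thesis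
    by (simp add: ent_def)
qed

lemma prob_neq_T:
  assumes X: "simple_function \<mu> X" and Y: "simple_function \<mu> Y"
  shows "prob {x \<in> space \<mu>. X (T p x) \<noteq> Y (T p x)} = prob {x \<in> space \<mu>. X x \<noteq> Y x}"
proof -
  have "{x \<in> space \<mu>. (X x = Y x) = False} \<in> events"
    by (rule simple_level_sets) (use X Y in \<open>rule simple_function_compose2\<close>)
  then have "{x \<in> space \<mu>. X x \<noteq> Y x} \<in> events"
    by simp
  moreover have "{x \<in> space \<mu>. X (T p x) \<noteq> Y (T p x)} = T p -` {x \<in> space \<mu>. X x \<noteq> Y x}"
    by (auto simp: space_UNIV)
  ultimately show ?thesis
    by (simp only: prob_vimage_T)
qed

lemma sequence_entropy_labels:
  assumes X: "simple_function \<mu> X"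
  shows "sequence_entropy \<mu> T S (fibre_partition X)
    = limsup (\<lambda>k. ereal (1 / real k * ent (joint (\<lambda>i x. X (T (S i) x)) k)))"
proof -
  have "common_refinement ((\<lambda>i. preimage_partition (T (S i)) (fibre_partition X)) ` {..<k})
      = fibre_partition (joint (\<lambda>i x. X (T (S i) x)) k)" for k
  proof -
    have "common_refinement ((\<lambda>i. preimage_partition (T (S i)) (fibre_partition X)) ` {..<k})
        = range (\<lambda>x. {y. \<forall>i\<in>{..<k}. X (T (S i) y) = X (T (S i) x)})"
      unfolding preimage_fibre_partition[OF surj_T] by (rule common_refinement_fibre_partition)
    also have "\<dots> = fibre_partition (joint (\<lambda>i x. X (T (S i) x)) k)"
      by (simp add: fibre_partition_def joint_eq_iff Ball_def)
    finally show ?thesis .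
  qed
  then show ?thesis
    unfolding sequence_entropy_def
    using partition_entropy_fibre[OF simple_joint[of "\<lambda>i x. X (T (S i) x)"]] simple_T[OF X] by simp
qed

end

section \<open>Sequences of full entropy\<close>

context prob_space
begin

lemma simple_membership:
  assumes "B \<in> events"
  shows "simple_function M (\<lambda>x. of_bool (x \<in> B) :: nat)"
proof (rule simple_functionI_finite)
  have "(\<lambda>x. of_bool (x \<in> B) :: nat) ` space M \<subseteq> {0, 1}"
    by auto
  then show "finite ((\<lambda>x. of_bool (x \<in> B) :: nat) ` space M)"
    by (rule finite_subset) simp
  have "{x \<in> space M. of_bool (x \<in> B) = v} = (if v = 0 then space M - B else if v = 1 then B else {})"
    for v :: nat
    using sets.sets_into_space[OF assms] by (auto simp: of_bool_def)
  then show "{x \<in> space M. of_bool (x \<in> B) = v} \<in> events" for v :: nat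
    using assms by simp
qed

end

context Z2_mpds
begin

text \<open>Near independence of \<open>W m\<close> and a translate of \<open>Y m\<close> concerns
  finitely many pairs of level sets, so one \<open>p\<close> can serve all
  \<open>m \<le> k\<close>.\<close>

lemma weakly_mixing_next_time:
  fixes W :: "nat \<Rightarrow> 'a \<Rightarrow> 'b" and Y :: "nat \<Rightarrow> 'a \<Rightarrow> nat"
  assumes wm: "directionally_weakly_mixing \<mu> T \<beta>" and b: "b > 0" and e: "e > 0" and F: "finite F"
    and W: "\<And>m. simple_function \<mu> (W m)" and Y: "\<And>m. simple_function \<mu> (Y m)"
  obtains p where "p \<in> strip \<beta> b" "p \<notin> F"
    "\<And>m. m \<le> k \<Longrightarrow> ent (W m) + ent (Y m) - e \<le> ent (\<lambda>x. (W m x, Y m (T p x)))"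
proof -
  define good where "good m d \<longleftrightarrow> (\<forall>Z. simple_function \<mu> Z \<longrightarrow> range Z \<subseteq> range (Y m) \<longrightarrow>
      (\<forall>w\<in>range (W m). \<forall>y\<in>range (Y m). \<bar>law (\<lambda>x. (W m x, Z x)) (w, y) - law (W m) w * law (Y m) y\<bar> < d) \<longrightarrow>
      ent (W m) + ent (Y m) - e \<le> ent (\<lambda>x. (W m x, Z x)))" for m d
  have "\<exists>d>0. good m d" for m
  proof (rule ent_near_independent[OF W[of m] Y[of m] e])
    fix d :: real
    assume d: "0 < d" and ind: "\<And>Z. simple_function \<mu> Z \<Longrightarrow> Z ` space \<mu> \<subseteq> Y m ` space \<mu> \<Longrightarrow>
      (\<And>w y. w \<in> W m ` space \<mu> \<Longrightarrow> y \<in> Y m ` space \<mu> \<Longrightarrow>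
        \<bar>law (\<lambda>x. (W m x, Z x)) (w, y) - law (W m) w * law (Y m) y\<bar> < d) \<Longrightarrow>
      ent (W m) + ent (Y m) - e \<le> ent (\<lambda>x. (W m x, Z x))"
    have "good m d"
      unfolding good_def by (intro allI impI ind) (simp_all only: space_UNIV Ball_def)
    with d show ?thesis
      by blast
  qed
  then obtain d where d: "\<And>m. d m > 0" and good: "\<And>m. good m (d m)"
    by metis
  \<comment> \<open>The tolerance \<open>d m\<close> depends on \<open>m\<close>; the minimum over
    finitely many is still positive.\<close>
  define d0 where "d0 = Min (d ` {..k})"
  have d0: "d0 > 0" "\<And>m. m \<le> k \<Longrightarrow> d0 \<le> d m"
    using d by (auto simp: d0_def)
  define I where "I = (SIGMA m:{..k}. range (Y m))"
  define \<D> where "\<D> = (\<Union>m\<le>k. (\<lambda>w. {x \<in> space \<mu>. W m x = w}) ` range (W m))"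
  have fin: "finite (range (W m))" "finite (range (Y m))" for m
    using simple_functionD(1)[OF W[of m]] simple_functionD(1)[OF Y[of m]] by (simp_all add: space_UNIV)
  have I: "finite I" and \<D>: "finite \<D>" "\<D> \<subseteq> events"
    using fin simple_level_sets[OF W] by (auto simp: I_def \<D>_def)
  define A where "A i = {x \<in> space \<mu>. Y (fst i) x = snd i}" for i
  have A: "A i \<in> events" for i
    unfolding A_def by (rule simple_level_sets[OF Y])
  obtain p where p: "p \<in> strip \<beta> b" "p \<notin> F"
    "\<And>i B. i \<in> I \<Longrightarrow> B \<in> \<D> \<Longrightarrow> \<bar>prob (T p -` A i \<inter> B) - prob (A i) * prob B\<bar> < d0"
    by (rule weakly_mixing_independence[where A=A, OF wm I A \<D> F b d0(1)]) (rule that)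
  show thesis
  proof
    show "p \<in> strip \<beta> b" "p \<notin> F"
      by fact+
    fix m assume m: "m \<le> k"
    show "ent (W m) + ent (Y m) - e \<le> ent (\<lambda>x. (W m x, Y m (T p x)))"
    proof (rule good[of m, unfolded good_def, rule_format])
      show "simple_function \<mu> (\<lambda>x. Y m (T p x))"
        using Y by (rule simple_T)
      show "range (\<lambda>x. Y m (T p x)) \<subseteq> range (Y m)"
        by auto
      fix w y assume w: "w \<in> range (W m)" and y: "y \<in> range (Y m)"
      have "(m, y) \<in> I" "{x \<in> space \<mu>. W m x = w} \<in> \<D>"
        using m w y unfolding I_def \<D>_def by blast+
      from p(3)[OF this] have "\<bar>prob (T p -` {x \<in> space \<mu>. Y m x = y} \<inter> {x \<in> space \<mu>. W m x = w})
          - law (Y m) y * law (W m) w\<bar> < d0"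
        by (simp add: law_def A_def)
      moreover have "T p -` {x \<in> space \<mu>. Y m x = y} \<inter> {x \<in> space \<mu>. W m x = w}
          = {x \<in> space \<mu>. (W m x, Y m (T p x)) = (w, y)}"
        by (auto simp: space_UNIV)
      ultimately show "\<bar>law (\<lambda>x. (W m x, Y m (T p x))) (w, y) - law (W m) w * law (Y m) y\<bar> < d m"
        using d0(2)[OF m] by (simp add: law_def mult.commute)
    qed
  qed
qed

text \<open>At step \<open>k\<close> only \<open>m \<le> k\<close> are treated, so the demands stay
  finite, and every \<open>m\<close> is treated from step \<open>m\<close> on. The loss
  \<open>1 / real (Suc k)\<close> tends to 0, so the increments approach full entropy.\<close>

lemma weakly_mixing_sequence:
  fixes Y :: "nat \<Rightarrow> 'a \<Rightarrow> nat"
  assumes wm: "directionally_weakly_mixing \<mu> T \<beta>" and b: "b > 0"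
    and Y: "\<And>m. simple_function \<mu> (Y m)"
  obtains S where "inj S" "range S \<subseteq> strip \<beta> b"
    "\<And>m k. m \<le> k \<Longrightarrow> ent (joint (\<lambda>i x. Y m (T (S i) x)) k) + ent (Y m) - 1 / real (Suc k)
      \<le> ent (joint (\<lambda>i x. Y m (T (S i) x)) (Suc k))"
proof -
  define J where "J f k m = joint (\<lambda>i x. Y m (T (f i) x)) k" for f :: "nat \<Rightarrow> int \<times> int" and k m
  define P where "P f k p \<longleftrightarrow> p \<in> strip \<beta> b \<and> p \<notin> f ` {..<k} \<and>
    (\<forall>m\<le>k. ent (J f k m) + ent (Y m) - 1 / real (Suc k) \<le> ent (\<lambda>x. (J f k m x, Y m (T p x))))"
    for f :: "nat \<Rightarrow> int \<times> int" and k p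
  have simple: "simple_function \<mu> (J f k m)" for f k m
    unfolding J_def by (intro simple_joint simple_T Y)
  \<comment> \<open>\<open>P f k\<close> looks only at the values of \<open>f\<close> below
    \<open>k\<close>, so the times can be chosen recursively.\<close>
  have "\<exists>S. \<forall>k. P S k (S k)"
  proof (rule dependent_wellorder_choice)
    fix r :: "int \<times> int" and f g :: "nat \<Rightarrow> int \<times> int" and k :: nat
    assume fg: "\<And>y. y < k \<Longrightarrow> f y = g y"
    have "J f k m = J g k m" for m
      using fg by (simp add: J_def joint_def fun_eq_iff)
    moreover have "f ` {..<k} = g ` {..<k}"
      using fg by (intro image_cong) auto
    ultimately show "P f k r = P g k r"
      by (simp add: P_def)
  next
    fix k :: nat and f :: "nat \<Rightarrow> int \<times> int"
    obtain p where "p \<in> strip \<beta> b" "p \<notin> f ` {..<k}"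
      "\<And>m. m \<le> k \<Longrightarrow> ent (J f k m) + ent (Y m) - 1 / real (Suc k) \<le> ent (\<lambda>x. (J f k m x, Y m (T p x)))"
      by (rule weakly_mixing_next_time[OF wm b, of "1 / real (Suc k)" "f ` {..<k}" "J f k" Y k])
         (use simple Y in auto)
    then show "\<exists>p. P f k p"
      unfolding P_def by blast
  qed
  then obtain S where S: "\<And>k. P S k (S k)"
    by blast
  show thesis
  proof
    show "range S \<subseteq> strip \<beta> b"
      using S by (auto simp: P_def)
    have "S i \<noteq> S k" if "i < k" for i k
      using S[of k] that unfolding P_def by (metis imageI lessThan_iff)
    then show "inj S"
      by (intro injI) (metis linorder_neqE_nat)
    fix m k :: nat assume "m \<le> k"
    then have "ent (J S k m) + ent (Y m) - 1 / real (Suc k) \<le> ent (\<lambda>x. (J S k m x, Y m (T (S k) x)))"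
      using S[of k] by (simp add: P_def)
    moreover have "ent (J S (Suc k) m) = ent (\<lambda>x. (J S k m x, Y m (T (S k) x)))"
      unfolding J_def by (intro ent_joint_Suc simple_T Y)
    ultimately show "ent (joint (\<lambda>i x. Y m (T (S i) x)) k) + ent (Y m) - 1 / real (Suc k)
        \<le> ent (joint (\<lambda>i x. Y m (T (S i) x)) (Suc k))"
      unfolding J_def by simp
  qed
qed

text \<open>The bound \<open>Suc r\<close> leaves room for one label more than \<open>X\<close> may
  use, given to the points missed by all listed sets.\<close>

lemma dense_labels:
  obtains Y :: "nat \<Rightarrow> 'a \<Rightarrow> nat" where "\<And>m. simple_function \<mu> (Y m)"
    "\<And>(X :: 'a \<Rightarrow> nat) r d. simple_function \<mu> X \<Longrightarrow> range X \<subseteq> {..<r} \<Longrightarrow> d > 0 \<Longrightarrow>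
      \<exists>m. range (Y m) \<subseteq> {..<Suc r} \<and> prob {x \<in> space \<mu>. X x \<noteq> Y m x} < d"
proof -
  obtain D where D: "measure_dense D"
    using dense_sequence .
  show thesis
  proof (rule that[of "\<lambda>m. first_hit D (from_nat m)"])
    show "simple_function \<mu> (first_hit D (from_nat m))" for m
      using D by (intro simple_first_hit) (simp add: measure_dense_def)
    fix X :: "'a \<Rightarrow> nat" and r and d :: real
    assume X: "simple_function \<mu> X" "range X \<subseteq> {..<r}" "d > 0"
    then obtain ns where ns: "length ns = r" "prob {x \<in> space \<mu>. X x \<noteq> first_hit D ns x} < d"
      using first_hit_approximation[OF D X(1), of r d] unfolding space_UNIV by blast
    have "range (first_hit D ns) \<subseteq> {..<Suc r}"
      using first_hit_le[of D ns] ns(1) by (auto simp: less_Suc_eq_le)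
    with ns(2) show "\<exists>m. range (first_hit D (from_nat m)) \<subseteq> {..<Suc r} \<and>
        prob {x \<in> space \<mu>. X x \<noteq> first_hit D (from_nat m) x} < d"
      by (intro exI[of _ "to_nat ns"]) simp
  qed
qed

lemma weakly_mixing_full_entropy:
  assumes wm: "directionally_weakly_mixing \<mu> T \<beta>" and b: "b > 0"
  obtains S where "inj S" "range S \<subseteq> strip \<beta> b"
    "\<And>\<alpha>. finite_measurable_partition \<mu> \<alpha> \<Longrightarrow> sequence_entropy \<mu> T S \<alpha> = ereal (partition_entropy \<mu> \<alpha>)"
proof -
  obtain Y :: "nat \<Rightarrow> 'a \<Rightarrow> nat" where Y: "\<And>m. simple_function \<mu> (Y m)"
    and dense: "\<And>(X :: 'a \<Rightarrow> nat) r d. simple_function \<mu> X \<Longrightarrow> range X \<subseteq> {..<r} \<Longrightarrow> d > 0 \<Longrightarrow>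
      \<exists>m. range (Y m) \<subseteq> {..<Suc r} \<and> prob {x \<in> space \<mu>. X x \<noteq> Y m x} < d"
    by (rule dense_labels) (rule that)
  obtain S where S: "inj S" "range S \<subseteq> strip \<beta> b"
    and increment: "\<And>m k. m \<le> k \<Longrightarrow> ent (joint (\<lambda>i x. Y m (T (S i) x)) k) + ent (Y m) - 1 / real (Suc k)
      \<le> ent (joint (\<lambda>i x. Y m (T (S i) x)) (Suc k))"
    by (rule weakly_mixing_sequence[where Y=Y, OF wm b Y]) (rule that)
  show thesis
  proof (rule that[OF S])
    fix \<alpha> assume "finite_measurable_partition \<mu> \<alpha>"
    then obtain X :: "'a \<Rightarrow> nat" and r where X: "simple_function \<mu> X" "range X \<subseteq> {..<r}"
      and \<alpha>: "\<alpha> = fibre_partition X"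
      by (rule partition_labels)
    define H where "H = ent X"
    define JX where "JX k = ent (joint (\<lambda>i x. X (T (S i) x)) k)" for k
    have upper: "JX k \<le> real k * H" for k
      unfolding JX_def H_def by (intro ent_joint_le_sum simple_T ent_T X)
    \<comment> \<open>There are three losses of \<open>e\<close> per step: from \<open>ent X\<close>
      to \<open>ent (Y m)\<close>, in the increments once their error is below \<open>e\<close>, and
      from the joint entropies of \<open>Y m\<close> back to those of \<open>X\<close>. The constant
      \<open>C\<close> absorbs the initial steps.\<close>
    have lower: "\<exists>C. \<forall>k. real k * (H - 3 * e) - C \<le> JX k" if e: "e > 0" for e
    proof -
      obtain d where d: "d > 0" "\<And>X Y. simple_function \<mu> X \<Longrightarrow> simple_function \<mu> Y \<Longrightarrow>
          X ` space \<mu> \<subseteq> {..<Suc r} \<Longrightarrow> Y ` space \<mu> \<subseteq> {..<Suc r} \<Longrightarrow>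
          prob {x \<in> space \<mu>. X x \<noteq> Y x} < d \<Longrightarrow> ent (\<lambda>x. (X x, Y x)) \<le> ent X + e"
        by (rule ent_joint_close[OF e, of "Suc r"]) (rule that)
      obtain m where m: "range (Y m) \<subseteq> {..<Suc r}" "prob {x \<in> space \<mu>. X x \<noteq> Y m x} < d"
        using dense[OF X d(1)] by blast
      have X_range: "range X \<subseteq> {..<Suc r}"
        using X(2) by (auto intro: less_SucI)
      define JY where "JY k = ent (joint (\<lambda>i x. Y m (T (S i) x)) k)" for k
      have HY: "H - e \<le> ent (Y m)"
      proof -
        have "ent (\<lambda>x. (Y m x, X x)) \<le> ent (Y m) + e"
        proof (rule d(2)[OF Y X(1)])
          show "prob {x \<in> space \<mu>. Y m x \<noteq> X x} < d"
            using m(2) by (simp only: neq_commute)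
        qed (use m(1) X_range in \<open>simp_all add: space_UNIV\<close>)
        moreover have "ent X \<le> ent (\<lambda>x. (Y m x, X x))"
          using X Y by (intro ent_mono) auto
        ultimately show ?thesis
          by (simp add: H_def)
      qed
      have XY: "JY k \<le> JX k + real k * e" for k
        unfolding JX_def JY_def
      proof (rule ent_joint_conditional)
        show "simple_function \<mu> (joint (\<lambda>i x. X (T (S i) x)) k)"
          by (intro simple_joint simple_T X)
        show "simple_function \<mu> (\<lambda>x. Y m (T (S i) x))" for i
          by (intro simple_T Y)
        fix i assume i: "i < k"
        have "ent (\<lambda>x. (X (T (S i) x), Y m (T (S i) x))) \<le> ent (\<lambda>x. X (T (S i) x)) + e"
        proof (rule d(2)[OF simple_T[OF X(1)] simple_T[OF Y]])
          show "prob {x \<in> space \<mu>. X (T (S i) x) \<noteq> Y m (T (S i) x)} < d"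
            using m(2) prob_neq_T[OF X(1) Y] by simp
        qed (use m(1) X_range in \<open>auto simp: space_UNIV\<close>)
        then show "\<exists>Z :: 'a \<Rightarrow> nat. simple_function \<mu> Z \<and>
            (\<forall>x y. joint (\<lambda>i x. X (T (S i) x)) k x = joint (\<lambda>i x. X (T (S i) x)) k y \<longrightarrow> Z x = Z y) \<and>
            ent (\<lambda>x. (Z x, Y m (T (S i) x))) \<le> ent Z + e"
          using i by (intro exI[of _ "\<lambda>x. X (T (S i) x)"]) (auto simp: joint_eq_iff intro: simple_T X)
      qed
      obtain K where K: "m \<le> K" "1 / real (Suc K) < e"
      proof -
        obtain N where "1 / real (Suc N) < e"
          using nat_approx_posE[OF e] .
        moreover have "1 / real (Suc (max m N)) \<le> 1 / real (Suc N)"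
          by (intro divide_left_mono) auto
        ultimately show thesis
          by (intro that[of "max m N"]) auto
      qed
      \<comment> \<open>Increments are controlled only from \<open>K\<close> on. The subtracted
        constant makes the bound trivial up to \<open>K\<close>; the absolute value is taken because
        \<open>H - 2 * e\<close> may be negative.\<close>
      have JY: "real k * (H - 2 * e) - real K * \<bar>H - 2 * e\<bar> \<le> JY k" for k
      proof (cases "K \<le> k")
        case True
        then show ?thesis
        proof (induction k rule: dec_induct)
          case base
          have "real K * (H - 2 * e) \<le> real K * \<bar>H - 2 * e\<bar>"
            by (intro mult_left_mono) auto
          moreover have "0 \<le> JY K"
            unfolding JY_def by (rule ent_nonneg)
          ultimately show ?case
            by linarith
        next
          case (step k)
          have "1 / real (Suc k) \<le> 1 / real (Suc K)"
            using step.hyps by (intro divide_left_mono) auto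
          moreover have "JY k + ent (Y m) - 1 / real (Suc k) \<le> JY (Suc k)"
            unfolding JY_def using K(1) step.hyps by (intro increment) auto
          ultimately have "JY k + (H - 2 * e) \<le> JY (Suc k)"
            using HY K(2) by linarith
          then show ?case
            using step.IH by (simp add: algebra_simps)
        qed
      next
        case False
        then have "real k * \<bar>H - 2 * e\<bar> \<le> real K * \<bar>H - 2 * e\<bar>"
          by (intro mult_right_mono) auto
        moreover have "real k * (H - 2 * e) \<le> real k * \<bar>H - 2 * e\<bar>"
          by (intro mult_left_mono) auto
        moreover have "0 \<le> JY k"
          unfolding JY_def by (rule ent_nonneg)
        ultimately show ?thesis
          by linarith
      qed
      have "real k * (H - 3 * e) - real K * \<bar>H - 2 * e\<bar> \<le> JX k" for k
        using XY[of k] JY[of k] by (simp add: algebra_simps)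
      then show ?thesis
        by blast
    qed
    have "(\<lambda>k. 1 / real k * JX k) \<longlonglongrightarrow> H"
    proof (rule metric_LIMSEQ_I)
      fix e :: real assume e: "e > 0"
      \<comment> \<open>\<open>3 * (e / 6)\<close> is half of \<open>e\<close>; the other half
        outweighs \<open>C\<close> once \<open>k\<close> exceeds
        \<open>2 * \<bar>C\<bar> / e\<close>.\<close>
      then obtain C where C: "\<And>k. real k * (H - 3 * (e / 6)) - C \<le> JX k"
        using lower[of "e / 6"] by auto
      obtain N :: nat where N: "real N > 2 * \<bar>C\<bar> / e"
        using reals_Archimedean2 by blast
      have "dist (1 / real k * JX k) H < e" if k: "k \<ge> Suc N" for k
      proof -
        have pos: "real k > 0"
          using k by simp
        have "2 * \<bar>C\<bar> / e < real k"
          using N k by linarith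
        then have Ck: "2 * \<bar>C\<bar> < real k * e"
          using e by (simp add: pos_divide_less_eq)
        have "1 / real k * JX k \<le> H"
          using upper[of k] pos by (simp add: pos_divide_le_eq mult.commute)
        moreover have "H - e < 1 / real k * JX k"
        proof -
          have "real k * (H - e) < real k * (H - e / 2) - C"
            using Ck by (simp add: algebra_simps)
          also have "\<dots> \<le> JX k"
            using C[of k] by simp
          finally show ?thesis
            using pos by (simp add: pos_less_divide_eq mult.commute)
        qed
        ultimately show ?thesis
          using e unfolding dist_real_def by linarith
      qed
      then show "\<exists>N. \<forall>k\<ge>N. dist (1 / real k * JX k) H < e"
        by blast
    qed
    then have "limsup (\<lambda>k. ereal (1 / real k * JX k)) = ereal H"
      by (intro lim_imp_Limsup) auto
    then show "sequence_entropy \<mu> T S \<alpha> = ereal (partition_entropy \<mu> \<alpha>)"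
      unfolding \<alpha> sequence_entropy_labels[OF X(1)] partition_entropy_fibre[OF X(1)]
      by (simp add: JX_def H_def)
  qed
qed

section \<open>The converse: zero entropy on the Kronecker algebra\<close>

lemma kronecker_orbit_net:
  assumes B: "B \<in> directional_kronecker \<mu> T \<beta>" and b: "b > 0" and d: "d > 0"
  obtains Q where "finite Q"
    "\<And>p. p \<in> strip \<beta> b \<Longrightarrow> \<exists>q\<in>Q. prob ((T q -` B - T p -` B) \<union> (T p -` B - T q -` B)) < d"
proof -
  interpret L2: Metric_space "L2_space \<mu>" "L2_dist \<mu>"
    by (rule Metric_space_L2)
  define orb where "orb = {L2_class \<mu> (koopman T p (indicator B)) | p. p \<in> strip \<beta> b}"
  have ev: "B \<in> events" and "compactin L2.mtopology (L2.mtopology closure_of orb)"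
    using B directional_kronecker_at_eq[OF b, of \<beta>] by (auto simp: directional_kronecker_at_def orb_def)
  moreover have "orb \<subseteq> L2_space \<mu>"
    using ev by (auto simp: orb_def intro!: L2_class_in_space koopman_L2 indicator_L2)
  ultimately have "L2.mtotally_bounded orb"
    using L2.compact_closure_of_imp_mtotally_bounded by blast
  \<comment> \<open>The radius is \<open>sqrt d\<close>, because the distance of two indicators is
    the square root of the measure of the symmetric difference.\<close>
  then obtain K where K: "finite K" "K \<subseteq> orb" "orb \<subseteq> (\<Union>F\<in>K. L2.mball F (sqrt d))"
    using d unfolding L2.mtotally_bounded_def by (meson real_sqrt_gt_zero)
  have "\<forall>F\<in>K. \<exists>q. F = L2_class \<mu> (indicator (T q -` B))"
    using K(2) unfolding orb_def koopman_indicator by blast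
  then obtain q where q: "\<And>F. F \<in> K \<Longrightarrow> F = L2_class \<mu> (indicator (T (q F) -` B))"
    by metis
  show thesis
  proof
    show "finite (q ` K)"
      using K(1) by simp
    fix p assume "p \<in> strip \<beta> b"
    then have "L2_class \<mu> (indicator (T p -` B)) \<in> orb"
      unfolding orb_def koopman_indicator by blast
    then obtain F where F: "F \<in> K" "L2_class \<mu> (indicator (T p -` B)) \<in> L2.mball F (sqrt d)"
      using K(3) by blast
    have "L2_dist \<mu> (L2_class \<mu> (indicator (T (q F) -` B))) (L2_class \<mu> (indicator (T p -` B))) < sqrt d"
      using F q[OF F(1)] by simp
    then have "prob ((T (q F) -` B - T p -` B) \<union> (T p -` B - T (q F) -` B)) < d"
      using ev by (subst (asm) L2_dist_indicator) auto
    then show "\<exists>q\<in>q ` K. prob ((T q -` B - T p -` B) \<union> (T p -` B - T q -` B)) < d"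
      using F(1) by blast
  qed
qed

text \<open>The labels of a finite net of translates, collected in \<open>W\<close>, nearly
  determine those of every translate in the strip. \<open>W\<close> does not depend on
  \<open>k\<close>, so beyond a constant the entropy grows by at most \<open>e\<close> per
  step.\<close>

lemma kronecker_zero_entropy:
  assumes B: "B \<in> directional_kronecker \<mu> T \<beta>" and b: "b > 0" and S: "range S \<subseteq> strip \<beta> b"
  defines "X \<equiv> (\<lambda>x. of_bool (x \<in> B) :: nat)"
  shows "sequence_entropy \<mu> T S (fibre_partition X) \<le> 0"
proof -
  have ev: "B \<in> events"
    using B by (simp add: directional_kronecker_def directional_kronecker_at_def)
  have X_range: "range X \<subseteq> {..<2}"
    by (auto simp: X_def of_bool_def)
  have X: "simple_function \<mu> X"
    unfolding X_def using ev by (rule simple_membership)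
  define JX where "JX k = ent (joint (\<lambda>i x. X (T (S i) x)) k)" for k
  have bound: "\<exists>C. \<forall>k. JX k \<le> C + real k * e" if e: "e > 0" for e
  proof -
    obtain d where d: "d > 0" "\<And>X Y. simple_function \<mu> X \<Longrightarrow> simple_function \<mu> Y \<Longrightarrow>
        X ` space \<mu> \<subseteq> {..<2::nat} \<Longrightarrow> Y ` space \<mu> \<subseteq> {..<2} \<Longrightarrow>
        prob {x \<in> space \<mu>. X x \<noteq> Y x} < d \<Longrightarrow> ent (\<lambda>x. (X x, Y x)) \<le> ent X + e"
      by (rule ent_joint_close[OF e, of 2]) (rule that)
    obtain Q where Q: "finite Q"
      "\<And>p. p \<in> strip \<beta> b \<Longrightarrow> \<exists>q\<in>Q. prob ((T q -` B - T p -` B) \<union> (T p -` B - T q -` B)) < d"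
      using kronecker_orbit_net[OF B b d(1)] by blast
    obtain qs where qs: "set qs = Q"
      using finite_list[OF Q(1)] by blast
    define W where "W = joint (\<lambda>i x. X (T (qs ! i) x)) (length qs)"
    have W: "simple_function \<mu> W"
      unfolding W_def by (intro simple_joint simple_T X)
    have "JX k \<le> ent W + real k * e" for k
      unfolding JX_def
    proof (rule ent_joint_conditional[OF W])
      show "simple_function \<mu> (\<lambda>x. X (T (S i) x))" for i
        by (intro simple_T X)
      fix i
      obtain q where q: "q \<in> Q" "prob ((T q -` B - T (S i) -` B) \<union> (T (S i) -` B - T q -` B)) < d"
        using Q(2)[of "S i"] S by blast
      have "ent (\<lambda>x. (X (T q x), X (T (S i) x))) \<le> ent (\<lambda>x. X (T q x)) + e"
      proof (rule d(2)[OF simple_T[OF X] simple_T[OF X]])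
        have "{x \<in> space \<mu>. X (T q x) \<noteq> X (T (S i) x)} = (T q -` B - T (S i) -` B) \<union> (T (S i) -` B - T q -` B)"
          by (auto simp: X_def space_UNIV)
        with q(2) show "prob {x \<in> space \<mu>. X (T q x) \<noteq> X (T (S i) x)} < d"
          by simp
      qed (use X_range in \<open>auto simp: space_UNIV\<close>)
      moreover obtain j where j: "j < length qs" "qs ! j = q"
        using q(1) qs by (metis in_set_conv_nth)
      have determined: "X (T q x) = X (T q y)" if "W x = W y" for x y
      proof -
        have "\<forall>i<length qs. X (T (qs ! i) x) = X (T (qs ! i) y)"
          using that unfolding W_def joint_eq_iff .
        then show ?thesis
          using j by blast
      qed
      ultimately show "\<exists>Z :: 'a \<Rightarrow> nat. simple_function \<mu> Z \<and> (\<forall>x y. W x = W y \<longrightarrow> Z x = Z y) \<and>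
          ent (\<lambda>x. (Z x, X (T (S i) x))) \<le> ent Z + e"
        by (intro exI[of _ "\<lambda>x. X (T q x)"] conjI allI impI simple_T[OF X] determined)
    qed
    then show ?thesis
      by blast
  qed
  have "limsup (\<lambda>k. ereal (1 / real k * JX k)) \<le> 0 + ereal e" if e: "e > 0" for e
  proof -
    obtain C where C: "\<And>k. JX k \<le> C + real k * (e / 2)"
      using bound[of "e / 2"] e by auto
    obtain N :: nat where N: "real N > 2 * \<bar>C\<bar> / e"
      using reals_Archimedean2 by blast
    have "1 / real k * JX k \<le> e" if k: "k \<ge> Suc N" for k
    proof -
      have "2 * \<bar>C\<bar> / e < real k"
        using N k by linarith
      then have "2 * \<bar>C\<bar> < real k * e"
        using e by (simp add: pos_divide_less_eq)
      then have "JX k \<le> real k * e"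
        using C[of k] by simp
      then show ?thesis
        using k by (simp add: pos_divide_le_eq mult.commute)
    qed
    then show ?thesis
      by (intro Limsup_bounded) (auto intro!: eventually_sequentiallyI[of "Suc N"])
  qed
  then have "limsup (\<lambda>k. ereal (1 / real k * JX k)) \<le> 0"
    by (rule ereal_le_epsilon2)
  then show ?thesis
    unfolding sequence_entropy_labels[OF X] JX_def .
qed

text \<open>A nontrivial set of the Kronecker algebra and its complement would form a partition of
  positive entropy whose sequence entropy vanishes.\<close>

lemma full_entropy_weakly_mixing:
  assumes b: "b > 0" and S: "range S \<subseteq> strip \<beta> b"
    and full: "\<And>\<alpha>. finite_measurable_partition \<mu> \<alpha> \<Longrightarrow> sequence_entropy \<mu> T S \<alpha> = ereal (partition_entropy \<mu> \<alpha>)"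
  shows "directionally_weakly_mixing \<mu> T \<beta>"
  unfolding directionally_weakly_mixing_def
proof (rule ballI, rule ccontr)
  fix B assume B: "B \<in> directional_kronecker \<mu> T \<beta>" and nt: "\<not> (prob B = 0 \<or> prob B = 1)"
  define X where "X = (\<lambda>x. of_bool (x \<in> B) :: nat)"
  have ev: "B \<in> events"
    using B by (simp add: directional_kronecker_def directional_kronecker_at_def)
  have X: "simple_function \<mu> X"
    unfolding X_def using ev by (rule simple_membership)
  have "ereal (ent X) \<le> 0"
    using kronecker_zero_entropy[OF B b S] full[OF fibre_partition_measurable[OF X]]
    unfolding X_def[symmetric] partition_entropy_fibre[OF X] by simp
  then have "ent X \<le> 0"
    by simp
  moreover have "0 < eta (prob B)"
    using nt by (intro eta_pos) (auto simp: less_le)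
  moreover have "eta (prob B) \<le> ent X"
  proof -
    have "{x \<in> space \<mu>. X x = 1} = B"
      by (auto simp: X_def space_UNIV)
    then have "eta (prob B) = eta (law X 1)"
      by (simp add: law_def)
    also have "\<dots> \<le> (\<Sum>v\<in>{0, 1}. eta (law X v))"
      using eta_nonneg[of "law X 0"] by simp
    also have "\<dots> = ent X"
      by (rule ent_superset[symmetric]) (auto simp: X_def)
    finally show ?thesis .
  qed
  ultimately show False
    by linarith
qed

end

theorem theorem1p4:
  fixes \<mu> :: "'a::metric_space measure"
    and T :: "int \<times> int \<Rightarrow> 'a \<Rightarrow> 'a"
    and \<beta> b :: real
  assumes "Z2_mpds \<mu> T"
    and "\<beta> \<notin> \<rat>"
    and "b > 0"
  shows "directionally_weakly_mixing \<mu> T \<beta> \<longleftrightarrow>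
    (\<exists>S :: nat \<Rightarrow> int \<times> int. inj S \<and> range S \<subseteq> strip \<beta> b \<and>
      (\<forall>\<alpha>. finite_measurable_partition \<mu> \<alpha> \<longrightarrow>
        sequence_entropy \<mu> T S \<alpha> = ereal (partition_entropy \<mu> \<alpha>)))"
proof -
  interpret Z2_mpds \<mu> T
    by fact
  show ?thesis
    using weakly_mixing_full_entropy[OF _ \<open>b > 0\<close>] full_entropy_weakly_mixing[OF \<open>b > 0\<close>] by metis
qed

end
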